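(* Let $D\subset\Omega\subset\square\subset\mathbb{R}^d$ be domains, $m\in\mathbb{N}$ and $I\subset\mathbb{R}$ a time interval. Let $E_D:H_0^m(D)\to V(\Omega):=E_D(H_0^m(D))\subset H_0^m(\Omega)$ and $E_\square:H_0^m(\Omega)\to U(\square):=E_\square(H_0^m(\Omega))\subset H_0^m(\square)$ be the zero-extension operators onto their ranges (with inherited norms). Define $E_{I\times D}:L_2(I;H_0^m(D))\to L_2(I;V(\Omega))$ by $(E_{I\times D}v)(t):=E_D(v(t))$ and $E_{I\times\square}:L_2(I;H_0^m(\Omega))\to L_2(I;U(\square))$ by $(E_{I\times\square}v)(t):=E_\square(v(t))$ for a.e. $t\in I$, and let $R_{I\times\square}:=E_{I\times\square}^{-1}$. Let $r_\Omega\in L_2(I;H^{-m}(\Omega))$ and set $r_D:=E_{I\times D}'\big(r_\Omega|_{L_2(I;V(\Omega))}\big)$. Then $$\|r_D\|_{L_2(I;H^{-m}(D))}\le\|r_\Omega\|_{L_2(I;H^{-m}(\Omega))}\le\|r_\square\|_{L_2(I;H^{-m}(\square))}$$ for all $r_\square\in\mathcal{E}\big(R_{I\times\square}'r_\Omega;L_2(I;H^{-m}(\square))\big)$.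
   Context: $H_0^m(G)$ is the real Sobolev space, i.e. the closure of $C_c^\infty(G)$ in $H^m(G)$, with norm $\|u\|^2=\sum_{|\alpha|\le m}\|D^\alpha u\|_{L_2(G)}^2$; $H^{-m}(G):=(H_0^m(G))'$ with the dual norm. The zero-extension operator from $G_1$ to $G_2\supset G_1$ maps $u\in H_0^m(G_1)$ to the function on $G_2$ equal to $u$ on $G_1$ and $0$ on $G_2\setminus G_1$; this lies in $H_0^m(G_2)$. For a Hilbert space $H$, $L_2(I;H)$ is the Bochner space with $\|g\|_{L_2(I;H)}^2=\int_I\|g(t)\|_H^2\,dt$, and its dual is identified with $L_2(I;H')$ via $\langle r,v\rangle=\int_I\langle r(t),v(t)\rangle\,dt$. The adjoint of a continuous linear $T:A\to B$ is $T':B'\to A'$, $T'g=g\circ T$. For a subspace $A\subset B$ with inherited norm and $r\in A'$, $\mathcal{E}(r;B'):=\{\tilde r\in B':\tilde r=r\text{ on }A\}$. *)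

theory Defs
  imports "HOL-Analysis.Analysis" "HOL-Library.Multiset"
begin

section \<open>Real normed spaces with explicit carriers\<close>

text \<open>The spaces below depend on sets such as \<open>D\<close>, \<open>\<Omega>\<close> and \<open>I\<close>, so they cannot be
  types of class \<^class>\<open>real_normed_vector\<close>. The same record is used for seminormed spaces of
  functions and for the normed spaces obtained from them by passing to the quotient.\<close>

record 'v nspace =
  vecs :: "'v set"
  vadd :: "'v \<Rightarrow> 'v \<Rightarrow> 'v"
  vscale :: "real \<Rightarrow> 'v \<Rightarrow> 'v"
  vnorm :: "'v \<Rightarrow> real"

definition vdiff :: "'v nspace \<Rightarrow> 'v \<Rightarrow> 'v \<Rightarrow> 'v" where
  "vdiff X u v = vadd X u (vscale X (-1) v)"

definition subspace_on :: "'v nspace \<Rightarrow> 'v set \<Rightarrow> 'v nspace" where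
  "subspace_on X A = X\<lparr>vecs := A\<rparr>"

definition closure_in :: "'v nspace \<Rightarrow> 'v set \<Rightarrow> 'v set" where
  "closure_in X A = {u \<in> vecs X. \<forall>e>0. \<exists>a\<in>A. vnorm X (vdiff X u a) < e}"

definition cls :: "'v nspace \<Rightarrow> 'v \<Rightarrow> 'v set" where
  "cls X u = {v \<in> vecs X. vnorm X (vdiff X v u) = 0}"

definition rep :: "'v set \<Rightarrow> 'v" where
  "rep A = (SOME u. u \<in> A)"

text \<open>The quotient of a seminormed space by the kernel of its seminorm. For the seminorms used
  here two functions are in the same class iff they are equal almost everywhere.\<close>

definition quot :: "'v nspace \<Rightarrow> 'v set nspace" where
  "quot X = \<lparr>vecs = cls X ` vecs X,
             vadd = (\<lambda>A B. cls X (vadd X (rep A) (rep B))),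
             vscale = (\<lambda>c A. cls X (vscale X c (rep A))),
             vnorm = (\<lambda>A. vnorm X (rep A))\<rparr>"

text \<open>Functionals are extensional, so that equality of functionals is equality on the space.\<close>

definition dual :: "'v nspace \<Rightarrow> ('v \<Rightarrow> real) nspace" where
  "dual X = \<lparr>vecs = {f \<in> extensional (vecs X).
                      (\<forall>u\<in>vecs X. \<forall>v\<in>vecs X. f (vadd X u v) = f u + f v) \<and>
                      (\<forall>c. \<forall>u\<in>vecs X. f (vscale X c u) = c * f u) \<and>
                      (\<exists>C. \<forall>u\<in>vecs X. \<bar>f u\<bar> \<le> C * vnorm X u)},
             vadd = (\<lambda>f g. \<lambda>u\<in>vecs X. f u + g u),
             vscale = (\<lambda>c f. \<lambda>u\<in>vecs X. c * f u),
             vnorm = (\<lambda>f. SUP u\<in>{u \<in> vecs X. vnorm X u \<le> 1}. \<bar>f u\<bar>)\<rparr>"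

text \<open>\<open>adjoint_on A T\<close> is \<open>T' : B' \<rightarrow> A'\<close> for \<open>T : A \<rightarrow> B\<close>.\<close>

definition adjoint_on :: "'u nspace \<Rightarrow> ('u \<Rightarrow> 'v) \<Rightarrow> ('v \<Rightarrow> real) \<Rightarrow> ('u \<Rightarrow> real)" where
  "adjoint_on A T g = (\<lambda>u\<in>vecs A. g (T u))"

text \<open>\<open>\<E>(r; B')\<close> for \<open>r \<in> A'\<close>, \<open>A \<subseteq> B\<close>.\<close>

definition extensions :: "'v nspace \<Rightarrow> 'v nspace \<Rightarrow> ('v \<Rightarrow> real) \<Rightarrow> ('v \<Rightarrow> real) set" where
  "extensions A B r = {s \<in> vecs (dual B). \<forall>u\<in>vecs A. s u = r u}"


section \<open>Sobolev spaces\<close>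

definition is_domain :: "'a::euclidean_space set \<Rightarrow> bool" where
  "is_domain G \<longleftrightarrow> open G \<and> connected G \<and> G \<noteq> {}"

primrec iter_partial :: "'a::euclidean_space list \<Rightarrow> ('a \<Rightarrow> real) \<Rightarrow> 'a \<Rightarrow> real" where
  "iter_partial [] f = f"
| "iter_partial (b # bs) f = (\<lambda>x. frechet_derivative (iter_partial bs f) (at x) b)"

text \<open>A multi-index is a multiset of basis vectors: \<open>\<alpha>\<^sub>b\<close> is the multiplicity of \<open>b\<close> and
  \<open>|\<alpha>|\<close> is the size.\<close>

definition multi_indices :: "nat \<Rightarrow> 'a::euclidean_space multiset set" where
  "multi_indices m = {\<alpha>. set_mset \<alpha> \<subseteq> Basis \<and> size \<alpha> \<le> m}"

text \<open>The basis carries no order, so some order of differentiation is chosen; for smooth functions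
  the choice is irrelevant.\<close>

definition partial :: "'a::euclidean_space multiset \<Rightarrow> ('a \<Rightarrow> real) \<Rightarrow> 'a \<Rightarrow> real" where
  "partial \<alpha> f = iter_partial (SOME bs. mset bs = \<alpha>) f"

text \<open>\<open>C\<^sup>\<infinity>\<close>: all iterated partial derivatives are Frechet differentiable, hence also continuous.\<close>

definition smooth :: "('a::euclidean_space \<Rightarrow> real) \<Rightarrow> bool" where
  "smooth f \<longleftrightarrow> (\<forall>bs. set bs \<subseteq> Basis \<longrightarrow> (\<forall>x. iter_partial bs f differentiable (at x)))"

text \<open>\<open>C\<^sub>c\<^sup>\<infinity>(G)\<close>; an element is given by its smooth zero extension to the whole space.\<close>

definition test_funs :: "'a::euclidean_space set \<Rightarrow> ('a \<Rightarrow> real) set" where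
  "test_funs G = {\<phi>. smooth \<phi> \<and> compact (closure {x. \<phi> x \<noteq> 0}) \<and> closure {x. \<phi> x \<noteq> 0} \<subseteq> G}"

text \<open>Functions on \<open>G\<close> are represented by functions on the whole space whose values off \<open>G\<close> are
  ignored throughout; in particular they do not affect membership or the class below.\<close>

definition sq_integrable :: "'a::euclidean_space set \<Rightarrow> ('a \<Rightarrow> real) set" where
  "sq_integrable G = {u \<in> borel_measurable (lebesgue_on G).
                        integrable (lebesgue_on G) (\<lambda>x. (u x)\<^sup>2)}"

definition weak_partials ::
    "'a::euclidean_space set \<Rightarrow> 'a multiset \<Rightarrow> ('a \<Rightarrow> real) \<Rightarrow> ('a \<Rightarrow> real) set" where
  "weak_partials G \<alpha> u = {w \<in> sq_integrable G. \<forall>\<phi>\<in>test_funs G.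
      (LINT x|lebesgue_on G. u x * partial \<alpha> \<phi> x)
        = (-1) ^ size \<alpha> * (LINT x|lebesgue_on G. w x * \<phi> x)}"

definition weak_partial ::
    "'a::euclidean_space set \<Rightarrow> 'a multiset \<Rightarrow> ('a \<Rightarrow> real) \<Rightarrow> 'a \<Rightarrow> real" where
  "weak_partial G \<alpha> u = (SOME w. w \<in> weak_partials G \<alpha> u)"

text \<open>The functions underlying \<open>H\<^sup>m(G)\<close>, before identification of functions equal almost everywhere.\<close>

definition sobolev_funs :: "nat \<Rightarrow> 'a::euclidean_space set \<Rightarrow> ('a \<Rightarrow> real) nspace" where
  "sobolev_funs m G =
     \<lparr>vecs = {u \<in> sq_integrable G. \<forall>\<alpha>\<in>multi_indices m. weak_partials G \<alpha> u \<noteq> {}},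
      vadd = (\<lambda>u v x. u x + v x),
      vscale = (\<lambda>c u x. c * u x),
      vnorm = (\<lambda>u. sqrt (\<Sum>\<alpha>\<in>multi_indices m.
                            LINT x|lebesgue_on G. (weak_partial G \<alpha> u x)\<^sup>2))\<rparr>"

definition sobolev :: "nat \<Rightarrow> 'a::euclidean_space set \<Rightarrow> ('a \<Rightarrow> real) set nspace" where
  "sobolev m G = quot (sobolev_funs m G)"

definition sobolev0 :: "nat \<Rightarrow> 'a::euclidean_space set \<Rightarrow> ('a \<Rightarrow> real) set nspace" where
  "sobolev0 m G = subspace_on (sobolev m G)
     (closure_in (sobolev m G) (cls (sobolev_funs m G) ` test_funs G))"

text \<open>\<open>H\<^sup>-\<^sup>m(G)\<close>.\<close>

definition sobolev_neg ::
    "nat \<Rightarrow> 'a::euclidean_space set \<Rightarrow> (('a \<Rightarrow> real) set \<Rightarrow> real) nspace" where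
  "sobolev_neg m G = dual (sobolev0 m G)"

text \<open>Zero extension from \<open>G\<close> to \<open>G'\<close> and its range with the norm of \<open>H\<^sub>0\<^sup>m(G')\<close>; thus
  \<open>zero_ext_range m D \<Omega>\<close> is \<open>V(\<Omega>)\<close> and \<open>zero_ext_range m \<Omega> Q\<close> is \<open>U(Q)\<close>.\<close>

definition zero_ext ::
    "nat \<Rightarrow> 'a::euclidean_space set \<Rightarrow> 'a set \<Rightarrow> ('a \<Rightarrow> real) set \<Rightarrow> ('a \<Rightarrow> real) set" where
  "zero_ext m G G' u = cls (sobolev_funs m G') (\<lambda>x. if x \<in> G then rep u x else 0)"

definition zero_ext_range ::
    "nat \<Rightarrow> 'a::euclidean_space set \<Rightarrow> 'a set \<Rightarrow> ('a \<Rightarrow> real) set nspace" where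
  "zero_ext_range m G G' = subspace_on (sobolev0 m G') (zero_ext m G G' ` vecs (sobolev0 m G))"


section \<open>Bochner spaces\<close>

definition strongly_measurable :: "real set \<Rightarrow> 'v nspace \<Rightarrow> (real \<Rightarrow> 'v) \<Rightarrow> bool" where
  "strongly_measurable I X f \<longleftrightarrow>
     (\<exists>s. (\<forall>n::nat. simple_function (lebesgue_on I) (s n) \<and> s n ` I \<subseteq> vecs X) \<and>
          (AE t in lebesgue_on I. (\<lambda>n. vnorm X (vdiff X (s n t) (f t))) \<longlonglongrightarrow> 0))"

text \<open>Values in \<open>X\<close> are required only almost everywhere. Hence, for a subspace \<open>Y\<close> of a normed
  space \<open>X\<close>, the class of a \<open>Y\<close>-valued function in \<open>L\<^sub>2(I;Y)\<close> is also its class in \<open>L\<^sub>2(I;X)\<close>,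
  and \<open>L\<^sub>2(I;Y)\<close> is a subset of \<open>L\<^sub>2(I;X)\<close>.\<close>

definition bochner_funs :: "real set \<Rightarrow> 'v nspace \<Rightarrow> (real \<Rightarrow> 'v) nspace" where
  "bochner_funs I X =
     \<lparr>vecs = {f. (AE t in lebesgue_on I. f t \<in> vecs X) \<and> strongly_measurable I X f \<and>
                 integrable (lebesgue_on I) (\<lambda>t. (vnorm X (f t))\<^sup>2)},
      vadd = (\<lambda>f g t. vadd X (f t) (g t)),
      vscale = (\<lambda>c f t. vscale X c (f t)),
      vnorm = (\<lambda>f. sqrt (LINT t|lebesgue_on I. (vnorm X (f t))\<^sup>2))\<rparr>"

definition bochner_L2 :: "real set \<Rightarrow> 'v nspace \<Rightarrow> (real \<Rightarrow> 'v) set nspace" where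
  "bochner_L2 I X = quot (bochner_funs I X)"

text \<open>The identification of \<open>L\<^sub>2(I;X')\<close> with the dual of \<open>L\<^sub>2(I;X)\<close>, and its inverse.\<close>

definition bochner_functional ::
    "real set \<Rightarrow> 'v nspace \<Rightarrow> (real \<Rightarrow> 'v \<Rightarrow> real) set \<Rightarrow> (real \<Rightarrow> 'v) set \<Rightarrow> real" where
  "bochner_functional I X r =
     (\<lambda>v\<in>vecs (bochner_L2 I X). LINT t|lebesgue_on I. rep r t (rep v t))"

definition bochner_density ::
    "real set \<Rightarrow> 'v nspace \<Rightarrow> ((real \<Rightarrow> 'v) set \<Rightarrow> real) \<Rightarrow> (real \<Rightarrow> 'v \<Rightarrow> real) set" where
  "bochner_density I X = the_inv_into (vecs (bochner_L2 I (dual X))) (bochner_functional I X)"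

text \<open>Zero extension applied pointwise in time, from \<open>L\<^sub>2(I;H\<^sub>0\<^sup>m(G))\<close> to
  \<open>L\<^sub>2(I; zero_ext_range m G G')\<close>: \<open>bochner_zero_ext I m D \<Omega>\<close> is \<open>E\<^bsub>I\<times>D\<^esub>\<close> and
  \<open>bochner_zero_ext I m \<Omega> Q\<close> is \<open>E\<^bsub>I\<times>Q\<^esub>\<close>, with inverse \<open>R\<^bsub>I\<times>Q\<^esub>\<close>.\<close>

definition bochner_zero_ext ::
    "real set \<Rightarrow> nat \<Rightarrow> 'a::euclidean_space set \<Rightarrow> 'a set \<Rightarrow>
     (real \<Rightarrow> ('a \<Rightarrow> real) set) set \<Rightarrow> (real \<Rightarrow> ('a \<Rightarrow> real) set) set" where
  "bochner_zero_ext I m G G' v =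
     cls (bochner_funs I (zero_ext_range m G G')) (\<lambda>t. zero_ext m G G' (rep v t))"

definition bochner_zero_restr ::
    "real set \<Rightarrow> nat \<Rightarrow> 'a::euclidean_space set \<Rightarrow> 'a set \<Rightarrow>
     (real \<Rightarrow> ('a \<Rightarrow> real) set) set \<Rightarrow> (real \<Rightarrow> ('a \<Rightarrow> real) set) set" where
  "bochner_zero_restr I m G G' =
     the_inv_into (vecs (bochner_L2 I (sobolev0 m G))) (bochner_zero_ext I m G G')"

end

theory Submission
  imports Defs
begin

text \<open>Zero extension \<open>E\<close> is a linear isometry of \<open>H\<^sub>0\<^sup>m(G)\<close> into \<open>H\<^sub>0\<^sup>m(G')\<close> for \<open>G \<subseteq> G'\<close>. Hence composing
  a functional with \<open>E\<close> does not increase its norm, and neither does doing so at almost every time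
  \<open>t\<close>; this gives the first inequality with \<open>r\<^sub>D(t) = r\<^sub>\<Omega>(t) \<circ> E\<close>. If \<open>r\<^sub>Q\<close> extends
  \<open>R' r\<^sub>\<Omega>\<close>, then \<open>t \<mapsto> r\<^sub>Q(t) \<circ> E\<close> and \<open>r\<^sub>\<Omega>\<close> induce the same functional on
  \<open>L\<^sub>2(I; H\<^sub>0\<^sup>m(\<Omega>))\<close>. A strongly measurable density is determined by its functional, so they
  agree, and the second inequality follows in the same way.

  That \<open>E\<close> is an isometry rests on two facts: weak derivatives are unique (fundamental lemma of the
  calculus of variations), and the weak derivatives of an element of \<open>H\<^sub>0\<^sup>m(G)\<close>, extended by zero, are
  weak derivatives on \<open>G'\<close> (integration by parts on \<open>C\<^sub>c\<^sup>\<infinity>(G)\<close> and density).\<close>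

text \<open>All spaces consist of classes whose values are read through \<open>rep\<close>, an
  arbitrary choice, so identities hold only almost everywhere, in \<open>x\<close> and again in
  \<open>t\<close>; many lemmas serve to remove the dependence on this choice. The norm of L2(I;
  H^-m) is the L2 norm of the pointwise dual norm, so both estimates are pointwise in
  \<open>t\<close> once the densities are known. The density of \<open>r_D\<close> is written down
  and recognised by injectivity of the pairing. This injectivity is the delicate point. Testing with
  step functions gives p(t)x = q(t)x outside a null set that depends on x, and there may be
  uncountably many x. Strong measurability supplies a countable family of vectors that suffices. On
  the Sobolev side the obstacle is that a test function on the larger set need not vanish near the
  boundary of G, so the definition of a weak derivative on G does not apply to it. Hence integration
  by parts is proved for a compactly supported factor against an arbitrary smooth one, and only then
  carried to H_0^m(G) by density.\<close>

subsection \<open>Seminormed spaces and their quotients\<close>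

text \<open>The axioms are consequences of the vector space and seminorm laws that mention vectors only
  through the seminorm. In this form they pass to quotients, where the operations are defined by
  chosen representatives.\<close>

locale seminormed =
  fixes X :: "'v nspace"
  assumes vecs_nonempty: "vecs X \<noteq> {}"
    and add_closed: "u \<in> vecs X \<Longrightarrow> v \<in> vecs X \<Longrightarrow> vadd X u v \<in> vecs X"
    and scale_closed: "u \<in> vecs X \<Longrightarrow> vscale X c u \<in> vecs X"
    and dist_self: "u \<in> vecs X \<Longrightarrow> vnorm X (vdiff X u u) = 0"
    and dist_commute: "u \<in> vecs X \<Longrightarrow> v \<in> vecs X \<Longrightarrow> vnorm X (vdiff X u v) = vnorm X (vdiff X v u)"
    and dist_triangle: "u \<in> vecs X \<Longrightarrow> v \<in> vecs X \<Longrightarrow> w \<in> vecs X \<Longrightarrow>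
           vnorm X (vdiff X u w) \<le> vnorm X (vdiff X u v) + vnorm X (vdiff X v w)"
    and norm_le: "u \<in> vecs X \<Longrightarrow> v \<in> vecs X \<Longrightarrow> vnorm X u \<le> vnorm X v + vnorm X (vdiff X u v)"
    and dist_le: "u \<in> vecs X \<Longrightarrow> v \<in> vecs X \<Longrightarrow> vnorm X (vdiff X u v) \<le> vnorm X u + vnorm X v"
    and dist_add: "u \<in> vecs X \<Longrightarrow> v \<in> vecs X \<Longrightarrow> u' \<in> vecs X \<Longrightarrow> v' \<in> vecs X \<Longrightarrow>
           vnorm X (vdiff X (vadd X u u') (vadd X v v'))
             \<le> vnorm X (vdiff X u v) + vnorm X (vdiff X u' v')"
    and dist_scale: "u \<in> vecs X \<Longrightarrow> v \<in> vecs X \<Longrightarrow>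
           vnorm X (vdiff X (vscale X c u) (vscale X c v)) = \<bar>c\<bar> * vnorm X (vdiff X u v)"
    and norm_scale: "u \<in> vecs X \<Longrightarrow> vnorm X (vscale X c u) = \<bar>c\<bar> * vnorm X u"
begin

lemma diff_closed: "u \<in> vecs X \<Longrightarrow> v \<in> vecs X \<Longrightarrow> vdiff X u v \<in> vecs X"
  by (simp add: vdiff_def add_closed scale_closed)

lemma norm_nonneg: "u \<in> vecs X \<Longrightarrow> 0 \<le> vnorm X u"
  using dist_le[of u u] dist_self[of u] by simp

lemma dist_nonneg: "u \<in> vecs X \<Longrightarrow> v \<in> vecs X \<Longrightarrow> 0 \<le> vnorm X (vdiff X u v)"
  by (simp add: diff_closed norm_nonneg)

lemma norm_eq: "u \<in> vecs X \<Longrightarrow> v \<in> vecs X \<Longrightarrow> vnorm X (vdiff X u v) = 0 \<Longrightarrow> vnorm X u = vnorm X v"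
  using norm_le[of u v] norm_le[of v u] dist_commute[of u v] by simp

lemma zero_norm_vector: obtains z where "z \<in> vecs X" "vnorm X z = 0"
proof -
  obtain u where "u \<in> vecs X" using vecs_nonempty by blast
  then show thesis using that[of "vscale X 0 u"] by (simp add: scale_closed norm_scale)
qed

lemma cls_self: "u \<in> vecs X \<Longrightarrow> u \<in> cls X u"
  by (simp add: cls_def dist_self)

lemma cls_eq:
  assumes "u \<in> vecs X" "v \<in> vecs X" "vnorm X (vdiff X u v) = 0"
  shows "cls X u = cls X v"
proof -
  have "vnorm X (vdiff X w u) = 0 \<longleftrightarrow> vnorm X (vdiff X w v) = 0" if "w \<in> vecs X" for w
    using dist_triangle[of w u v] dist_triangle[of w v u] dist_commute[of u v]
      dist_nonneg[of w u] dist_nonneg[of w v] assms that by linarith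
  then show ?thesis by (auto simp: cls_def)
qed

lemma cls_eq_iff:
  assumes "u \<in> vecs X" "v \<in> vecs X"
  shows "cls X u = cls X v \<longleftrightarrow> vnorm X (vdiff X u v) = 0"
proof
  assume "cls X u = cls X v"
  with cls_self[OF assms(1)] have "u \<in> cls X v" by simp
  then show "vnorm X (vdiff X u v) = 0" by (simp add: cls_def)
qed (rule cls_eq[OF assms])

lemma rep_cls:
  assumes "u \<in> vecs X"
  shows "rep (cls X u) \<in> vecs X" "vnorm X (vdiff X (rep (cls X u)) u) = 0"
proof -
  have "rep (cls X u) \<in> cls X u"
    unfolding rep_def using cls_self[OF assms] by (rule someI)
  then show "rep (cls X u) \<in> vecs X" "vnorm X (vdiff X (rep (cls X u)) u) = 0"
    by (auto simp: cls_def)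
qed

lemma cls_in_quot: "u \<in> vecs X \<Longrightarrow> cls X u \<in> vecs (quot X)"
  by (simp add: quot_def)

lemma norm_cls: "u \<in> vecs X \<Longrightarrow> vnorm (quot X) (cls X u) = vnorm X u"
  using norm_eq rep_cls by (simp add: quot_def)

lemma add_cls:
  assumes "u \<in> vecs X" "v \<in> vecs X"
  shows "vadd (quot X) (cls X u) (cls X v) = cls X (vadd X u v)"
proof -
  note r = rep_cls[OF assms(1)] rep_cls[OF assms(2)]
  have "vnorm X (vdiff X (vadd X (rep (cls X u)) (rep (cls X v))) (vadd X u v)) = 0"
    using dist_add[OF r(1) assms(1) r(3) assms(2)] r
      dist_nonneg[OF add_closed[OF r(1) r(3)] add_closed[OF assms]] by simp
  then have "cls X (vadd X (rep (cls X u)) (rep (cls X v))) = cls X (vadd X u v)"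
    using r assms by (intro cls_eq add_closed)
  then show ?thesis by (simp add: quot_def)
qed

lemma scale_cls:
  assumes "u \<in> vecs X"
  shows "vscale (quot X) c (cls X u) = cls X (vscale X c u)"
proof -
  note r = rep_cls[OF assms]
  have "vnorm X (vdiff X (vscale X c (rep (cls X u))) (vscale X c u)) = 0"
    using dist_scale[OF r(1) assms] r by simp
  then have "cls X (vscale X c (rep (cls X u))) = cls X (vscale X c u)"
    using r assms by (intro cls_eq scale_closed)
  then show ?thesis by (simp add: quot_def)
qed

lemma diff_cls: "u \<in> vecs X \<Longrightarrow> v \<in> vecs X \<Longrightarrow> vdiff (quot X) (cls X u) (cls X v) = cls X (vdiff X u v)"
  by (simp add: vdiff_def add_cls scale_cls scale_closed)

end

locale normed = seminormed +
  assumes dist_eq_0: "u \<in> vecs X \<Longrightarrow> v \<in> vecs X \<Longrightarrow> vnorm X (vdiff X u v) = 0 \<Longrightarrow> u = v"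

text \<open>Every element of the quotient is \<open>cls X a\<close>, and on such classes operations
  and norm are those of the representatives, so each axiom is inherited; definiteness holds because
  vectors at distance 0 have the same class.\<close>

lemma (in seminormed) normed_quot: "normed (quot X)"
proof (unfold_locales, goal_cases)
  case 1
  then show ?case using vecs_nonempty by (simp add: quot_def)
next
  case (2 u v)
  then obtain a b where "a \<in> vecs X" "u = cls X a" "b \<in> vecs X" "v = cls X b"
    by (auto simp: quot_def)
  then show ?case by (simp add: diff_cls norm_cls diff_closed cls_in_quot add_cls add_closed)
next
  case (3 u c)
  then obtain a where "a \<in> vecs X" "u = cls X a"
    by (auto simp: quot_def)
  then show ?case by (simp add: diff_cls norm_cls diff_closed cls_in_quot scale_cls scale_closed)
next
  case (4 u)
  then obtain a where "a \<in> vecs X" "u = cls X a"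
    by (auto simp: quot_def)
  then show ?case by (simp add: diff_cls norm_cls diff_closed dist_self)
next
  case (5 u v)
  then obtain a b where "a \<in> vecs X" "u = cls X a" "b \<in> vecs X" "v = cls X b"
    by (auto simp: quot_def)
  then show ?case by (simp add: diff_cls norm_cls diff_closed dist_commute[of a b])
next
  case (6 u v w)
  then obtain a b c' where "a \<in> vecs X" "u = cls X a" "b \<in> vecs X" "v = cls X b" "c' \<in> vecs X" "w = cls X c'"
    by (auto simp: quot_def)
  then show ?case by (simp add: diff_cls norm_cls diff_closed dist_triangle)
next
  case (7 u v)
  then obtain a b where "a \<in> vecs X" "u = cls X a" "b \<in> vecs X" "v = cls X b"
    by (auto simp: quot_def)
  then show ?case by (simp add: diff_cls norm_cls diff_closed norm_le)
next
  case (8 u v)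
  then obtain a b where "a \<in> vecs X" "u = cls X a" "b \<in> vecs X" "v = cls X b"
    by (auto simp: quot_def)
  then show ?case by (simp add: diff_cls norm_cls diff_closed dist_le)
next
  case (9 u v u' v')
  then obtain a b a' b' where "a \<in> vecs X" "u = cls X a" "b \<in> vecs X" "v = cls X b" "a' \<in> vecs X" "u' = cls X a'" "b' \<in> vecs X" "v' = cls X b'"
    by (auto simp: quot_def)
  then show ?case by (simp add: diff_cls norm_cls diff_closed dist_add add_cls add_closed)
next
  case (10 u v c)
  then obtain a b where "a \<in> vecs X" "u = cls X a" "b \<in> vecs X" "v = cls X b"
    by (auto simp: quot_def)
  then show ?case by (simp add: diff_cls norm_cls diff_closed dist_scale scale_cls scale_closed)
next
  case (11 u c)
  then obtain a where "a \<in> vecs X" "u = cls X a"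
    by (auto simp: quot_def)
  then show ?case by (simp add: diff_cls norm_cls diff_closed norm_scale scale_cls scale_closed)
next
  case (12 u v)
  then obtain a b where "a \<in> vecs X" "u = cls X a" "b \<in> vecs X" "v = cls X b"
    by (auto simp: quot_def)
  then show ?case using 12(3) by (simp add: diff_cls norm_cls diff_closed cls_eq_iff)
qed

section \<open>Subspaces, closures and spaces of functions\<close>

lemma vdiff_subspace_on [simp]: "vdiff (subspace_on X A) = vdiff X"
  by (simp add: vdiff_def subspace_on_def fun_eq_iff)

lemma subspace_on_simps [simp]:
  "vecs (subspace_on X A) = A" "vadd (subspace_on X A) = vadd X"
  "vscale (subspace_on X A) = vscale X" "vnorm (subspace_on X A) = vnorm X"
  by (simp_all add: subspace_on_def)

lemma (in normed) normed_subspace_on: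
  assumes "A \<subseteq> vecs X" "A \<noteq> {}"
    and "\<And>u v. u \<in> A \<Longrightarrow> v \<in> A \<Longrightarrow> vadd X u v \<in> A"
    and "\<And>u c. u \<in> A \<Longrightarrow> vscale X c u \<in> A"
  shows "normed (subspace_on X A)"
proof (unfold_locales, goal_cases)
  case (5 u v)
  then show ?case using assms(1) dist_commute by auto
next
  case (12 u v)
  then show ?case using assms(1) dist_eq_0 by auto
qed (use assms in \<open>auto simp: subset_iff dist_self dist_triangle norm_le dist_le dist_add dist_scale
      norm_scale\<close>)

lemma (in seminormed) closure_in_add_closed:
  assumes A: "A \<subseteq> vecs X" "\<And>a b. a \<in> A \<Longrightarrow> b \<in> A \<Longrightarrow> vadd X a b \<in> A"
    and u: "u \<in> closure_in X A" and v: "v \<in> closure_in X A"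
  shows "vadd X u v \<in> closure_in X A"
proof -
  have uv: "u \<in> vecs X" "v \<in> vecs X" using u v by (auto simp: closure_in_def)
  have "\<exists>c\<in>A. vnorm X (vdiff X (vadd X u v) c) < e" if "e > 0" for e
  proof -
    have "e/2 > 0" using that by simp
    then obtain a b where "a \<in> A" "b \<in> A" "vnorm X (vdiff X u a) < e/2" "vnorm X (vdiff X v b) < e/2"
      using u v unfolding closure_in_def by blast
    moreover have "vnorm X (vdiff X (vadd X u v) (vadd X a b))
        \<le> vnorm X (vdiff X u a) + vnorm X (vdiff X v b)"
      using \<open>a \<in> A\<close> \<open>b \<in> A\<close> A(1) uv by (intro dist_add) auto
    ultimately have "vnorm X (vdiff X (vadd X u v) (vadd X a b)) < e" by linarith
    then show ?thesis using A(2) \<open>a \<in> A\<close> \<open>b \<in> A\<close> by blast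
  qed
  then show ?thesis using uv by (simp add: closure_in_def add_closed)
qed

lemma (in seminormed) closure_in_scale_closed:
  assumes A: "A \<subseteq> vecs X" "\<And>a. a \<in> A \<Longrightarrow> vscale X c a \<in> A"
    and u: "u \<in> closure_in X A"
  shows "vscale X c u \<in> closure_in X A"
proof -
  have uv: "u \<in> vecs X" using u by (auto simp: closure_in_def)
  have "\<exists>b\<in>A. vnorm X (vdiff X (vscale X c u) b) < e" if "e > 0" for e
  proof -
    \<comment> \<open>The summand 1 covers \<open>c = 0\<close> without a case distinction.\<close>
    have "e / (\<bar>c\<bar> + 1) > 0" using that by simp
    then obtain a where a: "a \<in> A" "vnorm X (vdiff X u a) < e / (\<bar>c\<bar> + 1)"
      using u unfolding closure_in_def by blast
    have "vnorm X (vdiff X (vscale X c u) (vscale X c a)) = \<bar>c\<bar> * vnorm X (vdiff X u a)"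
      using dist_scale[of u a c] A(1) uv a by auto
    also have "\<dots> \<le> (\<bar>c\<bar> + 1) * vnorm X (vdiff X u a)"
      using dist_nonneg[of u a] A(1) uv a by (intro mult_right_mono) auto
    also have "\<dots> < e"
      using a(2) by (simp add: pos_less_divide_eq mult.commute)
    finally show ?thesis using A(2) a by blast
  qed
  then show ?thesis using uv by (simp add: closure_in_def scale_closed)
qed

lemma (in seminormed) norm_diff_le:
  assumes "u \<in> vecs X" "v \<in> vecs X"
  shows "\<bar>vnorm X u - vnorm X v\<bar> \<le> vnorm X (vdiff X u v)"
  using norm_le[OF assms] norm_le[OF assms(2,1)] dist_commute[OF assms] by linarith

text \<open>Joint continuity of the distance, by four triangle inequalities. It carries limits of
  simple functions over to limits of their distances.\<close>

lemma (in seminormed) dist_diff_le: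
  assumes "u \<in> vecs X" "v \<in> vecs X" "u' \<in> vecs X" "v' \<in> vecs X"
  shows "\<bar>vnorm X (vdiff X u v) - vnorm X (vdiff X u' v')\<bar>
    \<le> vnorm X (vdiff X u u') + vnorm X (vdiff X v v')"
  using dist_triangle[of u u' v] dist_triangle[of u' v' v] dist_triangle[of u' u v']
    dist_triangle[of u v v'] dist_commute[of u u'] dist_commute[of v v'] assms by linarith

text \<open>\<open>cls\<close> is onto and preserves distances. \<open>sobolev0\<close> takes its
  closure among classes; this moves the closure down to functions, where derivatives can be
  computed.\<close>

lemma (in seminormed) closure_in_quot:
  assumes A: "A \<subseteq> vecs X"
  shows "closure_in (quot X) (cls X ` A) = cls X ` closure_in X A"
proof -
  have dist: "vnorm (quot X) (vdiff (quot X) (cls X u) (cls X a)) = vnorm X (vdiff X u a)"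
    if "u \<in> vecs X" "a \<in> A" for u a
    using that A by (simp add: diff_cls norm_cls diff_closed subset_iff)
  have "cls X u \<in> closure_in (quot X) (cls X ` A) \<longleftrightarrow> u \<in> closure_in X A" if "u \<in> vecs X" for u
    using that by (simp add: closure_in_def cls_in_quot dist)
  moreover have "closure_in (quot X) (cls X ` A) \<subseteq> cls X ` vecs X" "closure_in X A \<subseteq> vecs X"
    by (auto simp: closure_in_def quot_def)
  ultimately show ?thesis by blast
qed

text \<open>The vector picked by \<open>rep\<close> has distance 0 from one in the closure, so by
  the triangle inequality it can be approximated equally well.\<close>

lemma (in seminormed) rep_closure_in:
  assumes A: "A \<subseteq> vecs X" and U: "U \<in> cls X ` closure_in X A"
  shows "rep U \<in> closure_in X A" "rep U \<in> vecs X" "cls X (rep U) = U"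
proof -
  obtain u where u: "u \<in> closure_in X A" "U = cls X u" using U by blast
  then have uv: "u \<in> vecs X" by (simp add: closure_in_def)
  note r = rep_cls[OF uv, folded u(2)]
  show "rep U \<in> vecs X" by (rule r)
  have "vnorm X (vdiff X (rep U) a) \<le> vnorm X (vdiff X u a)" if "a \<in> A" for a
    using dist_triangle[OF r(1) uv, of a] r(2) A that by auto
  then have "\<exists>a\<in>A. vnorm X (vdiff X (rep U) a) < e" if "e > 0" for e
    using u(1) that unfolding closure_in_def by (blast intro: le_less_trans)
  then show "rep U \<in> closure_in X A"
    using r(1) by (simp add: closure_in_def)
  show "cls X (rep U) = U" unfolding u(2) using r uv u(2) by (intro cls_eq) auto
qed

text \<open>With pointwise operations a difference is again a genuine function, so all the laws
  about distances follow from subadditivity and homogeneity.\<close>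

lemma seminormed_funsI:
  fixes X :: "('x \<Rightarrow> real) nspace"
  assumes add: "vadd X = (\<lambda>u v x. u x + v x)" and scale: "vscale X = (\<lambda>c u x. c * u x)"
    and ne: "vecs X \<noteq> {}"
    and addc: "\<And>u v. u \<in> vecs X \<Longrightarrow> v \<in> vecs X \<Longrightarrow> (\<lambda>x. u x + v x) \<in> vecs X"
    and scalec: "\<And>c u. u \<in> vecs X \<Longrightarrow> (\<lambda>x. c * u x) \<in> vecs X"
    and tri: "\<And>u v. u \<in> vecs X \<Longrightarrow> v \<in> vecs X \<Longrightarrow> vnorm X (\<lambda>x. u x + v x) \<le> vnorm X u + vnorm X v"
    and hom: "\<And>c u. u \<in> vecs X \<Longrightarrow> vnorm X (\<lambda>x. c * u x) = \<bar>c\<bar> * vnorm X u"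
  shows "seminormed X"
proof -
  have diff: "vdiff X = (\<lambda>u v x. u x + (-1) * v x)"
    by (simp add: vdiff_def fun_eq_iff add scale)
  have diffc: "(\<lambda>x. u x + (-1) * v x) \<in> vecs X" if "u \<in> vecs X" "v \<in> vecs X" for u v
    by (rule addc[OF that(1) scalec[OF that(2)]])
  show ?thesis
  proof (unfold_locales, goal_cases)
    case (4 u)
    then show ?case using hom[of u 0] by (simp add: diff)
  next
    case (5 u v)
    then show ?case using hom[OF diffc[of v u], of "-1"] by (simp add: diff add.commute)
  next
    case (6 u v w)
    then show ?case using tri[OF diffc[of u v] diffc[of v w]] by (simp add: diff)
  next
    case (7 u v)
    then show ?case using tri[OF _ diffc, of v u v] by (simp add: diff)
  next
    case (8 u v)
    then show ?case using tri[OF _ scalec, of u v "-1"] hom[of v "-1"] by (simp add: diff)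
  next
    case (9 u v u' v')
    then show ?case using tri[OF diffc[of u v] diffc[of u' v']] by (simp add: diff add algebra_simps)
  next
    case (10 u v c)
    then show ?case using hom[OF diffc[of u v], of c] by (simp add: diff scale algebra_simps)
  qed (simp_all add: ne add scale addc scalec hom)
qed

subsection \<open>Duals\<close>

lemma dual_simps:
  "vadd (dual X) f g = (\<lambda>u\<in>vecs X. f u + g u)"
  "vscale (dual X) c f = (\<lambda>u\<in>vecs X. c * f u)"
  "vdiff (dual X) f g = (\<lambda>u\<in>vecs X. f u - g u)"
  "vnorm (dual X) f = (SUP u\<in>{u \<in> vecs X. vnorm X u \<le> 1}. \<bar>f u\<bar>)"
  by (auto simp: dual_def vdiff_def fun_eq_iff restrict_def)

context seminormed begin

text \<open>A real \<open>SUP\<close> is informative only over bounded sets; this bound makes the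
  conditionally complete rules applicable to the dual norm.\<close>

lemma dual_bdd:
  assumes "f \<in> vecs (dual X)"
  shows "bdd_above ((\<lambda>u. \<bar>f u\<bar>) ` {u \<in> vecs X. vnorm X u \<le> 1})"
proof -
  obtain C where C: "\<forall>u\<in>vecs X. \<bar>f u\<bar> \<le> C * vnorm X u"
    using assms by (auto simp: dual_def)
  have "\<bar>f u\<bar> \<le> \<bar>C\<bar>" if "u \<in> vecs X" "vnorm X u \<le> 1" for u
  proof -
    have "\<bar>f u\<bar> \<le> C * vnorm X u" using C that(1) by blast
    also have "\<dots> \<le> \<bar>C\<bar> * vnorm X u" using norm_nonneg[OF that(1)] by (intro mult_right_mono) auto
    also have "\<dots> \<le> \<bar>C\<bar>" using that(2) by (simp add: mult_left_le)
    finally show ?thesis .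
  qed
  then show ?thesis by (intro bdd_aboveI2[where M = "\<bar>C\<bar>"]) auto
qed

lemma unit_ball_nonempty: "{u \<in> vecs X. vnorm X u \<le> 1} \<noteq> {}"
proof -
  obtain z where "z \<in> vecs X" "vnorm X z = 0" by (rule zero_norm_vector)
  then show ?thesis by (intro ex_in_conv[THEN iffD1] exI[of _ z]) simp
qed

lemma dual_le_norm:
  assumes "f \<in> vecs (dual X)" "u \<in> vecs X" "vnorm X u \<le> 1"
  shows "\<bar>f u\<bar> \<le> vnorm (dual X) f"
  unfolding dual_simps using assms by (intro cSUP_upper dual_bdd) auto

lemma dual_norm_leI:
  assumes "\<And>u. u \<in> vecs X \<Longrightarrow> vnorm X u \<le> 1 \<Longrightarrow> \<bar>f u\<bar> \<le> C"
  shows "vnorm (dual X) f \<le> C"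
  unfolding dual_simps using assms unit_ball_nonempty by (intro cSUP_least) auto

lemma dual_eq_0:
  assumes "f \<in> vecs (dual X)" "u \<in> vecs X" "vnorm X u = 0"
  shows "f u = 0"
proof -
  obtain C where C: "\<forall>u\<in>vecs X. \<bar>f u\<bar> \<le> C * vnorm X u"
    using assms by (auto simp: dual_def)
  then show ?thesis using assms(2,3) by fastforce
qed

text \<open>Rescale \<open>u\<close> to norm 1. Vectors of norm 0, which cannot be rescaled, are
  annihilated by boundedness.\<close>

lemma dual_le:
  assumes "f \<in> vecs (dual X)" "u \<in> vecs X"
  shows "\<bar>f u\<bar> \<le> vnorm (dual X) f * vnorm X u"
proof (cases "vnorm X u = 0")
  case False
  then have pos: "vnorm X u > 0" using norm_nonneg[OF assms(2)] by simp
  have "f (vscale X (1 / vnorm X u) u) = 1 / vnorm X u * f u"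
    using assms by (simp add: dual_def)
  moreover have "\<bar>f (vscale X (1 / vnorm X u) u)\<bar> \<le> vnorm (dual X) f"
    using pos by (intro dual_le_norm assms scale_closed) (simp add: norm_scale assms)
  ultimately show ?thesis using pos by (simp add: abs_mult pos_divide_le_eq)
qed (simp add: dual_eq_0 assms)

lemma dual_norm_nonneg:
  assumes "f \<in> vecs (dual X)"
  shows "0 \<le> vnorm (dual X) f"
proof -
  obtain z where "z \<in> vecs X" "vnorm X z = 0" by (rule zero_norm_vector)
  then show ?thesis using dual_le_norm[OF assms, of z] by simp
qed

lemma dualI:
  assumes "f \<in> extensional (vecs X)"
    and "\<And>u v. u \<in> vecs X \<Longrightarrow> v \<in> vecs X \<Longrightarrow> f (vadd X u v) = f u + f v"
    and "\<And>c u. u \<in> vecs X \<Longrightarrow> f (vscale X c u) = c * f u"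
    and "\<And>u. u \<in> vecs X \<Longrightarrow> \<bar>f u\<bar> \<le> C * vnorm X u"
  shows "f \<in> vecs (dual X)"
  using assms by (auto simp: dual_def intro!: exI[of _ C])

lemma dual_add: "f \<in> vecs (dual X) \<Longrightarrow> u \<in> vecs X \<Longrightarrow> v \<in> vecs X \<Longrightarrow> f (vadd X u v) = f u + f v"
  and dual_scale: "f \<in> vecs (dual X) \<Longrightarrow> u \<in> vecs X \<Longrightarrow> f (vscale X c u) = c * f u"
  and dual_extensional: "f \<in> vecs (dual X) \<Longrightarrow> f \<in> extensional (vecs X)"
  by (auto simp: dual_def)

lemma dual_add_closed:
  assumes f: "f \<in> vecs (dual X)" and g: "g \<in> vecs (dual X)"
  shows "vadd (dual X) f g \<in> vecs (dual X)"
proof (rule dualI[where C = "vnorm (dual X) f + vnorm (dual X) g"])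
  fix u assume u: "u \<in> vecs X"
  show "\<bar>vadd (dual X) f g u\<bar> \<le> (vnorm (dual X) f + vnorm (dual X) g) * vnorm X u"
    using dual_le[OF f u] dual_le[OF g u] u by (simp add: dual_simps(1) distrib_right)
qed (simp_all add: dual_simps(1) dual_add[OF f] dual_add[OF g] dual_scale[OF f] dual_scale[OF g]
    add_closed scale_closed distrib_left)

lemma dual_scale_closed:
  assumes f: "f \<in> vecs (dual X)"
  shows "vscale (dual X) c f \<in> vecs (dual X)"
proof (rule dualI[where C = "\<bar>c\<bar> * vnorm (dual X) f"])
  fix u assume u: "u \<in> vecs X"
  show "\<bar>vscale (dual X) c f u\<bar> \<le> \<bar>c\<bar> * vnorm (dual X) f * vnorm X u"
    using dual_le[OF f u] u by (simp add: dual_simps(2) abs_mult mult.assoc mult_left_mono)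
qed (simp_all add: dual_simps(2) dual_add[OF f] dual_scale[OF f] add_closed scale_closed distrib_left)

lemma dual_diff_closed:
  assumes "f \<in> vecs (dual X)" "g \<in> vecs (dual X)"
  shows "vdiff (dual X) f g \<in> vecs (dual X)"
  unfolding vdiff_def by (intro dual_add_closed dual_scale_closed assms)

lemma dual_norm_scale:
  assumes f: "f \<in> vecs (dual X)"
  shows "vnorm (dual X) (vscale (dual X) c f) = \<bar>c\<bar> * vnorm (dual X) f"
proof (rule antisym)
  have le: "vnorm (dual X) (vscale (dual X) a g) \<le> \<bar>a\<bar> * vnorm (dual X) g"
    if "g \<in> vecs (dual X)" for a g
    using dual_le_norm[OF that]
    by (intro dual_norm_leI) (auto simp: dual_simps(2) abs_mult intro!: mult_left_mono)
  show "vnorm (dual X) (vscale (dual X) c f) \<le> \<bar>c\<bar> * vnorm (dual X) f" by (rule le[OF f])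
  show "\<bar>c\<bar> * vnorm (dual X) f \<le> vnorm (dual X) (vscale (dual X) c f)"
  proof (cases "c = 0")
    case True
    then show ?thesis using dual_norm_nonneg[OF dual_scale_closed[OF f]] by simp
  next
    case False
    \<comment> \<open>Undoing the scaling turns \<open>le\<close> into the reverse
      inequality.\<close>
    have "vscale (dual X) (1/c) (vscale (dual X) c f) = f"
      using False dual_extensional[OF f] by (auto simp: dual_simps(2) fun_eq_iff extensional_def)
    then have "vnorm (dual X) f \<le> \<bar>1/c\<bar> * vnorm (dual X) (vscale (dual X) c f)"
      using le[OF dual_scale_closed[OF f], of "1/c" c] by simp
    then show ?thesis using False by (simp add: field_simps)
  qed
qed

lemma dual_norm_triangle:
  assumes "f \<in> vecs (dual X)" "g \<in> vecs (dual X)"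
  shows "vnorm (dual X) (vadd (dual X) f g) \<le> vnorm (dual X) f + vnorm (dual X) g"
proof (rule dual_norm_leI)
  fix u assume u: "u \<in> vecs X" "vnorm X u \<le> 1"
  show "\<bar>vadd (dual X) f g u\<bar> \<le> vnorm (dual X) f + vnorm (dual X) g"
    using dual_le_norm[OF assms(1) u] dual_le_norm[OF assms(2) u] u by (simp add: dual_simps(1))
qed

lemma normed_dual: "normed (dual X)"
proof (unfold_locales, goal_cases)
  case 1
  have "(\<lambda>u\<in>vecs X. 0) \<in> vecs (dual X)"
    by (rule dualI[where C = 0]) (auto simp: add_closed scale_closed)
  then show ?case by blast
next
  case (4 u)
  have "vdiff (dual X) u u = vscale (dual X) 0 u"
    by (auto simp: dual_simps)
  then show ?case using dual_norm_scale[OF 4, of 0] by simp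
next
  case (5 u v)
  have "vdiff (dual X) u v = vscale (dual X) (-1) (vdiff (dual X) v u)"
    by (auto simp: dual_simps fun_eq_iff)
  then show ?case using dual_norm_scale[OF dual_diff_closed, of v u "-1"] 5 by simp
next
  case (6 u v w)
  have "vdiff (dual X) u w = vadd (dual X) (vdiff (dual X) u v) (vdiff (dual X) v w)"
    by (auto simp: dual_simps fun_eq_iff)
  then show ?case using dual_norm_triangle[OF dual_diff_closed dual_diff_closed, of u v v w] 6 by simp
next
  case (7 u v)
  have "u = vadd (dual X) v (vdiff (dual X) u v)"
    using dual_extensional[OF 7(1)] by (auto simp: dual_simps fun_eq_iff extensional_def)
  then show ?case using dual_norm_triangle[OF _ dual_diff_closed, of v u v] 7 by simp
next
  case (8 u v)
  then show ?case
    using dual_norm_triangle[OF _ dual_scale_closed, of u v "-1"] dual_norm_scale[of v "-1"]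
    by (simp add: vdiff_def)
next
  case (9 u v u' v')
  have "vdiff (dual X) (vadd (dual X) u u') (vadd (dual X) v v')
      = vadd (dual X) (vdiff (dual X) u v) (vdiff (dual X) u' v')"
    by (auto simp: dual_simps fun_eq_iff)
  then show ?case using dual_norm_triangle[OF dual_diff_closed dual_diff_closed, of u v u' v'] 9 by simp
next
  case (10 u v c)
  have "vdiff (dual X) (vscale (dual X) c u) (vscale (dual X) c v) = vscale (dual X) c (vdiff (dual X) u v)"
    by (auto simp: dual_simps fun_eq_iff algebra_simps)
  then show ?case using dual_norm_scale[OF dual_diff_closed, of u v c] 10 by simp
next
  case (12 u v)
  show ?case
  proof
    fix x
    show "u x = v x"
    proof (cases "x \<in> vecs X")
      case True
      then show ?thesis
        using dual_le[OF dual_diff_closed[OF 12(1,2)] True] 12(3) by (simp add: dual_simps(3))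
    next
      case False
      then show ?thesis using 12 dual_extensional by (metis extensional_arb)
    qed
  qed
qed (simp_all add: dual_add_closed dual_scale_closed dual_norm_scale)

end

subsection \<open>Bochner spaces\<close>

text \<open>This is completeness of Lebesgue measure; extension by 0 reduces the restricted measure
  to the full one.\<close>

lemma borel_measurable_lebesgue_on_cong_AE:
  fixes f g :: "'a::euclidean_space \<Rightarrow> 'b::euclidean_space"
  assumes S: "S \<in> sets lebesgue" and f: "f \<in> borel_measurable (lebesgue_on S)"
    and eq: "AE x in lebesgue_on S. f x = g x"
  shows "g \<in> borel_measurable (lebesgue_on S)"
proof -
  have "(\<lambda>x. if x \<in> S then f x else 0) \<in> borel_measurable lebesgue"
    using f S by (simp add: borel_measurable_if)
  moreover have "AE x in lebesgue. (if x \<in> S then f x else 0) = (if x \<in> S then g x else 0)"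
    using eq S by (simp add: AE_restrict_space_iff)
  ultimately have "(\<lambda>x. if x \<in> S then g x else 0) \<in> borel_measurable lebesgue"
    by (rule borel_measurable_AE)
  then show ?thesis using S by (simp add: borel_measurable_if)
qed

text \<open>No measurability is assumed: by completeness \<open>f\<close> and \<open>g\<close> are
  measurable together, and if they are not, both integrals have the default value 0.\<close>

lemma integral_lebesgue_on_cong_AE:
  fixes f g :: "'a::euclidean_space \<Rightarrow> real"
  assumes S: "S \<in> sets lebesgue" and eq: "AE x in lebesgue_on S. f x = g x"
  shows "(LINT x|lebesgue_on S. f x) = (LINT x|lebesgue_on S. g x)"
proof (cases "f \<in> borel_measurable (lebesgue_on S)")
  case True
  then show ?thesis
    by (rule integral_cong_AE[OF _ borel_measurable_lebesgue_on_cong_AE[OF S True eq] eq])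
next
  case False
  have "AE x in lebesgue_on S. g x = f x" using eq by eventually_elim simp
  then have "g \<notin> borel_measurable (lebesgue_on S)"
    using borel_measurable_lebesgue_on_cong_AE[OF S] False by blast
  then have "\<not> integrable (lebesgue_on S) f" "\<not> integrable (lebesgue_on S) g"
    using False by (auto dest: borel_measurable_integrable)
  then show ?thesis by (simp add: not_integrable_integral_eq)
qed

lemma borel_measurable_lebesgue_on_limit_AE:
  fixes s :: "nat \<Rightarrow> 'a::euclidean_space \<Rightarrow> real"
  assumes S: "S \<in> sets lebesgue" and s: "\<And>n. s n \<in> borel_measurable (lebesgue_on S)"
    and lim: "AE x in lebesgue_on S. (\<lambda>n. s n x) \<longlonglongrightarrow> f x"
  shows "f \<in> borel_measurable (lebesgue_on S)"
proof (rule borel_measurable_lebesgue_on_cong_AE[OF S])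
  show "(\<lambda>x. lim (\<lambda>n. s n x)) \<in> borel_measurable (lebesgue_on S)"
    using s by (rule borel_measurable_lim_metric)
  show "AE x in lebesgue_on S. lim (\<lambda>n. s n x) = f x"
    using lim by eventually_elim (rule limI)
qed

section \<open>Strongly measurable, square integrable functions with values in a normed
  space\<close>

locale bochner = normed X for X :: "'v nspace" +
  fixes I :: "real set"
  assumes I: "I \<in> sets lebesgue"
begin

lemma bochner_dual: "bochner (dual X) I"
  by (intro bochner.intro bochner_axioms.intro normed_dual I)

lemma bochner_simps:
  "vdiff (bochner_funs I X) f g = (\<lambda>t. vdiff X (f t) (g t))"
  "vnorm (bochner_funs I X) f = sqrt (LINT t|lebesgue_on I. (vnorm X (f t))\<^sup>2)"
  by (simp_all add: bochner_funs_def vdiff_def)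

lemma bochner_funs_iff:
  "f \<in> vecs (bochner_funs I X) \<longleftrightarrow> (AE t in lebesgue_on I. f t \<in> vecs X) \<and>
     strongly_measurable I X f \<and> integrable (lebesgue_on I) (\<lambda>t. (vnorm X (f t))\<^sup>2)"
  by (simp add: bochner_funs_def)

lemma strongly_measurableE:
  assumes "strongly_measurable I X f"
  obtains s :: "nat \<Rightarrow> real \<Rightarrow> 'v" where "\<And>n. simple_function (lebesgue_on I) (s n)"
    "\<And>n t. t \<in> I \<Longrightarrow> s n t \<in> vecs X"
    "AE t in lebesgue_on I. (\<lambda>n. vnorm X (vdiff X (s n t) (f t))) \<longlonglongrightarrow> 0"
  using assms unfolding strongly_measurable_def by (elim exE conjE) (rule that; auto)

text \<open>The values carry no sigma-algebra, so measurability cannot come from composing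
  measurable maps. It comes from simple approximations, whose distances are simple real functions
  converging almost everywhere.\<close>

lemma dist_measurable:
  assumes f: "AE t in lebesgue_on I. f t \<in> vecs X" "strongly_measurable I X f"
    and g: "AE t in lebesgue_on I. g t \<in> vecs X" "strongly_measurable I X g"
  shows "(\<lambda>t. vnorm X (vdiff X (f t) (g t))) \<in> borel_measurable (lebesgue_on I)"
proof -
  obtain s where s: "\<And>n. simple_function (lebesgue_on I) (s n)" "\<And>n t. t \<in> I \<Longrightarrow> s n t \<in> vecs X"
    and s': "AE t in lebesgue_on I. (\<lambda>n. vnorm X (vdiff X (s n t) (f t))) \<longlonglongrightarrow> 0"
    using f(2) by (rule strongly_measurableE) (rule that)
  obtain r where r: "\<And>n. simple_function (lebesgue_on I) (r n)" "\<And>n t. t \<in> I \<Longrightarrow> r n t \<in> vecs X"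
    and r': "AE t in lebesgue_on I. (\<lambda>n. vnorm X (vdiff X (r n t) (g t))) \<longlonglongrightarrow> 0"
    using g(2) by (rule strongly_measurableE) (rule that)
  show ?thesis
  proof (rule borel_measurable_lebesgue_on_limit_AE[OF I])
    show "(\<lambda>t. vnorm X (vdiff X (s n t) (r n t))) \<in> borel_measurable (lebesgue_on I)" for n
      by (intro borel_measurable_simple_function s r
          simple_function_compose2[where h = "\<lambda>a b. vnorm X (vdiff X a b)"])
    show "AE t in lebesgue_on I.
        (\<lambda>n. vnorm X (vdiff X (s n t) (r n t))) \<longlonglongrightarrow> vnorm X (vdiff X (f t) (g t))"
      using f(1) g(1) s' r' AE_space
    proof eventually_elim
      case (elim t)
      have "(\<lambda>n. vnorm X (vdiff X (s n t) (f t)) + vnorm X (vdiff X (r n t) (g t))) \<longlonglongrightarrow> 0"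
        using tendsto_add[OF elim(3,4)] by simp
      then have "(\<lambda>n. vnorm X (vdiff X (s n t) (r n t)) - vnorm X (vdiff X (f t) (g t))) \<longlonglongrightarrow> 0"
        using elim s(2) r(2) by (elim Lim_null_comparison[rotated]) (simp add: dist_diff_le)
      then show ?case by (rule LIM_zero_cancel)
    qed
  qed
qed

lemma norm_measurable:
  assumes f: "AE t in lebesgue_on I. f t \<in> vecs X" "strongly_measurable I X f"
  shows "(\<lambda>t. vnorm X (f t)) \<in> borel_measurable (lebesgue_on I)"
proof -
  obtain s where s: "\<And>n. simple_function (lebesgue_on I) (s n)" "\<And>n t. t \<in> I \<Longrightarrow> s n t \<in> vecs X"
    and s': "AE t in lebesgue_on I. (\<lambda>n. vnorm X (vdiff X (s n t) (f t))) \<longlonglongrightarrow> 0"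
    using f(2) by (rule strongly_measurableE) (rule that)
  show ?thesis
  proof (rule borel_measurable_lebesgue_on_limit_AE[OF I])
    show "(\<lambda>t. vnorm X (s n t)) \<in> borel_measurable (lebesgue_on I)" for n
      by (intro borel_measurable_simple_function simple_function_compose1[where g = "vnorm X"] s)
    show "AE t in lebesgue_on I. (\<lambda>n. vnorm X (s n t)) \<longlonglongrightarrow> vnorm X (f t)"
      using f(1) s' AE_space
    proof eventually_elim
      case (elim t)
      then have "(\<lambda>n. vnorm X (s n t) - vnorm X (f t)) \<longlonglongrightarrow> 0"
        using s(2) by (elim Lim_null_comparison[rotated]) (simp add: norm_diff_le)
      then show ?case by (rule LIM_zero_cancel)
    qed
  qed
qed

lemma bochner_funs_cong_AE:
  assumes f: "f \<in> vecs (bochner_funs I X)" and eq: "AE t in lebesgue_on I. g t = f t"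
  shows "g \<in> vecs (bochner_funs I X)"
proof -
  have f': "AE t in lebesgue_on I. f t \<in> vecs X" "strongly_measurable I X f"
    "integrable (lebesgue_on I) (\<lambda>t. (vnorm X (f t))\<^sup>2)"
    using f by (auto simp: bochner_funs_iff)
  have g: "AE t in lebesgue_on I. g t \<in> vecs X"
    using f'(1) eq by eventually_elim simp
  obtain s where s: "\<And>n. simple_function (lebesgue_on I) (s n)" "\<And>n t. t \<in> I \<Longrightarrow> s n t \<in> vecs X"
    and s': "AE t in lebesgue_on I. (\<lambda>n. vnorm X (vdiff X (s n t) (f t))) \<longlonglongrightarrow> 0"
    using f'(2) by (rule strongly_measurableE) (rule that)
  have "AE t in lebesgue_on I. (\<lambda>n. vnorm X (vdiff X (s n t) (g t))) \<longlonglongrightarrow> 0"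
    using s' eq by eventually_elim simp
  then have sm: "strongly_measurable I X g"
    unfolding strongly_measurable_def using s by (intro exI[of _ s]) auto
  have "integrable (lebesgue_on I) (\<lambda>t. (vnorm X (g t))\<^sup>2)"
    using norm_measurable[OF g sm] eq
    by (intro integrable_cong_AE_imp[OF f'(3)]) auto
  then show ?thesis using g sm by (simp add: bochner_funs_iff)
qed

text \<open>All facts about L2 classes rest on this description. A vanishing integral forces the
  integrand to vanish almost everywhere only if the integrand is integrable, since otherwise 0 is
  merely the default value; hence the preliminary domination by (a + b)^2 \<le> 2 a^2 + 2
  b^2.\<close>

lemma cls_bochner:
  assumes f: "f \<in> vecs (bochner_funs I X)"
  shows "cls (bochner_funs I X) f = {g. AE t in lebesgue_on I. g t = f t}"
proof (intro equalityI subsetI)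
  fix g assume "g \<in> cls (bochner_funs I X) f"
  then have g: "g \<in> vecs (bochner_funs I X)"
    and 0: "(LINT t|lebesgue_on I. (vnorm X (vdiff X (g t) (f t)))\<^sup>2) = 0"
    by (auto simp: cls_def bochner_simps)
  have v: "AE t in lebesgue_on I. g t \<in> vecs X \<and> f t \<in> vecs X"
    using f g by (auto simp: bochner_funs_iff)
  have "integrable (lebesgue_on I) (\<lambda>t. (vnorm X (vdiff X (g t) (f t)))\<^sup>2)"
  proof (rule Bochner_Integration.integrable_bound)
    show "integrable (lebesgue_on I) (\<lambda>t. 2 * (vnorm X (g t))\<^sup>2 + 2 * (vnorm X (f t))\<^sup>2)"
      using f g by (simp add: bochner_funs_iff)
    show "(\<lambda>t. (vnorm X (vdiff X (g t) (f t)))\<^sup>2) \<in> borel_measurable (lebesgue_on I)"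
      using f g by (intro borel_measurable_power dist_measurable) (simp_all add: bochner_funs_iff)
    show "AE t in lebesgue_on I. norm ((vnorm X (vdiff X (g t) (f t)))\<^sup>2)
        \<le> norm (2 * (vnorm X (g t))\<^sup>2 + 2 * (vnorm X (f t))\<^sup>2)"
      using v
    proof eventually_elim
      case (elim t)
      then have "(vnorm X (vdiff X (g t) (f t)))\<^sup>2 \<le> (vnorm X (g t) + vnorm X (f t))\<^sup>2"
        by (intro power_mono dist_le dist_nonneg) auto
      also have "\<dots> \<le> 2 * (vnorm X (g t))\<^sup>2 + 2 * (vnorm X (f t))\<^sup>2"
        using sum_squares_bound[of "vnorm X (g t)" "vnorm X (f t)"] by (simp add: power2_sum)
      finally show ?case by simp
    qed
  qed
  then have "AE t in lebesgue_on I. (vnorm X (vdiff X (g t) (f t)))\<^sup>2 = 0"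
    using integral_nonneg_eq_0_iff_AE[of _ "\<lambda>t. (vnorm X (vdiff X (g t) (f t)))\<^sup>2"] 0 by simp
  then have "AE t in lebesgue_on I. g t = f t"
    using v by eventually_elim (auto intro: dist_eq_0)
  then show "g \<in> {g. AE t in lebesgue_on I. g t = f t}" by simp
next
  fix g assume "g \<in> {g. AE t in lebesgue_on I. g t = f t}"
  then have eq: "AE t in lebesgue_on I. g t = f t" by simp
  have "AE t in lebesgue_on I. f t \<in> vecs X" using f by (simp add: bochner_funs_iff)
  with eq have "AE t in lebesgue_on I. (vnorm X (vdiff X (g t) (f t)))\<^sup>2 = 0"
    by eventually_elim (simp add: dist_self)
  then have "(LINT t|lebesgue_on I. (vnorm X (vdiff X (g t) (f t)))\<^sup>2) = 0"
    by (rule integral_eq_zero_AE)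
  then show "g \<in> cls (bochner_funs I X) f"
    using bochner_funs_cong_AE[OF f eq] by (simp add: cls_def bochner_simps)
qed

lemma cls_in_bochner: "f \<in> vecs (bochner_funs I X) \<Longrightarrow> cls (bochner_funs I X) f \<in> vecs (bochner_L2 I X)"
  by (simp add: bochner_L2_def quot_def)

lemma rep_cls_bochner:
  assumes f: "f \<in> vecs (bochner_funs I X)"
  shows "AE t in lebesgue_on I. rep (cls (bochner_funs I X) f) t = f t"
proof -
  have "rep (cls (bochner_funs I X) f) \<in> cls (bochner_funs I X) f"
    unfolding rep_def by (rule someI[of _ f]) (simp add: cls_bochner[OF f])
  then show ?thesis by (simp add: cls_bochner[OF f])
qed

lemma cls_bochner_eqI:
  assumes f: "f \<in> vecs (bochner_funs I X)" and eq: "AE t in lebesgue_on I. g t = f t"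
  shows "cls (bochner_funs I X) g = cls (bochner_funs I X) f"
proof -
  have "(AE t in lebesgue_on I. h t = g t) \<longleftrightarrow> (AE t in lebesgue_on I. h t = f t)" for h
    by (rule eventually_subst) (use eq in eventually_elim, simp)
  then show ?thesis by (simp add: cls_bochner f bochner_funs_cong_AE[OF f eq])
qed

lemma rep_bochner:
  assumes "r \<in> vecs (bochner_L2 I X)"
  shows "rep r \<in> vecs (bochner_funs I X)" "cls (bochner_funs I X) (rep r) = r"
proof -
  obtain f where f: "f \<in> vecs (bochner_funs I X)" "r = cls (bochner_funs I X) f"
    using assms by (auto simp: bochner_L2_def quot_def)
  then show "rep r \<in> vecs (bochner_funs I X)"
    using bochner_funs_cong_AE rep_cls_bochner by blast
  show "cls (bochner_funs I X) (rep r) = r"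
    using f cls_bochner_eqI rep_cls_bochner by blast
qed

lemma norm_bochner_L2:
  "vnorm (bochner_L2 I X) r = sqrt (LINT t|lebesgue_on I. (vnorm X (rep r t))\<^sup>2)"
  by (simp add: bochner_L2_def quot_def bochner_simps)

end

section \<open>Uniqueness of densities for the pairing of L2(I;X') with L2(I;X)\<close>

context bochner begin

text \<open>The simple approximations of \<open>p\<close> and \<open>q\<close> take countably many values, so countably many vectors
  detect the dual norms of all their differences.\<close>

lemma dual_pointwise_eq_AE:
  assumes p: "p \<in> vecs (bochner_funs I (dual X))" and q: "q \<in> vecs (bochner_funs I (dual X))"
    and eq: "\<And>x. x \<in> vecs X \<Longrightarrow> AE t in lebesgue_on I. p t x = q t x"
  shows "AE t in lebesgue_on I. p t = q t"
proof -
  interpret D: bochner "dual X" I by (rule bochner_dual)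
  have v: "AE t in lebesgue_on I. p t \<in> vecs (dual X)" "AE t in lebesgue_on I. q t \<in> vecs (dual X)"
    using p q by (auto simp: D.bochner_funs_iff)
  obtain s where s: "\<And>n. simple_function (lebesgue_on I) (s n)" "\<And>n t. t \<in> I \<Longrightarrow> s n t \<in> vecs (dual X)"
    and s': "AE t in lebesgue_on I. (\<lambda>n. vnorm (dual X) (vdiff (dual X) (s n t) (p t))) \<longlonglongrightarrow> 0"
    by (rule D.strongly_measurableE[of p]) (use p in \<open>auto simp: D.bochner_funs_iff\<close>)
  obtain r where r: "\<And>n. simple_function (lebesgue_on I) (r n)" "\<And>n t. t \<in> I \<Longrightarrow> r n t \<in> vecs (dual X)"
    and r': "AE t in lebesgue_on I. (\<lambda>n. vnorm (dual X) (vdiff (dual X) (r n t) (q t))) \<longlonglongrightarrow> 0"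
    by (rule D.strongly_measurableE[of q]) (use q in \<open>auto simp: D.bochner_funs_iff\<close>)
  \<comment> \<open>The supremum in the dual norm need not be attained, so for every functional and
    every \<open>k\<close> a unit-ball vector with defect below 1/(k+1) is chosen.\<close>
  have "\<exists>x. f \<in> vecs (dual X) \<longrightarrow> x \<in> vecs X \<and> vnorm X x \<le> 1 \<and> vnorm (dual X) f < \<bar>f x\<bar> + 1 / real (Suc k)" for f k
  proof (cases "f \<in> vecs (dual X)")
    case True
    have "vnorm (dual X) f - 1 / real (Suc k) < (SUP u\<in>{u \<in> vecs X. vnorm X u \<le> 1}. \<bar>f u\<bar>)"
      unfolding dual_simps(4) by simp
    then obtain x where "x \<in> {u \<in> vecs X. vnorm X u \<le> 1}" "vnorm (dual X) f - 1 / real (Suc k) < \<bar>f x\<bar>"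
      using less_cSUP_iff[OF unit_ball_nonempty dual_bdd[OF True]] by blast
    then show ?thesis by (auto simp: algebra_simps)
  qed auto
  then obtain w where w: "\<And>f k. f \<in> vecs (dual X) \<Longrightarrow> w f k \<in> vecs X \<and> vnorm X (w f k) \<le> 1 \<and>
      vnorm (dual X) f < \<bar>f (w f k)\<bar> + 1 / real (Suc k)" by metis
  \<comment> \<open>Only differences of values of the simple approximations are tested, and each of
    these functions has finitely many values on \<open>I\<close>.\<close>
  define F where "F = (\<Union>n. s n ` I) \<times> (\<Union>n. r n ` I)"
  have F: "countable F"
    unfolding F_def
  proof (rule countable_SIGMA)
    show "countable (\<Union>n. s n ` I)"
      using s(1) by (intro countable_UN) (auto simp: simple_function_def intro!: countable_finite)
    show "countable (\<Union>n. r n ` I)"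
      using r(1) by (intro countable_UN) (auto simp: simple_function_def intro!: countable_finite)
  qed
  have dv: "vdiff (dual X) (fst c) (snd c) \<in> vecs (dual X)" if "c \<in> F" for c
    using that s(2) r(2) by (auto simp: F_def intro!: dual_diff_closed)
  have "AE t in lebesgue_on I. \<forall>c\<in>F. \<forall>k. p t (w (vdiff (dual X) (fst c) (snd c)) k)
      = q t (w (vdiff (dual X) (fst c) (snd c)) k)"
    unfolding AE_ball_countable[OF F] AE_all_countable
    using w[OF dv] by (intro ballI allI eq) blast
  then show ?thesis
    using v s' r' AE_space
  proof eventually_elim
    case (elim t)
    then have t: "t \<in> I" by simp
    let ?d = "\<lambda>f g. vnorm (dual X) (vdiff (dual X) f g)"
    \<comment> \<open>Each approximation error enters twice: once in replacing \<open>p t\<close>,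
      \<open>q t\<close> by \<open>s n t\<close>, \<open>r n t\<close>, and once in evaluating
      \<open>s n t - r n t\<close> at the near-maximiser, where \<open>p t\<close> and
      \<open>q t\<close> cancel. Using \<open>n\<close> also as the index of the defect leaves a
      single limit.\<close>
    have le: "?d (p t) (q t) \<le> 2 * (?d (s n t) (p t) + ?d (r n t) (q t)) + 1 / real (Suc n)" for n
    proof -
      have c: "(s n t, r n t) \<in> F" using t by (auto simp: F_def)
      let ?f = "vdiff (dual X) (s n t) (r n t)"
      note sr = s(2)[OF t, of n] r(2)[OF t, of n]
      have f: "?f \<in> vecs (dual X)" using dv[OF c] by simp
      define x where "x = w ?f n"
      have x: "x \<in> vecs X" "vnorm X x \<le> 1" "vnorm (dual X) ?f < \<bar>?f x\<bar> + 1 / real (Suc n)"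
        using w[OF f] by (auto simp: x_def)
      have "p t x = q t x"
        using bspec[OF elim(1) c, THEN spec, of n] by (simp add: x_def)
      then have "?f x = vdiff (dual X) (s n t) (p t) x - vdiff (dual X) (r n t) (q t) x"
        using x(1) by (simp add: dual_simps(3))
      moreover have "\<bar>vdiff (dual X) (s n t) (p t) x\<bar> \<le> ?d (s n t) (p t)"
        "\<bar>vdiff (dual X) (r n t) (q t) x\<bar> \<le> ?d (r n t) (q t)"
        using sr elim x by (auto intro!: dual_le_norm dual_diff_closed)
      moreover have "?d (p t) (q t) \<le> ?d (s n t) (p t) + ?d (r n t) (q t) + ?d (s n t) (r n t)"
        using D.dist_diff_le[OF elim(2,3) sr] D.dist_commute[of "p t" "s n t"]
          D.dist_commute[of "q t" "r n t"] sr elim by simp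
      ultimately have "\<bar>?f x\<bar> \<le> ?d (s n t) (p t) + ?d (r n t) (q t)"
        "?d (p t) (q t) \<le> ?d (s n t) (p t) + ?d (r n t) (q t) + vnorm (dual X) ?f"
        by linarith+
      then show ?thesis using x(3) by argo
    qed
    have "(\<lambda>n. 2 * (?d (s n t) (p t) + ?d (r n t) (q t)) + 1 / real (Suc n)) \<longlonglongrightarrow> 2 * (0 + 0) + 0"
      using elim by (intro tendsto_intros LIMSEQ_Suc[OF lim_1_over_n]) auto
    then have "?d (p t) (q t) \<le> 0"
      using le by (intro LIMSEQ_le_const[where a = "?d (p t) (q t)"]) auto
    then show ?case using D.dist_nonneg[of "p t" "q t"] elim by (intro D.dist_eq_0) auto
  qed
qed

lemma dual_apply_measurable:
  assumes p: "p \<in> vecs (bochner_funs I (dual X))" and x: "x \<in> vecs X"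
  shows "(\<lambda>t. p t x) \<in> borel_measurable (lebesgue_on I)"
proof -
  interpret D: bochner "dual X" I by (rule bochner_dual)
  obtain s where s: "\<And>n. simple_function (lebesgue_on I) (s n)" "\<And>n t. t \<in> I \<Longrightarrow> s n t \<in> vecs (dual X)"
    and s': "AE t in lebesgue_on I. (\<lambda>n. vnorm (dual X) (vdiff (dual X) (s n t) (p t))) \<longlonglongrightarrow> 0"
    by (rule D.strongly_measurableE[of p]) (use p in \<open>auto simp: D.bochner_funs_iff\<close>)
  have v: "AE t in lebesgue_on I. p t \<in> vecs (dual X)"
    using p by (auto simp: D.bochner_funs_iff)
  show ?thesis
  proof (rule borel_measurable_lebesgue_on_limit_AE[OF I])
    show "(\<lambda>t. s n t x) \<in> borel_measurable (lebesgue_on I)" for n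
      by (rule borel_measurable_simple_function[OF simple_function_compose1[OF s(1), where g = "\<lambda>f. f x"]])
    show "AE t in lebesgue_on I. (\<lambda>n. s n t x) \<longlonglongrightarrow> p t x"
      using v s' AE_space
    proof eventually_elim
      case (elim t)
      have "(\<lambda>n. vnorm (dual X) (vdiff (dual X) (s n t) (p t)) * vnorm X x) \<longlonglongrightarrow> 0"
        using tendsto_mult_left_zero[OF elim(2)] .
      moreover have "\<bar>s n t x - p t x\<bar> \<le> vnorm (dual X) (vdiff (dual X) (s n t) (p t)) * vnorm X x" for n
        using dual_le[OF dual_diff_closed[of "s n t" "p t"] x] s(2) elim x by (simp add: dual_simps(3))
      ultimately have "(\<lambda>n. s n t x - p t x) \<longlonglongrightarrow> 0"
        by (elim Lim_null_comparison[rotated]) simp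
      then show ?case by (rule LIM_zero_cancel)
    qed
  qed
qed

text \<open>Test with the function equal to \<open>x\<close> on a bounded measurable set and to a
  zero vector elsewhere. The pairing becomes the integral over that set of the density applied to
  \<open>x\<close>, which determines this scalar function almost everywhere for each fixed
  \<open>x\<close>; \<open>dual_pointwise_eq_AE\<close> then removes the dependence of the null set
  on \<open>x\<close>.\<close>

lemma bochner_functional_inj: "inj_on (bochner_functional I X) (vecs (bochner_L2 I (dual X)))"
proof (rule inj_onI)
  interpret D: bochner "dual X" I by (rule bochner_dual)
  fix p q assume p: "p \<in> vecs (bochner_L2 I (dual X))" and q: "q \<in> vecs (bochner_L2 I (dual X))"
    and eq: "bochner_functional I X p = bochner_functional I X q"
  note rp = D.rep_bochner[OF p] and rq = D.rep_bochner[OF q]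
  \<comment> \<open>The record has no zero constant; \<open>z\<close> stands in for it, and
    functionals vanish on it by \<open>dual_eq_0\<close>.\<close>
  obtain z where z: "z \<in> vecs X" "vnorm X z = 0" by (rule zero_norm_vector)
  have "AE t in lebesgue_on I. rep p t x = rep q t x" if x: "x \<in> vecs X" for x
  proof -
    \<comment> \<open>\<open>I\<close> may be unbounded. On a window of finite measure, constants
      are square integrable and square integrable functions are integrable; the windows exhaust
      \<open>I\<close>.\<close>
    let ?B = "\<lambda>n::nat. {- real n..real n} \<inter> I"
    have B: "?B n \<in> sets (lebesgue_on I)" for n
      using I by (auto simp: sets_restrict_space)
    have Bi: "integrable (lebesgue_on I) (indicat_real (A \<inter> ?B n))" if "A \<in> sets (lebesgue_on I)" for A n
    proof -
      have A: "A \<in> sets lebesgue" using that I by (simp add: sets_restrict_space_iff)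
      have S: "A \<inter> ?B n \<in> sets lebesgue" using A I by (intro sets.Int) auto
      have "emeasure lebesgue (A \<inter> ?B n) \<le> emeasure lebesgue {- real n..real n}"
        using A I by (intro emeasure_mono) auto
      also have "\<dots> < \<infinity>" by simp
      finally show ?thesis
        using S I by (intro integrable_real_indicator)
          (simp_all add: emeasure_restrict_space sets_restrict_space_iff le_infI2)
    qed
    have int: "integrable (lebesgue_on I) (\<lambda>t. indicat_real (?B n) t * g t x)"
      if g: "g \<in> vecs (bochner_funs I (dual X))" for g n
    proof (rule Bochner_Integration.integrable_bound)
      show "integrable (lebesgue_on I) (\<lambda>t. vnorm X x * (indicat_real (?B n) t + (vnorm (dual X) (g t))\<^sup>2))"
        using Bi[OF sets_lebesgue_on_refl, of n] g by (simp add: D.bochner_funs_iff Int_absorb1)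
      show "(\<lambda>t. indicat_real (?B n) t * g t x) \<in> borel_measurable (lebesgue_on I)"
        by (rule borel_measurable_times[OF borel_measurable_indicator[OF B] dual_apply_measurable[OF g x]])
      have "AE t in lebesgue_on I. g t \<in> vecs (dual X)" using g by (simp add: D.bochner_funs_iff)
      then show "AE t in lebesgue_on I. norm (indicat_real (?B n) t * g t x)
          \<le> norm (vnorm X x * (indicat_real (?B n) t + (vnorm (dual X) (g t))\<^sup>2))"
      proof eventually_elim
        case (elim t)
        let ?N = "vnorm (dual X) (g t)"
        \<comment> \<open>This bounds the first power by the only powers known to be integrable on
          the window, namely 0 and 2.\<close>
        have N: "?N \<le> 1 + ?N\<^sup>2"
          using sum_squares_bound[of 1 ?N] dual_norm_nonneg[OF elim] by simp
        have "\<bar>g t x\<bar> \<le> vnorm X x * (1 + ?N\<^sup>2)"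
          using dual_le[OF elim x] mult_left_mono[OF N norm_nonneg[OF x]] by (simp add: mult.commute)
        then show ?case using norm_nonneg[OF x] by (auto simp: indicator_def abs_mult)
      qed
    qed
    have "AE t in lebesgue_on I. indicat_real (?B n) t * rep p t x = indicat_real (?B n) t * rep q t x" for n
    proof (rule density_unique_real[OF int[OF rp(1)] int[OF rq(1)]])
      fix A assume A: "A \<in> sets (lebesgue_on I)"
      define v where "v t = (if t \<in> A \<inter> ?B n then x else z)" for t
      have AB: "A \<inter> ?B n \<in> sets (lebesgue_on I)" using A B by blast
      have sf: "simple_function (lebesgue_on I) v"
        unfolding v_def using AB by (intro simple_function_If_set) auto
      have vv: "v t \<in> vecs X" for t by (simp add: v_def x z)
      have v: "v \<in> vecs (bochner_funs I X)"
      proof -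
        have "strongly_measurable I X v"
          unfolding strongly_measurable_def using sf vv by (intro exI[of _ "\<lambda>n. v"]) (auto simp: dist_self)
        moreover have "(\<lambda>t. (vnorm X (v t))\<^sup>2) = (\<lambda>t. (vnorm X x)\<^sup>2 * indicat_real (A \<inter> ?B n) t)"
          by (auto simp: v_def z fun_eq_iff)
        ultimately show ?thesis using Bi[OF A] vv by (simp add: bochner_funs_iff)
      qed
      have pairing: "(LINT t:A|lebesgue_on I. indicat_real (?B n) t * rep g t x)
          = bochner_functional I X g (cls (bochner_funs I X) v)"
        if "g \<in> vecs (bochner_L2 I (dual X))" for g
      proof -
        have "AE t in lebesgue_on I. rep g t \<in> vecs (dual X)"
          using D.rep_bochner(1)[OF that] by (simp add: D.bochner_funs_iff)
        then have e: "AE t in lebesgue_on I. indicat_real A t *\<^sub>R (indicat_real (?B n) t * rep g t x)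
            = rep g t (rep (cls (bochner_funs I X) v) t)"
          using rep_cls_bochner[OF v]
        proof eventually_elim
          case (elim t)
          then show ?case using dual_eq_0[OF elim(1) z] by (auto simp: v_def indicator_def)
        qed
        have "bochner_functional I X g (cls (bochner_funs I X) v)
          = (LINT t|lebesgue_on I. rep g t (rep (cls (bochner_funs I X) v) t))"
          using cls_in_bochner[OF v] by (simp add: bochner_functional_def)
        moreover have m: "(\<lambda>t. indicat_real A t *\<^sub>R (indicat_real (?B n) t * rep g t x)) \<in> borel_measurable (lebesgue_on I)"
          by (intro borel_measurable_scaleR borel_measurable_indicator A
              borel_measurable_integrable[OF int[OF D.rep_bochner(1)[OF that]]])
        moreover have "(LINT t:A|lebesgue_on I. indicat_real (?B n) t * rep g t x)
            = (LINT t|lebesgue_on I. rep g t (rep (cls (bochner_funs I X) v) t))"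
          unfolding set_lebesgue_integral_def
          by (rule integral_cong_AE[OF m borel_measurable_lebesgue_on_cong_AE[OF I m e] e])
        ultimately show ?thesis by simp
      qed
      show "(LINT t:A|lebesgue_on I. indicat_real (?B n) t * rep p t x)
          = (LINT t:A|lebesgue_on I. indicat_real (?B n) t * rep q t x)"
        unfolding pairing[OF p] pairing[OF q] eq by (rule refl)
    qed
    then have "AE t in lebesgue_on I. \<forall>n. indicat_real (?B n) t * rep p t x = indicat_real (?B n) t * rep q t x"
      unfolding AE_all_countable by (rule allI)
    then show ?thesis
    proof (rule AE_mp, intro AE_I2 impI)
      fix t assume t: "t \<in> space (lebesgue_on I)"
        and eq: "\<forall>n. indicat_real (?B n) t * rep p t x = indicat_real (?B n) t * rep q t x"
      obtain n where "\<bar>t\<bar> \<le> real n" using real_arch_simple[of "\<bar>t\<bar>"] by blast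
      then have "t \<in> ?B n" using t by auto
      then show "rep p t x = rep q t x" using spec[OF eq, of n] by simp
    qed
  qed
  then have "AE t in lebesgue_on I. rep p t = rep q t"
    by (rule dual_pointwise_eq_AE[OF rp(1) rq(1)])
  from D.cls_bochner_eqI[OF rq(1) this] show "p = q"
    unfolding rp(2) rq(2) .
qed

end

subsection \<open>Linear isometries\<close>

locale linear_isometry = X: normed X + Y: normed Y
  for X :: "'u nspace" and Y :: "'v nspace" and E :: "'u \<Rightarrow> 'v" +
  assumes maps: "u \<in> vecs X \<Longrightarrow> E u \<in> vecs Y"
    and map_add: "u \<in> vecs X \<Longrightarrow> v \<in> vecs X \<Longrightarrow> E (vadd X u v) = vadd Y (E u) (E v)"
    and map_scale: "u \<in> vecs X \<Longrightarrow> E (vscale X c u) = vscale Y c (E u)"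
    and map_norm: "u \<in> vecs X \<Longrightarrow> vnorm Y (E u) = vnorm X u"
begin

abbreviation range_space :: "'v nspace" where
  "range_space \<equiv> subspace_on Y (E ` vecs X)"

lemma map_dist: "u \<in> vecs X \<Longrightarrow> v \<in> vecs X \<Longrightarrow> vnorm Y (vdiff Y (E u) (E v)) = vnorm X (vdiff X u v)"
  using map_norm[of "vdiff X u v"]
  by (simp add: vdiff_def map_add map_scale X.scale_closed X.add_closed)

lemma map_eq_iff: "u \<in> vecs X \<Longrightarrow> v \<in> vecs X \<Longrightarrow> E u = E v \<longleftrightarrow> u = v"
  using map_dist[of u v] X.dist_eq_0[of u v] Y.dist_self[OF maps, of v] by auto

lemma normed_range: "normed range_space"
proof (rule Y.normed_subspace_on)
  show "E ` vecs X \<subseteq> vecs Y" using maps by blast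
  show "E ` vecs X \<noteq> {}" using X.vecs_nonempty by simp
next
  fix u v assume "u \<in> E ` vecs X" "v \<in> E ` vecs X"
  then show "vadd Y u v \<in> E ` vecs X"
    by (auto simp: map_add[symmetric] X.add_closed)
next
  fix u c assume "u \<in> E ` vecs X"
  then show "vscale Y c u \<in> E ` vecs X"
    by (auto simp: map_scale[symmetric] X.scale_closed)
qed

lemma adjoint_dual:
  assumes f: "f \<in> vecs (dual Y)"
  shows "adjoint_on X E f \<in> vecs (dual X)"
proof (rule X.dualI[where C = "vnorm (dual Y) f"])
  fix u assume u: "u \<in> vecs X"
  show "\<bar>adjoint_on X E f u\<bar> \<le> vnorm (dual Y) f * vnorm X u"
    using Y.dual_le[OF f maps[OF u]] u by (simp add: adjoint_on_def map_norm)
qed (simp_all add: adjoint_on_def map_add map_scale Y.dual_add[OF f] Y.dual_scale[OF f] maps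
    X.add_closed X.scale_closed)

text \<open>\<open>E\<close> maps the unit ball of \<open>X\<close> into that of \<open>Y\<close>,
  so the supremum runs over fewer values.\<close>

lemma adjoint_norm_le:
  assumes f: "f \<in> vecs (dual Y)"
  shows "vnorm (dual X) (adjoint_on X E f) \<le> vnorm (dual Y) f"
proof (rule X.dual_norm_leI)
  fix u assume "u \<in> vecs X" "vnorm X u \<le> 1"
  then show "\<bar>adjoint_on X E f u\<bar> \<le> vnorm (dual Y) f"
    using Y.dual_le_norm[OF f maps, of u] by (simp add: adjoint_on_def map_norm)
qed

text \<open>Being a contraction, the adjoint sends simple approximations to simple approximations,
  so it preserves strong measurability in \<open>pull_fun\<close>.\<close>

lemma adjoint_dist_le:
  assumes f: "f \<in> vecs (dual Y)" and g: "g \<in> vecs (dual Y)"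
  shows "vnorm (dual X) (vdiff (dual X) (adjoint_on X E f) (adjoint_on X E g))
    \<le> vnorm (dual Y) (vdiff (dual Y) f g)"
proof -
  have "vdiff (dual X) (adjoint_on X E f) (adjoint_on X E g) = adjoint_on X E (vdiff (dual Y) f g)"
    by (auto simp: dual_simps(3) adjoint_on_def fun_eq_iff maps)
  then show ?thesis using adjoint_norm_le[OF Y.dual_diff_closed[OF f g]] by simp
qed

end

section \<open>Isometries and their adjoints applied pointwise in time\<close>

locale bochner_isometry = linear_isometry X Y E
  for X :: "'u nspace" and Y :: "'v nspace" and E :: "'u \<Rightarrow> 'v" +
  fixes I :: "real set"
  assumes I: "I \<in> sets lebesgue"
begin

sublocale BX: bochner X I by (unfold_locales) (rule I)
sublocale BY: bochner Y I by (unfold_locales) (rule I)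
sublocale DX: bochner "dual X" I by (rule BX.bochner_dual)
sublocale DY: bochner "dual Y" I by (rule BY.bochner_dual)
sublocale BV: bochner range_space I
  by (intro bochner.intro bochner_axioms.intro normed_range I)

text \<open>\<open>bochner_zero_ext\<close> for an abstract isometry.\<close>

definition lift :: "(real \<Rightarrow> 'u) set \<Rightarrow> (real \<Rightarrow> 'v) set" where
  "lift v = cls (bochner_funs I range_space) (\<lambda>t. E (rep v t))"

text \<open>The adjoint of \<open>lift\<close> at the level of densities; see
  \<open>bochner_functional_pull\<close>.\<close>

definition pull :: "(real \<Rightarrow> 'v \<Rightarrow> real) set \<Rightarrow> (real \<Rightarrow> 'u \<Rightarrow> real) set" where
  "pull r = cls (bochner_funs I (dual X)) (\<lambda>t. adjoint_on X E (rep r t))"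

lemma lift_fun:
  assumes f: "f \<in> vecs (bochner_funs I X)"
  shows "(\<lambda>t. E (f t)) \<in> vecs (bochner_funs I range_space)"
proof -
  have v: "AE t in lebesgue_on I. f t \<in> vecs X" and sm: "strongly_measurable I X f"
    and int: "integrable (lebesgue_on I) (\<lambda>t. (vnorm X (f t))\<^sup>2)"
    using f by (auto simp: BX.bochner_funs_iff)
  obtain s where s: "\<And>n. simple_function (lebesgue_on I) (s n)" "\<And>n t. t \<in> I \<Longrightarrow> s n t \<in> vecs X"
    and s': "AE t in lebesgue_on I. (\<lambda>n. vnorm X (vdiff X (s n t) (f t))) \<longlonglongrightarrow> 0"
    using sm by (rule BX.strongly_measurableE) (rule that)
  have v': "AE t in lebesgue_on I. E (f t) \<in> vecs range_space"
    using v by eventually_elim simp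
  have "AE t in lebesgue_on I. (\<lambda>n. vnorm Y (vdiff Y (E (s n t)) (E (f t)))) \<longlonglongrightarrow> 0"
    using v s' AE_space
  proof eventually_elim
    case (elim t)
    then show ?case using s(2) by (simp add: map_dist)
  qed
  then have sm': "strongly_measurable I range_space (\<lambda>t. E (f t))"
    unfolding strongly_measurable_def using s
    by (intro exI[of _ "\<lambda>n t. E (s n t)"]) (simp_all add: simple_function_compose1[where g = E] image_subset_iff)
  have "integrable (lebesgue_on I) (\<lambda>t. (vnorm range_space (E (f t)))\<^sup>2)"
  proof (rule integrable_cong_AE_imp[OF int])
    show "(\<lambda>t. (vnorm range_space (E (f t)))\<^sup>2) \<in> borel_measurable (lebesgue_on I)"
      by (intro borel_measurable_power BV.norm_measurable v' sm')
    show "AE t in lebesgue_on I. (vnorm X (f t))\<^sup>2 = (vnorm range_space (E (f t)))\<^sup>2"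
      using v by eventually_elim (simp add: map_norm)
  qed
  then show ?thesis using v' sm' by (simp only: BV.bochner_funs_iff)
qed

lemma range_funs_subset: "vecs (bochner_funs I range_space) \<subseteq> vecs (bochner_funs I Y)"
proof
  fix f assume "f \<in> vecs (bochner_funs I range_space)"
  then have v: "AE t in lebesgue_on I. f t \<in> E ` vecs X" and sm: "strongly_measurable I range_space f"
    and int: "integrable (lebesgue_on I) (\<lambda>t. (vnorm Y (f t))\<^sup>2)"
    by (auto simp: BV.bochner_funs_iff)
  have "AE t in lebesgue_on I. f t \<in> vecs Y"
    using v by eventually_elim (auto simp: maps)
  moreover have "strongly_measurable I Y f"
  proof -
    have "A \<subseteq> E ` vecs X \<Longrightarrow> A \<subseteq> vecs Y" for A using maps by blast
    then show ?thesis
      using sm unfolding strongly_measurable_def subspace_on_simps vdiff_subspace_on by blast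
  qed
  ultimately show "f \<in> vecs (bochner_funs I Y)" using int by (simp add: BY.bochner_funs_iff)
qed

text \<open>Both classes consist of all functions almost everywhere equal to \<open>f\<close>,
  whatever the carrier. Thus \<open>lift v\<close>, formed in L2 of the range, can be fed to
  functionals on L2(I;Y).\<close>

lemma cls_range:
  assumes "f \<in> vecs (bochner_funs I range_space)"
  shows "cls (bochner_funs I range_space) f = cls (bochner_funs I Y) f"
  unfolding BV.cls_bochner[OF assms] BY.cls_bochner[OF subsetD[OF range_funs_subset assms]] ..

lemma lift:
  assumes v: "v \<in> vecs (bochner_L2 I X)"
  shows "lift v \<in> vecs (bochner_L2 I range_space)" "lift v \<in> vecs (bochner_L2 I Y)"
    "AE t in lebesgue_on I. rep (lift v) t = E (rep v t)"
proof -
  note f = lift_fun[OF BX.rep_bochner(1)[OF v]]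
  show "lift v \<in> vecs (bochner_L2 I range_space)"
    unfolding lift_def by (rule BV.cls_in_bochner[OF f])
  show "lift v \<in> vecs (bochner_L2 I Y)"
    unfolding lift_def cls_range[OF f] by (rule BY.cls_in_bochner[OF subsetD[OF range_funs_subset f]])
  show "AE t in lebesgue_on I. rep (lift v) t = E (rep v t)"
    unfolding lift_def by (rule BV.rep_cls_bochner[OF f])
qed

lemma inj_on_lift: "inj_on lift (vecs (bochner_L2 I X))"
proof (rule inj_onI)
  fix v w assume v: "v \<in> vecs (bochner_L2 I X)" and w: "w \<in> vecs (bochner_L2 I X)" and eq: "lift v = lift w"
  note rv = BX.rep_bochner[OF v] and rw = BX.rep_bochner[OF w]
  have "AE t in lebesgue_on I. rep v t \<in> vecs X" "AE t in lebesgue_on I. rep w t \<in> vecs X"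
    using rv(1) rw(1) by (simp_all add: BX.bochner_funs_iff)
  then have "AE t in lebesgue_on I. rep v t = rep w t"
    using lift(3)[OF v] lift(3)[OF w]
  proof eventually_elim
    case (elim t)
    then have "E (rep v t) = E (rep w t)" using eq by simp
    then show ?case using elim by (simp add: map_eq_iff)
  qed
  from BX.cls_bochner_eqI[OF rw(1) this] show "v = w"
    unfolding rv(2) rw(2) .
qed

lemma pull_fun:
  assumes r: "r \<in> vecs (bochner_funs I (dual Y))"
  shows "(\<lambda>t. adjoint_on X E (r t)) \<in> vecs (bochner_funs I (dual X))"
proof -
  let ?A = "adjoint_on X E"
  have v: "AE t in lebesgue_on I. r t \<in> vecs (dual Y)" and sm: "strongly_measurable I (dual Y) r"
    and int: "integrable (lebesgue_on I) (\<lambda>t. (vnorm (dual Y) (r t))\<^sup>2)"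
    using r by (auto simp: DY.bochner_funs_iff)
  obtain s where s: "\<And>n. simple_function (lebesgue_on I) (s n)" "\<And>n t. t \<in> I \<Longrightarrow> s n t \<in> vecs (dual Y)"
    and s': "AE t in lebesgue_on I. (\<lambda>n. vnorm (dual Y) (vdiff (dual Y) (s n t) (r t))) \<longlonglongrightarrow> 0"
    using sm by (rule DY.strongly_measurableE) (rule that)
  have v': "AE t in lebesgue_on I. ?A (r t) \<in> vecs (dual X)"
    using v by eventually_elim (rule adjoint_dual)
  have "AE t in lebesgue_on I. (\<lambda>n. vnorm (dual X) (vdiff (dual X) (?A (s n t)) (?A (r t)))) \<longlonglongrightarrow> 0"
    using v s' AE_space
  proof eventually_elim
    case (elim t)
    show ?case
    proof (rule Lim_null_comparison[OF always_eventually elim(2)], rule allI)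
      fix n
      have "s n t \<in> vecs (dual Y)" using s(2) elim(3) by simp
      then show "norm (vnorm (dual X) (vdiff (dual X) (?A (s n t)) (?A (r t))))
          \<le> vnorm (dual Y) (vdiff (dual Y) (s n t) (r t))"
        using adjoint_dist_le[of "s n t" "r t"] DX.dist_nonneg[of "?A (s n t)" "?A (r t)"] elim(1)
        by (simp add: adjoint_dual)
    qed
  qed
  then have sm': "strongly_measurable I (dual X) (\<lambda>t. ?A (r t))"
    unfolding strongly_measurable_def using s
    by (intro exI[of _ "\<lambda>n t. ?A (s n t)"])
      (simp_all add: simple_function_compose1[where g = ?A] image_subset_iff adjoint_dual)
  have "integrable (lebesgue_on I) (\<lambda>t. (vnorm (dual X) (?A (r t)))\<^sup>2)"
  proof (rule Bochner_Integration.integrable_bound[OF int])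
    show "(\<lambda>t. (vnorm (dual X) (?A (r t)))\<^sup>2) \<in> borel_measurable (lebesgue_on I)"
      by (intro borel_measurable_power DX.norm_measurable v' sm')
    show "AE t in lebesgue_on I. norm ((vnorm (dual X) (?A (r t)))\<^sup>2) \<le> norm ((vnorm (dual Y) (r t))\<^sup>2)"
      using v by eventually_elim (simp add: power_mono adjoint_norm_le X.dual_norm_nonneg adjoint_dual)
  qed
  then show ?thesis using v' sm' by (simp only: DX.bochner_funs_iff)
qed

lemma pull:
  assumes r: "r \<in> vecs (bochner_L2 I (dual Y))"
  shows "pull r \<in> vecs (bochner_L2 I (dual X))"
    "AE t in lebesgue_on I. rep (pull r) t = adjoint_on X E (rep r t)"
proof -
  note f = pull_fun[OF DY.rep_bochner(1)[OF r]]
  show "pull r \<in> vecs (bochner_L2 I (dual X))"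
    unfolding pull_def by (rule DX.cls_in_bochner[OF f])
  show "AE t in lebesgue_on I. rep (pull r) t = adjoint_on X E (rep r t)"
    unfolding pull_def by (rule DX.rep_cls_bochner[OF f])
qed

lemma norm_pull_le:
  assumes r: "r \<in> vecs (bochner_L2 I (dual Y))"
  shows "vnorm (bochner_L2 I (dual X)) (pull r) \<le> vnorm (bochner_L2 I (dual Y)) r"
proof -
  have i: "integrable (lebesgue_on I) (\<lambda>t. (vnorm (dual X) (rep (pull r) t))\<^sup>2)"
    using DX.rep_bochner(1)[OF pull(1)[OF r]] by (simp add: DX.bochner_funs_iff)
  have j: "integrable (lebesgue_on I) (\<lambda>t. (vnorm (dual Y) (rep r t))\<^sup>2)"
    and v: "AE t in lebesgue_on I. rep r t \<in> vecs (dual Y)"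
    using DY.rep_bochner(1)[OF r] by (simp_all add: DY.bochner_funs_iff)
  have "AE t in lebesgue_on I. (vnorm (dual X) (rep (pull r) t))\<^sup>2 \<le> (vnorm (dual Y) (rep r t))\<^sup>2"
    using v pull(2)[OF r]
    by eventually_elim (simp add: power_mono adjoint_norm_le X.dual_norm_nonneg adjoint_dual)
  then show ?thesis
    unfolding DX.norm_bochner_L2 DY.norm_bochner_L2
    by (intro real_sqrt_le_mono integral_mono_AE i j)
qed

lemma bochner_functional_pull:
  assumes r: "r \<in> vecs (bochner_L2 I (dual Y))" and v: "v \<in> vecs (bochner_L2 I X)"
  shows "bochner_functional I X (pull r) v = bochner_functional I Y r (lift v)"
proof -
  have "AE t in lebesgue_on I. rep v t \<in> vecs X"
    using BX.rep_bochner(1)[OF v] by (simp add: BX.bochner_funs_iff)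
  then have "AE t in lebesgue_on I. rep (pull r) t (rep v t) = rep r t (rep (lift v) t)"
    using pull(2)[OF r] lift(3)[OF v] by eventually_elim (simp add: adjoint_on_def)
  then show ?thesis
    using v lift(2)[OF v] by (simp add: bochner_functional_def integral_lebesgue_on_cong_AE[OF I])
qed

text \<open>\<open>bochner_functional_pull\<close> exhibits a density of the adjoint functional, and
  injectivity of the pairing makes \<open>bochner_density\<close> return it.\<close>

lemma bochner_density_adjoint:
  assumes r: "r \<in> vecs (bochner_L2 I (dual Y))"
  shows "bochner_density I X (adjoint_on (bochner_L2 I X) lift
    (restrict (bochner_functional I Y r) (vecs (bochner_L2 I range_space)))) = pull r"
proof -
  have "adjoint_on (bochner_L2 I X) lift
      (restrict (bochner_functional I Y r) (vecs (bochner_L2 I range_space)))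
    = bochner_functional I X (pull r)"
  proof
    fix v
    show "adjoint_on (bochner_L2 I X) lift
        (restrict (bochner_functional I Y r) (vecs (bochner_L2 I range_space))) v
      = bochner_functional I X (pull r) v"
    proof (cases "v \<in> vecs (bochner_L2 I X)")
      case True
      then show ?thesis using lift(1)[OF True] bochner_functional_pull[OF r True]
        by (simp add: adjoint_on_def)
    qed (simp add: adjoint_on_def bochner_functional_def)
  qed
  then show ?thesis
    unfolding bochner_density_def
    by (simp add: the_inv_into_f_f BX.bochner_functional_inj pull(1)[OF r])
qed

text \<open>On \<open>lift v\<close> the extension has the value of \<open>r\<close> at the inverse
  image of \<open>lift v\<close>, which is \<open>v\<close> because \<open>lift\<close> is
  injective. So \<open>pull q\<close> and \<open>r\<close> induce the same functional.\<close>

lemma pull_extension: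
  assumes r: "r \<in> vecs (bochner_L2 I (dual X))" and q: "q \<in> vecs (bochner_L2 I (dual Y))"
    and ext: "bochner_functional I Y q \<in> extensions (bochner_L2 I range_space) (bochner_L2 I Y)
      (adjoint_on (bochner_L2 I range_space) (the_inv_into (vecs (bochner_L2 I X)) lift)
        (bochner_functional I X r))"
  shows "pull q = r"
proof (rule inj_onD[OF BX.bochner_functional_inj _ pull(1)[OF q] r])
  show "bochner_functional I X (pull q) = bochner_functional I X r"
  proof
    fix v
    show "bochner_functional I X (pull q) v = bochner_functional I X r v"
    proof (cases "v \<in> vecs (bochner_L2 I X)")
      case True
      have "bochner_functional I Y q (lift v) = bochner_functional I X r
          (the_inv_into (vecs (bochner_L2 I X)) lift (lift v))"
        using ext lift(1)[OF True] by (simp add: extensions_def adjoint_on_def)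
      then show ?thesis
        using bochner_functional_pull[OF q True] by (simp add: the_inv_into_f_f inj_on_lift True)
    qed (simp add: bochner_functional_def)
  qed
qed

end

subsection \<open>Smooth functions\<close>

abbreviation pd :: "'a::euclidean_space \<Rightarrow> ('a \<Rightarrow> real) \<Rightarrow> 'a \<Rightarrow> real" where
  "pd b f x \<equiv> frechet_derivative f (at x) b"

lemma pd_eqI: "(f has_derivative f') (at x) \<Longrightarrow> pd b f x = f' b"
  using frechet_derivative_at by metis

text \<open>The recursion peels off the outermost derivative; this peels off the innermost, as
  inductions that replace \<open>f\<close> by a derivative of \<open>f\<close> require.\<close>

lemma iter_partial_append: "iter_partial (bs @ [b]) f = iter_partial bs (pd b f)"
  by (induction bs) auto

lemma smooth_iff:
  "smooth f \<longleftrightarrow> (\<forall>x. f differentiable (at x)) \<and> (\<forall>b\<in>Basis. smooth (pd b f))"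
proof (intro iffI conjI allI ballI)
  fix x assume "smooth f"
  then have "iter_partial [] f differentiable (at x)"
    unfolding smooth_def by (metis empty_subsetI list.set(1))
  then show "f differentiable (at x)" by simp
next
  fix b :: 'a assume "smooth f" "b \<in> Basis"
  then have "iter_partial (bs @ [b]) f differentiable (at x)" if "set bs \<subseteq> Basis" for bs x
    using that unfolding smooth_def by (metis Un_insert_right empty_set insert_subset list.simps(15) set_append sup_bot_right)
  then show "smooth (pd b f)" by (simp add: smooth_def iter_partial_append)
next
  assume f: "(\<forall>x. f differentiable (at x)) \<and> (\<forall>b\<in>Basis. smooth (pd b f))"
  show "smooth f"
    unfolding smooth_def
  proof (intro allI impI)
    fix bs :: "'a list" and x assume bs: "set bs \<subseteq> Basis"
    show "iter_partial bs f differentiable (at x)"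
    proof (cases bs rule: rev_cases)
      case (snoc cs b)
      then show ?thesis using f bs by (auto simp: iter_partial_append smooth_def)
    qed (use f in simp)
  qed
qed

lemma smooth_differentiable: "smooth f \<Longrightarrow> f differentiable (at x)"
  by (subst (asm) smooth_iff) simp

lemma smooth_pd: "smooth f \<Longrightarrow> b \<in> Basis \<Longrightarrow> smooth (pd b f)"
  by (subst (asm) smooth_iff) simp

lemma smooth_iter_partial: "smooth f \<Longrightarrow> set bs \<subseteq> Basis \<Longrightarrow> smooth (iter_partial bs f)"
  by (induction bs) (auto intro: smooth_pd)

lemma smooth_continuous: "smooth f \<Longrightarrow> continuous_on UNIV f"
  by (simp add: continuous_on_eq_continuous_at smooth_differentiable differentiable_imp_continuous_within)

text \<open>Smoothness graded by order, so that closure under sums and products can be proved by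
  induction; index \<open>n\<close> stands for order n + 1. In the product rule the undifferentiated
  factors drop one index, by \<open>differentiable_upto_Suc_D\<close>.\<close>

primrec differentiable_upto :: "nat \<Rightarrow> ('a::euclidean_space \<Rightarrow> real) \<Rightarrow> bool" where
  "differentiable_upto 0 f \<longleftrightarrow> (\<forall>x. f differentiable (at x))"
| "differentiable_upto (Suc n) f \<longleftrightarrow>
     (\<forall>x. f differentiable (at x)) \<and> (\<forall>b\<in>Basis. differentiable_upto n (pd b f))"

lemma differentiable_upto_Suc_D: "differentiable_upto (Suc n) f \<Longrightarrow> differentiable_upto n f"
  by (induction n arbitrary: f) auto

lemma smooth_differentiable_upto: "smooth f \<longleftrightarrow> (\<forall>n. differentiable_upto n f)"
proof
  assume "smooth f"
  have "smooth g \<Longrightarrow> differentiable_upto n g" for n and g :: "'a \<Rightarrow> real"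
    by (induction n arbitrary: g) (auto intro: smooth_differentiable smooth_pd)
  with \<open>smooth f\<close> show "\<forall>n. differentiable_upto n f" by blast
next
  assume f: "\<forall>n. differentiable_upto n f"
  have "differentiable_upto (length bs) g \<Longrightarrow> set bs \<subseteq> Basis \<Longrightarrow> iter_partial bs g differentiable (at x)"
    for bs x and g :: "'a \<Rightarrow> real"
    by (induction bs arbitrary: g rule: rev_induct) (auto simp: iter_partial_append)
  with f show "smooth f" by (simp add: smooth_def)
qed

lemma differentiable_upto_const: "differentiable_upto n (\<lambda>x. c)"
  by (induction n arbitrary: c) auto

lemma differentiable_upto_add:
  "differentiable_upto n f \<Longrightarrow> differentiable_upto n g \<Longrightarrow> differentiable_upto n (\<lambda>x. f x + g x)"
proof (induction n arbitrary: f g)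
  case (Suc n)
  have "pd b (\<lambda>x. f x + g x) = (\<lambda>x. pd b f x + pd b g x)" for b
  proof
    fix x
    have "(f has_derivative frechet_derivative f (at x)) (at x)"
      "(g has_derivative frechet_derivative g (at x)) (at x)"
      using Suc.prems by (simp_all add: frechet_derivative_works[symmetric])
    from has_derivative_add[OF this]
    show "pd b (\<lambda>x. f x + g x) x = pd b f x + pd b g x" by (rule pd_eqI)
  qed
  then show ?case using Suc by simp
qed simp

lemma pd_mult:
  assumes "f differentiable (at x)" "g differentiable (at x)"
  shows "pd b (\<lambda>x. f x * g x) x = f x * pd b g x + pd b f x * g x"
proof -
  have "(f has_derivative frechet_derivative f (at x)) (at x)"
    "(g has_derivative frechet_derivative g (at x)) (at x)"
    using assms by (simp_all add: frechet_derivative_works[symmetric])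
  from has_derivative_mult[OF this] show ?thesis by (rule pd_eqI)
qed

lemma differentiable_upto_mult:
  "differentiable_upto n f \<Longrightarrow> differentiable_upto n g \<Longrightarrow> differentiable_upto n (\<lambda>x. f x * g x)"
proof (induction n arbitrary: f g)
  case (Suc n)
  have "pd b (\<lambda>x. f x * g x) = (\<lambda>x. f x * pd b g x + pd b f x * g x)" for b
    using Suc.prems by (auto simp: pd_mult)
  moreover have "differentiable_upto n f" "differentiable_upto n g"
    using Suc.prems differentiable_upto_Suc_D by blast+
  ultimately show ?case using Suc by (simp add: differentiable_upto_add)
qed simp

lemma smooth_const: "smooth (\<lambda>x. c)"
  by (simp add: smooth_differentiable_upto differentiable_upto_const)

lemma smooth_add: "smooth f \<Longrightarrow> smooth g \<Longrightarrow> smooth (\<lambda>x. f x + g x)"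
  by (simp add: smooth_differentiable_upto differentiable_upto_add)

lemma smooth_mult: "smooth f \<Longrightarrow> smooth g \<Longrightarrow> smooth (\<lambda>x. f x * g x)"
  by (simp add: smooth_differentiable_upto differentiable_upto_mult)

lemma smooth_prod: "finite A \<Longrightarrow> (\<And>i. i \<in> A \<Longrightarrow> smooth (f i)) \<Longrightarrow> smooth (\<lambda>x. \<Prod>i\<in>A. f i x)"
  by (induction A rule: finite_induct) (auto intro: smooth_const smooth_mult)

section \<open>Bump functions\<close>

text \<open>The derivatives of \<open>exp (-1/t)\<close>, extended by \<open>0\<close> to \<open>t \<le> 0\<close>, are all of the following form.\<close>

definition poly_bump :: "real poly \<Rightarrow> real \<Rightarrow> real" where
  "poly_bump p t = (if t > 0 then poly p (inverse t) * exp (- inverse t) else 0)"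

lemma poly_times_exp_tendsto_0: "((\<lambda>y::real. poly p y * exp (- y)) \<longlongrightarrow> 0) at_top"
proof -
  have "((\<lambda>y::real. \<Sum>i\<le>degree p. coeff p i * (y ^ i / exp y)) \<longlongrightarrow> 0) at_top"
    by (intro tendsto_null_sum tendsto_mult_right_zero tendsto_power_div_exp_0)
  then show ?thesis
    by (simp add: poly_altdef sum_distrib_right exp_minus divide_inverse mult.assoc)
qed

text \<open>With y = 1/t, the derivative of p(y) exp(-y) is y^2 (p(y) - p'(y)) exp(-y), since dy/dt
  = -y^2; \<open>[:0, 0, 1:]\<close> is the polynomial y^2.\<close>

lemma DERIV_poly_bump: "(poly_bump p has_real_derivative poly_bump ([:0, 0, 1:] * (p - pderiv p)) t) (at t)"
proof -
  let ?q = "[:0, 0, 1:] * (p - pderiv p)"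
  consider "t > 0" | "t < 0" | "t = 0" by linarith
  then show ?thesis
  proof cases
    case 1
    have "((\<lambda>t. poly p (inverse t) * exp (- inverse t)) has_real_derivative poly_bump ?q t) (at t)"
      using 1 by (auto intro!: derivative_eq_intros DERIV_chain'[OF _ poly_DERIV]
          simp: poly_bump_def algebra_simps power2_eq_square)
    then show ?thesis
      by (rule has_field_derivative_transform_within_open[of _ _ _ "{0<..}"]) (use 1 in \<open>auto simp: poly_bump_def\<close>)
  next
    case 2
    have "((\<lambda>t. 0) has_real_derivative poly_bump ?q t) (at t)"
      using 2 by (simp add: poly_bump_def)
    then show ?thesis
      by (rule has_field_derivative_transform_within_open[of _ _ _ "{..<0}"]) (use 2 in \<open>auto simp: poly_bump_def\<close>)
  next
    case 3
    \<comment> \<open>Dividing by \<open>h\<close> multiplies the polynomial in 1/h by its variable,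
      so the quotient is again a polynomial times exp(-y) with y tending to infinity.\<close>
    have "((\<lambda>h. poly_bump p h / h) \<longlongrightarrow> 0) (at_right 0)"
    proof (rule Lim_transform_eventually)
      show "((\<lambda>h::real. poly ([:0, 1:] * p) (inverse h) * exp (- inverse h)) \<longlongrightarrow> 0) (at_right 0)"
        by (rule filterlim_compose[OF poly_times_exp_tendsto_0 filterlim_inverse_at_top_right])
      show "\<forall>\<^sub>F h::real in at_right 0. poly ([:0, 1:] * p) (inverse h) * exp (- inverse h) = poly_bump p h / h"
        using eventually_at_right_less[of "0::real"]
        by eventually_elim (simp add: poly_bump_def divide_inverse)
    qed
    moreover have "((\<lambda>h. poly_bump p h / h) \<longlongrightarrow> 0) (at_left 0)"
    proof (rule Lim_transform_eventually[OF tendsto_const])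
      show "\<forall>\<^sub>F h::real in at_left 0. 0 = poly_bump p h / h"
        unfolding eventually_at_left_field by (intro exI[of _ "-1"]) (simp add: poly_bump_def)
    qed
    ultimately have "((\<lambda>h. poly_bump p h / h) \<longlongrightarrow> 0) (at 0)"
      by (simp add: filterlim_split_at_real)
    then show ?thesis
      using 3 by (simp add: has_field_derivative_iff poly_bump_def)
  qed
qed

lemma smooth_poly_bump_affine:
  fixes v :: "'a::euclidean_space"
  shows "smooth (\<lambda>x. poly_bump p (x \<bullet> v + d))"
proof -
  \<comment> \<open>The factor \<open>k\<close> makes the induction close: differentiating along
    \<open>b\<close> produces the constant \<open>b \<bullet> v\<close>.\<close>
  have "differentiable_upto n (\<lambda>x. k * poly_bump p (x \<bullet> v + d))" for n k
  proof (induction n arbitrary: k p)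
    let ?q = "\<lambda>p::real poly. [:0, 0, 1:] * (p - pderiv p)"
    have der: "((\<lambda>x. k * poly_bump p (x \<bullet> v + d)) has_derivative
        (\<lambda>h. k * (poly_bump (?q p) (x \<bullet> v + d) * (h \<bullet> v)))) (at x)" for k p and x :: 'a
    proof -
      have "((\<lambda>x. x \<bullet> v + d) has_derivative (\<lambda>h. h \<bullet> v)) (at x)"
        by (auto intro!: derivative_eq_intros)
      from has_derivative_compose[OF this DERIV_poly_bump[unfolded has_field_derivative_def]]
      show ?thesis by (intro has_derivative_mult_right)
    qed
    have diff: "(\<lambda>x. k * poly_bump p (x \<bullet> v + d)) differentiable (at x)" for k p and x :: 'a
      using der unfolding differentiable_def by blast
    {
      case 0
      show ?case using diff by simp
    next
      case (Suc n)
      have "pd b (\<lambda>x. k * poly_bump p (x \<bullet> v + d)) = (\<lambda>x. (k * (b \<bullet> v)) * poly_bump (?q p) (x \<bullet> v + d))" for b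
        by (simp add: fun_eq_iff pd_eqI[OF der])
      then show ?case using Suc diff by simp
    }
  qed
  from this[of _ 1] show ?thesis by (simp add: smooth_differentiable_upto)
qed

text \<open>\<open>poly_bump 1\<close> is exp(-1/t) for t > 0 and 0 otherwise. Each factor detects
  one face of the box, and the dilation by \<open>n\<close> drives the positive values to 1, so the
  limit is the indicator of the open box while the support stays in it.\<close>

definition box_bump :: "'a::euclidean_space \<Rightarrow> 'a \<Rightarrow> nat \<Rightarrow> 'a \<Rightarrow> real" where
  "box_bump a b n x = (\<Prod>i\<in>Basis. poly_bump 1 (real n * (x \<bullet> i - a \<bullet> i)) * poly_bump 1 (real n * (b \<bullet> i - x \<bullet> i)))"

lemma smooth_box_bump: "smooth (box_bump a b n)"
proof -
  have "smooth (\<lambda>x. poly_bump 1 (real n * (x \<bullet> i - a \<bullet> i)))" for i :: 'a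
    using smooth_poly_bump_affine[of 1 "real n *\<^sub>R i" "- (real n * (a \<bullet> i))"] by (simp add: algebra_simps)
  moreover have "smooth (\<lambda>x. poly_bump 1 (real n * (b \<bullet> i - x \<bullet> i)))" for i :: 'a
    using smooth_poly_bump_affine[of 1 "- real n *\<^sub>R i" "real n * (b \<bullet> i)"] by (simp add: algebra_simps)
  ultimately show ?thesis
    unfolding box_bump_def by (intro smooth_prod smooth_mult) auto
qed

lemma poly_bump_pos: "poly_bump p t \<noteq> 0 \<Longrightarrow> t > 0"
  by (auto simp: poly_bump_def split: if_splits)

lemma poly_bump_1_bounds: "0 \<le> poly_bump 1 t" "poly_bump 1 t \<le> 1"
  by (auto simp: poly_bump_def)

lemma box_bump_bounds: "0 \<le> box_bump a b n x" "box_bump a b n x \<le> 1"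
  unfolding box_bump_def using poly_bump_1_bounds
  by (auto intro!: prod_nonneg prod_le_1 mult_le_one)

lemma box_bump_support: "{x. box_bump a b n x \<noteq> 0} \<subseteq> box a b"
proof
  fix x assume "x \<in> {x. box_bump a b n x \<noteq> 0}"
  then have "0 < real n * (x \<bullet> i - a \<bullet> i)" "0 < real n * (b \<bullet> i - x \<bullet> i)" if "i \<in> Basis" for i
    using that by (auto simp: box_bump_def intro!: poly_bump_pos)
  then show "x \<in> box a b"
    by (auto simp: mem_box zero_less_mult_iff)
qed

lemma box_bump_tendsto: "(\<lambda>n. box_bump a b n x) \<longlonglongrightarrow> indicat_real (box a b) x"
proof (cases "x \<in> box a b")
  case True
  have lim: "(\<lambda>n. poly_bump 1 (real n * t)) \<longlonglongrightarrow> 1" if "t > 0" for t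
  proof (rule Lim_transform_eventually)
    have "(\<lambda>n. exp (- (inverse t * (1 / real n)))) \<longlonglongrightarrow> exp (- (inverse t * 0))"
      by (intro tendsto_intros lim_1_over_n)
    then show "(\<lambda>n. exp (- (inverse t * (1 / real n)))) \<longlonglongrightarrow> 1" by simp
    show "\<forall>\<^sub>F n in sequentially. exp (- (inverse t * (1 / real n))) = poly_bump 1 (real n * t)"
      using eventually_gt_at_top[of 0]
      by eventually_elim (use that in \<open>simp add: poly_bump_def divide_inverse\<close>)
  qed
  have "(\<lambda>n. box_bump a b n x) \<longlonglongrightarrow> (\<Prod>i\<in>(Basis::'a set). 1 * 1)"
    unfolding box_bump_def using True
    by (intro tendsto_prod tendsto_mult lim) (auto simp: mem_box)
  then show ?thesis using True by simp
next
  case False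
  then have "box_bump a b n x = 0" for n using box_bump_support[of a b n] by blast
  then show ?thesis using False by simp
qed

section \<open>Test functions\<close>

lemma test_funsI:
  assumes "smooth f" "{x. f x \<noteq> 0} \<subseteq> K" "compact K" "K \<subseteq> G"
  shows "f \<in> test_funs G"
proof -
  have "closure {x. f x \<noteq> 0} \<subseteq> K" using assms by (intro closure_minimal compact_imp_closed)
  moreover have "compact (closure {x. f x \<noteq> 0})"
    using bounded_subset[OF compact_imp_bounded[OF assms(3)] assms(2)] by (simp add: compact_closure)
  ultimately show ?thesis using assms by (auto simp: test_funs_def)
qed

lemma test_funsE:
  assumes "f \<in> test_funs G"
  obtains K where "smooth f" "compact K" "K \<subseteq> G" "\<And>x. x \<notin> K \<Longrightarrow> f x = 0"
proof (rule that)
  show "smooth f" "compact (closure {x. f x \<noteq> 0})" "closure {x. f x \<noteq> 0} \<subseteq> G"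
    using assms by (auto simp: test_funs_def)
  show "f x = 0" if "x \<notin> closure {x. f x \<noteq> 0}" for x
    using that closure_subset[of "{x. f x \<noteq> 0}"] by blast
qed

lemma box_bump_test_funs: "box a b \<subseteq> cbox c d \<Longrightarrow> cbox c d \<subseteq> G \<Longrightarrow> box_bump a b n \<in> test_funs G"
  by (rule test_funsI[where K = "cbox c d"])
    (auto intro: smooth_box_bump subsetD[OF order_trans[OF box_bump_support]])

lemma test_funs_add: "f \<in> test_funs G \<Longrightarrow> g \<in> test_funs G \<Longrightarrow> (\<lambda>x. f x + g x) \<in> test_funs G"
  by (elim test_funsE, rule_tac K = "K \<union> Ka" in test_funsI) (auto simp: smooth_add intro: ccontr)

lemma test_funs_scale: "f \<in> test_funs G \<Longrightarrow> (\<lambda>x. c * f x) \<in> test_funs G"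
  by (elim test_funsE, rule_tac K = K in test_funsI) (auto simp: smooth_mult smooth_const intro: ccontr)

lemma zero_in_test_funs: "(\<lambda>x. 0) \<in> test_funs G"
  by (rule test_funsI[where K = "{}"]) (auto simp: smooth_const)

lemma pd_eq_0_outside:
  assumes "closed K" "\<And>x. x \<notin> K \<Longrightarrow> f x = 0" "x \<notin> K"
  shows "pd b f x = 0"
proof -
  have "((\<lambda>x. 0) has_derivative (\<lambda>h. 0)) (at x)" by simp
  then have "(f has_derivative (\<lambda>h. 0)) (at x)"
    by (rule has_derivative_transform_within_open[of _ _ _ _ "- K"]) (use assms in auto)
  then show ?thesis by (rule pd_eqI)
qed

lemma test_funs_pd:
  assumes "f \<in> test_funs G" "b \<in> Basis"
  shows "pd b f \<in> test_funs G"
proof -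
  obtain K where K: "smooth f" "compact K" "K \<subseteq> G" "\<And>x. x \<notin> K \<Longrightarrow> f x = 0"
    using assms(1) by (rule test_funsE) (rule that)
  show ?thesis
    using K pd_eq_0_outside[of K f _ b] compact_imp_closed
    by (intro test_funsI[where K = K] smooth_pd assms(2)) auto
qed

lemma test_funs_mono: "G \<subseteq> G' \<Longrightarrow> test_funs G \<subseteq> test_funs G'"
  by (auto simp: test_funs_def)

subsection \<open>Integration by parts\<close>

lemma integrable_compact_support:
  fixes f :: "'a::euclidean_space \<Rightarrow> real"
  assumes "continuous_on UNIV f" "compact K" "\<And>x. x \<notin> K \<Longrightarrow> f x = 0"
  shows "integrable lborel f"
proof -
  have "integrable lborel (\<lambda>x. indicator K x *\<^sub>R f x)"
    using assms by (intro borel_integrable_compact) (auto intro: continuous_on_subset)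
  moreover have "(\<lambda>x. indicator K x *\<^sub>R f x) = f"
    using assms(3) by (auto simp: fun_eq_iff indicator_def)
  ultimately show ?thesis by simp
qed

text \<open>The difference quotients have integral \<open>0\<close> by translation invariance and converge dominatedly.\<close>

lemma integral_pd_eq_0:
  fixes f :: "'a::euclidean_space \<Rightarrow> real"
  assumes diff: "\<And>x. f differentiable (at x)" and cont: "continuous_on UNIV (pd b f)"
    and K: "compact K" "\<And>x. x \<notin> K \<Longrightarrow> f x = 0"
  shows "(LINT x|lborel. pd b f x) = 0"
proof -
  have contf: "continuous_on UNIV f"
    by (simp add: continuous_on_eq_continuous_at diff differentiable_imp_continuous_within)
  have pd0: "pd b f x = 0" if "x \<notin> K" for x
    using pd_eq_0_outside[of K f x b] K that compact_imp_closed by blast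
  obtain R where R: "K \<subseteq> cball 0 R"
    using compact_imp_bounded[OF K(1)] bounded_subset_ballD[of K 0] ball_subset_cball by blast
  obtain M where M: "\<And>x. \<bar>pd b f x\<bar> \<le> M"
  proof -
    have "bounded (pd b f ` K)"
      using K(1) cont by (intro compact_imp_bounded compact_continuous_image) (auto intro: continuous_on_subset)
    then obtain M where M: "\<forall>y\<in>pd b f ` K. norm y \<le> M"
      unfolding bounded_iff by blast
    have "\<bar>pd b f x\<bar> \<le> max M 0" for x
    proof (cases "x \<in> K")
      case True
      then have "\<bar>pd b f x\<bar> \<le> M" using M by simp
      then show ?thesis by simp
    qed (simp add: pd0)
    then show thesis by (rule that)
  qed
  have der: "((\<lambda>s. f (x + s *\<^sub>R b)) has_real_derivative pd b f (x + s *\<^sub>R b)) (at s)" for x s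
  proof -
    have f: "(f has_derivative frechet_derivative f (at (x + s *\<^sub>R b))) (at (x + s *\<^sub>R b))"
      using diff by (simp add: frechet_derivative_works[symmetric])
    have "((\<lambda>s. x + s *\<^sub>R b) has_derivative (\<lambda>h. h *\<^sub>R b)) (at s)"
      by (auto intro!: derivative_eq_intros)
    from has_derivative_compose[OF this f]
    have "((\<lambda>s. f (x + s *\<^sub>R b)) has_derivative (\<lambda>h. frechet_derivative f (at (x + s *\<^sub>R b)) (h *\<^sub>R b))) (at s)" .
    moreover have "frechet_derivative f (at (x + s *\<^sub>R b)) (h *\<^sub>R b) = pd b f (x + s *\<^sub>R b) * h" for h
      using linear_cmul[OF linear_frechet_derivative[OF diff]] by simp
    ultimately show ?thesis by (simp add: has_field_derivative_def)
  qed
  define q where "q n x = real (Suc n) * (f (x + inverse (real (Suc n)) *\<^sub>R b) - f x)" for n x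
  \<comment> \<open>The mean value theorem makes the quotient a value of the derivative at a point
    at distance at most \<open>norm b\<close> from \<open>x\<close>. That point leaves
    \<open>cball 0 R\<close> as soon as \<open>x\<close> leaves the ball enlarged by
    \<open>norm b\<close>.\<close>
  have q_le: "norm (q n x) \<le> M * indicat_real (cball 0 (R + norm b)) x" for n x
  proof -
    let ?h = "inverse (real (Suc n))"
    have h: "0 < ?h" "?h \<le> 1" by (auto simp: field_simps)
    have "\<exists>z. 0 < z \<and> z < ?h \<and> f (x + ?h *\<^sub>R b) - f (x + 0 *\<^sub>R b) = (?h - 0) * pd b f (x + z *\<^sub>R b)"
      using h der by (intro MVT2) auto
    then obtain z where z: "0 < z" "z < ?h" "f (x + ?h *\<^sub>R b) - f x = ?h * pd b f (x + z *\<^sub>R b)"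
      by auto
    then have q: "q n x = pd b f (x + z *\<^sub>R b)" by (simp add: q_def)
    show ?thesis
    proof (cases "x \<in> cball 0 (R + norm b)")
      case True
      then show ?thesis using M q by simp
    next
      case False
      have "norm x \<le> norm (x + z *\<^sub>R b) + norm (z *\<^sub>R b)"
        by (metis add_diff_cancel_right' norm_triangle_ineq4)
      moreover have "norm (z *\<^sub>R b) \<le> norm b"
        using z h by (simp add: mult_left_le_one_le)
      ultimately have "x + z *\<^sub>R b \<notin> cball 0 R" using False by auto
      then have "pd b f (x + z *\<^sub>R b) = 0" using R by (intro pd0) blast
      then show ?thesis using False q by simp
    qed
  qed
  have q_lim: "(\<lambda>n. q n x) \<longlonglongrightarrow> pd b f x" for x
  proof -
    have "((\<lambda>h. (f (x + h *\<^sub>R b) - f x) / h) \<longlongrightarrow> pd b f x) (at 0)"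
      using der[of x 0] by (simp add: has_field_derivative_iff)
    moreover have "filterlim (\<lambda>n. inverse (real (Suc n))) (at 0) sequentially"
      by (intro filterlim_atI LIMSEQ_inverse_real_of_nat always_eventually) auto
    ultimately have "(\<lambda>n. (f (x + inverse (real (Suc n)) *\<^sub>R b) - f x) / inverse (real (Suc n))) \<longlonglongrightarrow> pd b f x"
      by (rule filterlim_compose)
    then show ?thesis by (simp add: q_def[abs_def] divide_inverse mult.commute)
  qed
  have fi: "integrable lborel f" by (rule integrable_compact_support[OF contf K])
  have shift: "integrable lborel (\<lambda>x. f (x + c))" "(LINT x|lborel. f (x + c)) = (LINT x|lborel. f x)" for c
  proof -
    have d: "distr lborel borel (\<lambda>x. x + c) = lborel"
      using lborel_distr_plus[of c] by (simp add: add.commute[of _ c] fun_eq_iff cong: distr_cong)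
    show "integrable lborel (\<lambda>x. f (x + c))"
      using fi by (subst (asm) d[symmetric]) (subst (asm) integrable_distr_eq, auto simp: borel_measurable_continuous_onI[OF contf])
    show "(LINT x|lborel. f (x + c)) = (LINT x|lborel. f x)"
      by (subst (2) d[symmetric]) (simp add: integral_distr borel_measurable_continuous_onI[OF contf])
  qed
  have "(LINT x|lborel. q n x) = 0" for n
    using shift fi by (simp add: q_def Bochner_Integration.integral_diff)
  moreover have "(\<lambda>n. LINT x|lborel. q n x) \<longlonglongrightarrow> (LINT x|lborel. pd b f x)"
  proof (rule integral_dominated_convergence[where w = "\<lambda>x. M * indicat_real (cball 0 (R + norm b)) x"])
    show "pd b f \<in> borel_measurable lborel"
      using borel_measurable_continuous_onI[OF cont] by simp
    show "q n \<in> borel_measurable lborel" for n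
      unfolding q_def
      using borel_measurable_integrable[OF shift(1)] borel_measurable_integrable[OF fi] by measurable
    show "integrable lborel (\<lambda>x. M * indicat_real (cball 0 (R + norm b)) x)"
      by (intro integrable_mult_right integrable_real_indicator emeasure_bounded_finite bounded_cball) simp
  qed (use q_le q_lim in auto)
  ultimately show ?thesis by (simp add: LIMSEQ_const_iff)
qed

lemma integral_by_parts_pd:
  assumes f: "f \<in> test_funs G" and g: "smooth g" and b: "b \<in> Basis"
  shows "(LINT x|lborel. f x * pd b g x) = - (LINT x|lborel. pd b f x * g x)"
proof -
  obtain K where K: "smooth f" "compact K" "K \<subseteq> G" "\<And>x. x \<notin> K \<Longrightarrow> f x = 0"
    using f by (rule test_funsE) (rule that)
  have pd0: "pd b f x = 0" if "x \<notin> K" for x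
    using pd_eq_0_outside[of K f x b] K that compact_imp_closed by blast
  have pd: "pd b (\<lambda>x. f x * g x) = (\<lambda>x. f x * pd b g x + pd b f x * g x)"
    by (intro ext pd_mult smooth_differentiable K g)
  note c = smooth_continuous[OF K(1)] smooth_continuous[OF g] smooth_continuous[OF smooth_pd[OF K(1) b]]
    smooth_continuous[OF smooth_pd[OF g b]]
  have "(LINT x|lborel. pd b (\<lambda>x. f x * g x) x) = 0"
  proof (rule integral_pd_eq_0[OF _ _ K(2)])
    show "(\<lambda>x. f x * g x) differentiable at x" for x
      by (intro smooth_differentiable smooth_mult K g)
    show "continuous_on UNIV (pd b (\<lambda>x. f x * g x))"
      unfolding pd by (intro continuous_intros c)
  qed (simp add: K)
  moreover have "integrable lborel (\<lambda>x. f x * pd b g x)" "integrable lborel (\<lambda>x. pd b f x * g x)"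
    using K(4) pd0 by (auto intro!: integrable_compact_support[OF _ K(2)] continuous_intros c)
  ultimately show ?thesis by (simp add: pd)
qed

text \<open>Moving the derivatives over one at a time differentiates \<open>f\<close> in the reverse
  order; the existential keeps that order out of the statement. Two features matter later:
  \<open>h\<close> is independent of \<open>g\<close>, and \<open>g\<close> is any smooth function,
  since \<open>f\<close> alone provides the compact support.\<close>

lemma integral_by_parts:
  assumes "f \<in> test_funs G" "set bs \<subseteq> Basis"
  shows "\<exists>h\<in>test_funs G. \<forall>g. smooth g \<longrightarrow>
    (LINT x|lborel. f x * iter_partial bs g x) = (-1) ^ length bs * (LINT x|lborel. h x * g x)"
  using assms
proof (induction bs arbitrary: f)
  case Nil
  then show ?case by auto
next
  case (Cons b bs)
  have "pd b f \<in> test_funs G" using Cons.prems by (auto intro: test_funs_pd)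
  from Cons.IH[OF this] Cons.prems obtain h where h: "h \<in> test_funs G"
    "\<And>g. smooth g \<Longrightarrow> (LINT x|lborel. pd b f x * iter_partial bs g x) = (-1) ^ length bs * (LINT x|lborel. h x * g x)"
    by auto
  have "(LINT x|lborel. f x * iter_partial (b # bs) g x) = (-1) ^ length (b # bs) * (LINT x|lborel. h x * g x)"
    if "smooth g" for g
    using integral_by_parts_pd[OF Cons.prems(1) smooth_iter_partial[OF that, of bs], of b] h(2)[OF that] Cons.prems(2)
    by simp
  with h(1) show ?case by blast
qed

subsection \<open>Square integrable functions\<close>

lemma sq_integrable_mult:
  assumes f: "f \<in> sq_integrable G" and g: "g \<in> sq_integrable G"
  shows "integrable (lebesgue_on G) (\<lambda>x. f x * g x)"
proof (rule Bochner_Integration.integrable_bound)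
  show "integrable (lebesgue_on G) (\<lambda>x. (f x)\<^sup>2 + (g x)\<^sup>2)"
    using assms by (auto simp: sq_integrable_def)
  show "(\<lambda>x. f x * g x) \<in> borel_measurable (lebesgue_on G)"
    using assms by (auto simp: sq_integrable_def)
  have "\<bar>f x * g x\<bar> \<le> (f x)\<^sup>2 + (g x)\<^sup>2" for x
  proof -
    have "2 * (\<bar>f x\<bar> * \<bar>g x\<bar>) \<le> (f x)\<^sup>2 + (g x)\<^sup>2"
      using sum_squares_bound[of "\<bar>f x\<bar>" "\<bar>g x\<bar>"] by simp
    moreover have "0 \<le> \<bar>f x\<bar> * \<bar>g x\<bar>" by simp
    ultimately show ?thesis unfolding abs_mult by linarith
  qed
  then show "AE x in lebesgue_on G. norm (f x * g x) \<le> norm ((f x)\<^sup>2 + (g x)\<^sup>2)"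
    by simp
qed

lemma sq_integrable_scale: "f \<in> sq_integrable G \<Longrightarrow> (\<lambda>x. c * f x) \<in> sq_integrable G"
  by (auto simp: sq_integrable_def power_mult_distrib)

lemma sq_integrable_add:
  assumes "f \<in> sq_integrable G" "g \<in> sq_integrable G"
  shows "(\<lambda>x. f x + g x) \<in> sq_integrable G"
proof -
  have "integrable (lebesgue_on G) (\<lambda>x. (f x)\<^sup>2 + (g x)\<^sup>2 + 2 * (f x * g x))"
    using sq_integrable_mult[OF assms] assms
    by (intro Bochner_Integration.integrable_add integrable_mult_right) (auto simp: sq_integrable_def)
  then have "integrable (lebesgue_on G) (\<lambda>x. (f x + g x)\<^sup>2)"
    by (simp add: power2_sum mult.assoc)
  then show ?thesis using assms by (auto simp: sq_integrable_def)
qed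

lemma sq_integrable_cong_AE:
  assumes G: "G \<in> sets lebesgue" and f: "f \<in> sq_integrable G" and eq: "AE x in lebesgue_on G. f x = g x"
  shows "g \<in> sq_integrable G"
proof -
  have g: "g \<in> borel_measurable (lebesgue_on G)"
    using f by (intro borel_measurable_lebesgue_on_cong_AE[OF G _ eq]) (simp add: sq_integrable_def)
  moreover have "integrable (lebesgue_on G) (\<lambda>x. (g x)\<^sup>2)"
  proof (rule integrable_cong_AE_imp)
    show "integrable (lebesgue_on G) (\<lambda>x. (f x)\<^sup>2)" using f by (simp add: sq_integrable_def)
    show "AE x in lebesgue_on G. (f x)\<^sup>2 = (g x)\<^sup>2" using eq by eventually_elim simp
  qed (use g in simp)
  ultimately show ?thesis by (simp add: sq_integrable_def)
qed

definition l2norm :: "'a::euclidean_space set \<Rightarrow> ('a \<Rightarrow> real) \<Rightarrow> real" where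
  "l2norm G f = sqrt (LINT x|lebesgue_on G. (f x)\<^sup>2)"

lemma l2norm_nonneg: "0 \<le> l2norm G f"
  by (simp add: l2norm_def)

lemma l2norm_power2: "(l2norm G f)\<^sup>2 = (LINT x|lebesgue_on G. (f x)\<^sup>2)"
  by (simp add: l2norm_def)

lemma l2norm_scale: "l2norm G (\<lambda>x. c * f x) = \<bar>c\<bar> * l2norm G f"
  by (simp add: l2norm_def power_mult_distrib real_sqrt_mult)

lemma l2norm_add_power2:
  assumes "f \<in> sq_integrable G" "g \<in> sq_integrable G"
  shows "(l2norm G (\<lambda>x. f x + g x))\<^sup>2
    = (l2norm G f)\<^sup>2 + (l2norm G g)\<^sup>2 + 2 * (LINT x|lebesgue_on G. f x * g x)"
proof -
  have i: "integrable (lebesgue_on G) (\<lambda>x. (f x)\<^sup>2)" "integrable (lebesgue_on G) (\<lambda>x. (g x)\<^sup>2)"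
    "integrable (lebesgue_on G) (\<lambda>x. 2 * (f x * g x))"
    using assms sq_integrable_mult[OF assms] by (auto simp: sq_integrable_def)
  have "(LINT x|lebesgue_on G. (f x + g x)\<^sup>2) = (LINT x|lebesgue_on G. (f x)\<^sup>2 + (g x)\<^sup>2 + 2 * (f x * g x))"
    by (simp add: power2_sum mult.assoc)
  also have "\<dots> = (LINT x|lebesgue_on G. (f x)\<^sup>2) + (LINT x|lebesgue_on G. (g x)\<^sup>2)
      + (LINT x|lebesgue_on G. 2 * (f x * g x))"
    using i by (simp only: Bochner_Integration.integral_add Bochner_Integration.integrable_add)
  finally show ?thesis by (simp add: l2norm_power2)
qed

lemma l2_Cauchy_Schwarz:
  assumes f: "f \<in> sq_integrable G" and g: "g \<in> sq_integrable G"
  shows "\<bar>LINT x|lebesgue_on G. f x * g x\<bar> \<le> l2norm G f * l2norm G g"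
proof -
  define A B C where "A = l2norm G f" and "B = l2norm G g" and "C = (LINT x|lebesgue_on G. f x * g x)"
  \<comment> \<open>The squared norm of f + t g is a quadratic polynomial in \<open>t\<close> that
    is never negative.\<close>
  have pos: "0 \<le> A\<^sup>2 + t\<^sup>2 * B\<^sup>2 + 2 * (t * C)" for t
    using zero_le_power2[of "l2norm G (\<lambda>x. f x + t * g x)"]
    unfolding l2norm_add_power2[OF f sq_integrable_scale[OF g]] l2norm_scale
    by (simp add: power_mult_distrib A_def B_def C_def mult.left_commute)
  have nn: "0 \<le> A" "0 \<le> B" by (simp_all add: A_def B_def l2norm_nonneg)
  have "C\<^sup>2 \<le> (A * B)\<^sup>2"
  proof (cases "B = 0")
    case True
    have "C = 0"
    proof (rule ccontr)
      assume "C \<noteq> 0"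
      \<comment> \<open>For B = 0 the polynomial is affine in \<open>t\<close> and equals -1 at this
        point.\<close>
      then show False using pos[of "- (A\<^sup>2 + 1) / (2 * C)"] True by (simp add: field_simps)
    qed
    then show ?thesis by simp
  next
    case False
    then have "0 < B\<^sup>2" by simp
    \<comment> \<open>-C/B^2 is the minimiser of the quadratic; the factor B^2 clears
      denominators.\<close>
    have "0 \<le> B\<^sup>2 * (A\<^sup>2 + (- C / B\<^sup>2)\<^sup>2 * B\<^sup>2 + 2 * ((- C / B\<^sup>2) * C))"
      by (rule mult_nonneg_nonneg[OF zero_le_power2 pos])
    also have "\<dots> = (A * B)\<^sup>2 - C\<^sup>2"
      using False by (simp add: field_simps power2_eq_square)
    finally show ?thesis by simp
  qed
  then have "\<bar>C\<bar> \<le> A * B" using nn abs_le_square_iff[of C "A * B"] by simp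
  then show ?thesis by (simp add: A_def B_def C_def)
qed

lemma l2norm_triangle:
  assumes f: "f \<in> sq_integrable G" and g: "g \<in> sq_integrable G"
  shows "l2norm G (\<lambda>x. f x + g x) \<le> l2norm G f + l2norm G g"
proof (rule power2_le_imp_le)
  show "(l2norm G (\<lambda>x. f x + g x))\<^sup>2 \<le> (l2norm G f + l2norm G g)\<^sup>2"
    using l2norm_add_power2[OF f g] l2_Cauchy_Schwarz[OF f g] by (simp add: power2_sum)
qed (simp add: l2norm_nonneg)

lemma l2norm_eq_0:
  assumes f: "f \<in> sq_integrable G" and "l2norm G f = 0"
  shows "AE x in lebesgue_on G. f x = 0"
proof -
  have "integrable (lebesgue_on G) (\<lambda>x. (f x)\<^sup>2)" using f by (simp add: sq_integrable_def)
  then have "AE x in lebesgue_on G. (f x)\<^sup>2 = 0"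
    using assms(2) integral_nonneg_eq_0_iff_AE[of _ "\<lambda>x. (f x)\<^sup>2"] by (simp add: l2norm_def)
  then show ?thesis by simp
qed

lemma l2norm_cong_AE:
  assumes G: "G \<in> sets lebesgue" and eq: "AE x in lebesgue_on G. f x = g x"
  shows "l2norm G f = l2norm G g"
proof -
  have "AE x in lebesgue_on G. (f x)\<^sup>2 = (g x)\<^sup>2" using eq by eventually_elim simp
  from integral_lebesgue_on_cong_AE[OF G this] show ?thesis by (simp add: l2norm_def)
qed

subsection \<open>The fundamental lemma of the calculus of variations\<close>

text \<open>Boxes form an intersection-stable generator of the Borel sets, and the sets over which
  \<open>f\<close> integrates to 0 form a Dynkin system. The hypothesis on the total integral covers
  complements, the whole space not being a box. Uniqueness of densities then gives the
  claim.\<close>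

lemma AE_eq_0_if_integral_box_eq_0:
  fixes f :: "'a::euclidean_space \<Rightarrow> real"
  assumes f: "integrable lborel f" and f0: "(LINT x|lborel. f x) = 0"
    and box: "\<And>a b. (LINT x:box a b|lborel. f x) = 0"
  shows "AE x in lborel. f x = 0"
proof -
  have si: "set_integrable lborel A f" if "A \<in> sets lborel" for A
    unfolding set_integrable_def by (rule integrable_mult_indicator[OF that f])
  have "(LINT x:A|lborel. f x) = 0" if "A \<in> sets lborel" for A
  proof -
    let ?B = "range (\<lambda>(a, b). box a b) :: 'a set set"
    have "Int_stable ?B"
      unfolding Int_stable_def by (auto simp: box_Int_box)
    moreover have "A \<in> sigma_sets UNIV ?B"
      using that by (simp add: borel_eq_box)
    ultimately show ?thesis
    proof (induction rule: sigma_sets_induct_disjoint[OF _ subset_UNIV[of ?B, folded Pow_UNIV],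
        consumes 2, case_names basic empty compl union])
      case (compl B)
      then have B: "B \<in> sets lborel" by (simp add: borel_eq_box)
      have "(LINT x:UNIV - B|lborel. f x) + (LINT x:B|lborel. f x) = (LINT x:(UNIV - B) \<union> B|lborel. f x)"
        using B si by (intro set_integral_Un[symmetric]) auto
      then show ?case using compl f0 by (simp add: set_lebesgue_integral_def)
    next
      case (union B)
      then have B: "B i \<in> sets lborel" for i by (auto simp: borel_eq_box)
      have "(LINT x:(\<Union>i. B i)|lborel. f x) = (\<Sum>i. (LINT x:B i|lborel. f x))"
        using B union(1) by (intro lebesgue_integral_countable_add si) (auto simp: disjoint_family_on_def)
      then show ?case using union by simp
    qed (use box in \<open>auto simp: set_lebesgue_integral_def\<close>)
  qed
  then show ?thesis
    using density_unique_real[OF f integrable_zero] by (simp add: set_lebesgue_integral_def)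
qed

lemma sq_integrable_indicator:
  assumes "bounded S" "S \<in> sets lebesgue" "G \<in> sets lebesgue"
  shows "indicat_real S \<in> sq_integrable G"
proof -
  have "integrable lebesgue (indicat_real (S \<inter> G))"
  proof (rule integrable_real_indicator)
    show "S \<inter> G \<in> sets lebesgue" using assms by blast
    have "S \<inter> G \<in> lmeasurable"
      using assms by (intro bounded_set_imp_lmeasurable) auto
    then show "emeasure lebesgue (S \<inter> G) < \<infinity>" by (auto simp only: fmeasurable_def)
  qed
  moreover have "indicat_real (S \<inter> G) = (\<lambda>x. indicat_real G x * indicat_real S x)"
    by (auto simp: indicator_def fun_eq_iff)
  ultimately have "integrable (lebesgue_on G) (indicat_real S)"
    using assms(3) by (simp add: integrable_restrict_space)
  moreover have "(\<lambda>x. (indicat_real S x)\<^sup>2) = indicat_real S"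
    by (auto simp: indicator_def fun_eq_iff)
  ultimately show ?thesis by (simp add: sq_integrable_def borel_measurable_integrable)
qed

lemma test_funs_sq_integrable:
  assumes f: "f \<in> test_funs H" and G: "G \<in> sets lebesgue"
  shows "f \<in> sq_integrable G"
proof -
  obtain K where K: "smooth f" "compact K" "K \<subseteq> H" "\<And>x. x \<notin> K \<Longrightarrow> f x = 0"
    using f by (rule test_funsE) (rule that)
  have c: "continuous_on UNIV f" by (rule smooth_continuous[OF K(1)])
  have "integrable lborel (\<lambda>x. (f x)\<^sup>2)"
    using K(4) by (intro integrable_compact_support[OF _ K(2)] continuous_intros c) auto
  then have "integrable lebesgue (\<lambda>x. (f x)\<^sup>2)"
    using integrable_completion[OF borel_measurable_integrable] by blast
  from integrable_mult_indicator[OF G this] have "integrable (lebesgue_on G) (\<lambda>x. (f x)\<^sup>2)"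
    using G by (simp add: integrable_restrict_space)
  moreover have "f \<in> borel_measurable (lebesgue_on G)"
    using borel_measurable_continuous_onI[OF c]
    by (intro measurable_restrict_space1 measurable_completion) simp
  ultimately show ?thesis by (simp add: sq_integrable_def)
qed

text \<open>Inside a box whose closure lies in \<open>G\<close>, the functions
  \<open>box_bump\<close> are admissible and converge to indicators of subboxes, so all integrals of
  \<open>w\<close> over subboxes vanish and \<open>w\<close> is 0 there. Countably many such boxes
  cover \<open>G\<close>.\<close>

lemma fundamental_lemma:
  fixes w :: "'a::euclidean_space \<Rightarrow> real"
  assumes G: "open G" and w: "w \<in> sq_integrable G"
    and test: "\<And>\<phi>. \<phi> \<in> test_funs G \<Longrightarrow> (LINT x|lebesgue_on G. w x * \<phi> x) = 0"
  shows "AE x in lebesgue_on G. w x = 0"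
proof -
  have Gm: "G \<in> sets lebesgue" using G by simp
  have box0: "AE x in lebesgue. x \<in> box a b \<longrightarrow> w x = 0" if ab: "cbox a b \<subseteq> G" for a b
  proof -
    have sub: "box a b \<subseteq> G" using ab box_subset_cbox by blast
    have int: "integrable (lebesgue_on G) (\<lambda>x. w x * indicat_real (cbox a b) x)"
      by (intro sq_integrable_mult w sq_integrable_indicator bounded_cbox Gm) simp
    have zero: "(LINT x|lebesgue_on G. w x * indicat_real (box c d) x) = 0"
      if cd: "box c d \<subseteq> box a b" for c d
    proof -
      have t: "box_bump c d n \<in> test_funs G" for n
        using cd ab box_subset_cbox[of a b] by (intro box_bump_test_funs[where c = a and d = b]) auto
      have "(\<lambda>n. LINT x|lebesgue_on G. w x * box_bump c d n x)
          \<longlonglongrightarrow> (LINT x|lebesgue_on G. w x * indicat_real (box c d) x)"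
      \<comment> \<open>\<open>w\<close> is only square integrable on \<open>G\<close>, but its
        product with the indicator of a bounded box is integrable.\<close>
      proof (rule integral_dominated_convergence[where w = "\<lambda>x. \<bar>w x * indicat_real (cbox a b) x\<bar>"])
        show "(\<lambda>x. w x * indicat_real (box c d) x) \<in> borel_measurable (lebesgue_on G)"
          by (intro borel_measurable_integrable sq_integrable_mult w sq_integrable_indicator bounded_box Gm) simp
        show "(\<lambda>x. w x * box_bump c d n x) \<in> borel_measurable (lebesgue_on G)" for n
          by (intro borel_measurable_integrable sq_integrable_mult w test_funs_sq_integrable[OF t Gm])
        show "integrable (lebesgue_on G) (\<lambda>x. \<bar>w x * indicat_real (cbox a b) x\<bar>)"
          using int by (rule integrable_abs)
        show "AE x in lebesgue_on G. (\<lambda>n. w x * box_bump c d n x) \<longlonglongrightarrow> w x * indicat_real (box c d) x"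
          by (intro AE_I2 tendsto_mult tendsto_const box_bump_tendsto)
        show "AE x in lebesgue_on G. norm (w x * box_bump c d n x) \<le> \<bar>w x * indicat_real (cbox a b) x\<bar>" for n
        proof (rule AE_I2)
          fix x
          have "\<bar>box_bump c d n x\<bar> \<le> indicat_real (cbox a b) x"
            using box_bump_bounds[of c d n x] box_bump_support[of c d n] cd box_subset_cbox[of a b]
            by (cases "x \<in> cbox a b") auto
          then show "norm (w x * box_bump c d n x) \<le> \<bar>w x * indicat_real (cbox a b) x\<bar>"
            by (simp add: abs_mult mult_left_mono)
        qed
      qed
      then show ?thesis using test[OF t] by (simp add: LIMSEQ_const_iff)
    qed
    define f where "f x = (if x \<in> box a b then w x else 0)" for x
    have f_eq: "(LINT x|lebesgue. indicat_real (box c d) x * f x)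
        = (LINT x|lebesgue_on G. w x * indicat_real (box c d \<inter> box a b) x)" for c d
      using Gm sub by (simp add: integral_restrict_space, intro Bochner_Integration.integral_cong)
        (auto simp: f_def indicator_def)
    have "integrable lebesgue (\<lambda>x. indicator G x *\<^sub>R (w x * indicat_real (box a b) x))"
      using sq_integrable_mult[OF w sq_integrable_indicator[of "box a b"]] Gm
      by (simp add: integrable_restrict_space bounded_box)
    moreover have "(\<lambda>x. indicator G x *\<^sub>R (w x * indicat_real (box a b) x)) = f"
      using sub by (auto simp: f_def indicator_def fun_eq_iff)
    ultimately have fi: "integrable lebesgue f" by simp
    \<comment> \<open>\<open>f\<close> is Lebesgue measurable, whereas the criterion for boxes is
      stated for Borel measure; hence the passage to a Borel version.\<close>
    obtain f' where f': "f' \<in> borel_measurable lborel" "AE x in lborel. f x = f' x"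
      using completion_ex_borel_measurable_real[OF borel_measurable_integrable[OF fi]] by auto
    have ff': "AE x in lebesgue. f x = f' x" using f'(2) by (rule AE_completion)
    have f'i: "integrable lborel f'"
    proof -
      have "integrable lebesgue f'"
        using f'(1) ff' by (intro integrable_cong_AE_imp[OF fi] measurable_completion) auto
      then show ?thesis using integrable_completion[OF f'(1)] by simp
    qed
    have boxes: "(LINT x:box c d|lborel. f' x) = 0" for c d
    proof -
      have "(LINT x:box c d|lborel. f' x) = (LINT x|lebesgue. indicat_real (box c d) x * f' x)"
        using f'(1) unfolding set_lebesgue_integral_def by (subst integral_completion) auto
      also have "\<dots> = (LINT x|lebesgue. indicat_real (box c d) x * f x)"
      proof (rule integral_cong_AE)
        show "AE x in lebesgue. indicat_real (box c d) x * f' x = indicat_real (box c d) x * f x"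
          using ff' by eventually_elim simp
        show "(\<lambda>x. indicat_real (box c d) x * f x) \<in> borel_measurable lebesgue"
          using borel_measurable_integrable[OF fi] by (intro borel_measurable_times borel_measurable_indicator) auto
        show "(\<lambda>x. indicat_real (box c d) x * f' x) \<in> borel_measurable lebesgue"
          using measurable_completion[OF f'(1)] by (intro borel_measurable_times borel_measurable_indicator) auto
      qed
      also have "\<dots> = 0"
      proof -
        obtain p q where "box c d \<inter> box a b = box p q" by (simp add: box_Int_box)
        then show ?thesis using f_eq zero[of p q] by (metis inf_le2)
      qed
      finally show ?thesis .
    qed
    have "(LINT x|lborel. f' x) = 0"
    proof -
      have "(LINT x|lborel. f' x) = (LINT x|lebesgue. f' x)"
        using f'(1) by (simp add: integral_completion)
      also have "\<dots> = (LINT x|lebesgue. f x)"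
        using ff' measurable_completion[OF f'(1)] borel_measurable_integrable[OF fi]
        by (intro integral_cong_AE) (auto simp: eq_commute)
      also have "\<dots> = (LINT x|lebesgue. indicat_real (box a b) x * f x)"
        by (intro Bochner_Integration.integral_cong) (auto simp: f_def)
      also have "\<dots> = 0"
        using f_eq[of a b] zero[of a b] by simp
      finally show ?thesis .
    qed
    then have "AE x in lborel. f' x = 0"
      by (intro AE_eq_0_if_integral_box_eq_0 f'i boxes)
    then have "AE x in lebesgue. f' x = 0" by (rule AE_completion)
    with ff' show ?thesis by eventually_elim (auto simp: f_def split: if_splits)
  qed
  obtain \<D> where D: "countable \<D>" "\<D> \<subseteq> Pow G" "\<And>X. X \<in> \<D> \<Longrightarrow> \<exists>a b. X = cbox a b" "\<Union>\<D> = G"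
    using open_countable_Union_open_cbox[OF G] by metis
  have "AE x in lebesgue. \<forall>X\<in>\<D>. x \<in> X \<longrightarrow> w x = 0"
  proof (subst AE_ball_countable[OF D(1)], rule ballI)
    fix X assume X: "X \<in> \<D>"
    then obtain a b where ab: "X = cbox a b" using D(3) by blast
    \<comment> \<open>The cover consists of closed boxes and \<open>box0\<close> treats open ones;
      the faces form a null set.\<close>
    have "AE x in lebesgue. x \<notin> cbox a b - box a b"
      using negligible_frontier_interval[of a b] by (intro AE_not_in) (simp add: negligible_iff_null_sets)
    moreover have "AE x in lebesgue. x \<in> box a b \<longrightarrow> w x = 0"
      using X D(2) ab by (intro box0) auto
    ultimately show "AE x in lebesgue. x \<in> X \<longrightarrow> w x = 0"
      unfolding ab by eventually_elim blast
  qed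
  then have "AE x in lebesgue. x \<in> G \<longrightarrow> w x = 0"
    using D(4) by (auto elim!: eventually_mono)
  then show ?thesis using Gm by (simp add: AE_restrict_space_iff)
qed

subsection \<open>Sobolev spaces\<close>

lemma finite_multi_indices: "finite (multi_indices m :: 'a::euclidean_space multiset set)"
proof -
  have "multi_indices m = (\<Union>k\<le>m. multisets_of_size (Basis :: 'a set) k)"
    by (auto simp: multi_indices_def multisets_of_size_def)
  then show ?thesis by (simp add: finite_multisets_of_size)
qed

lemma partial_iter_partial:
  assumes "set_mset \<alpha> \<subseteq> Basis"
  obtains bs where "partial \<alpha> = iter_partial bs" "set bs \<subseteq> Basis" "length bs = size \<alpha>"
proof
  let ?bs = "SOME bs. mset bs = \<alpha>"
  have m: "mset ?bs = \<alpha>" by (rule someI_ex) (rule ex_mset)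
  show "partial \<alpha> = iter_partial ?bs" by (simp add: partial_def fun_eq_iff)
  show "set ?bs \<subseteq> Basis" using assms m by (metis set_mset_mset)
  show "length ?bs = size \<alpha>" using m by (metis size_mset)
qed

lemma test_funs_iter_partial: "f \<in> test_funs G \<Longrightarrow> set bs \<subseteq> Basis \<Longrightarrow> iter_partial bs f \<in> test_funs G"
  by (induction bs) (auto intro: test_funs_pd)

lemma test_funs_partial: "f \<in> test_funs G \<Longrightarrow> set_mset \<alpha> \<subseteq> Basis \<Longrightarrow> partial \<alpha> f \<in> test_funs G"
  by (rule partial_iter_partial[of \<alpha>]) (simp_all add: test_funs_iter_partial)

lemma partial_empty: "partial {#} f = f"
  by (simp add: partial_def)

lemma test_funs_smooth: "f \<in> test_funs G \<Longrightarrow> smooth f"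
  by (simp add: test_funs_def)

lemma test_funs_eq_0:
  assumes f: "f \<in> test_funs G" and x: "x \<notin> G"
  shows "f x = 0"
proof -
  obtain K where "K \<subseteq> G" "\<And>x. x \<notin> K \<Longrightarrow> f x = 0"
    using f by (rule test_funsE) (rule that)
  then show ?thesis using x by blast
qed

definition zext :: "'a set \<Rightarrow> ('a \<Rightarrow> real) \<Rightarrow> 'a \<Rightarrow> real" where
  "zext G u = (\<lambda>x. if x \<in> G then u x else 0)"

locale sobolev_space =
  fixes m :: nat and G :: "'a::euclidean_space set"
  assumes open_G: "open G"
begin

abbreviation S where "S \<equiv> sobolev_funs m G"

lemma G: "G \<in> sets lebesgue"
  using open_G by simp

lemma test_sq: "f \<in> test_funs H \<Longrightarrow> f \<in> sq_integrable G"
  by (rule test_funs_sq_integrable[OF _ G])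

lemma multi_indicesD: "\<alpha> \<in> multi_indices m \<Longrightarrow> set_mset \<alpha> \<subseteq> Basis"
  by (simp add: multi_indices_def)

lemma weak_partials_sq: "w \<in> weak_partials G \<alpha> u \<Longrightarrow> w \<in> sq_integrable G"
  by (simp add: weak_partials_def)

lemma weak_partials_unique:
  assumes w: "w \<in> weak_partials G \<alpha> u" and w': "w' \<in> weak_partials G \<alpha> u"
  shows "AE x in lebesgue_on G. w x = w' x"
proof -
  have sq: "w \<in> sq_integrable G" "w' \<in> sq_integrable G" using assms by (auto simp: weak_partials_def)
  have "AE x in lebesgue_on G. w x + (-1) * w' x = 0"
  proof (rule fundamental_lemma[OF open_G])
    show "(\<lambda>x. w x + (-1) * w' x) \<in> sq_integrable G"
      by (intro sq_integrable_add sq_integrable_scale sq)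
    fix \<phi> assume \<phi>: "\<phi> \<in> test_funs G"
    have "(-1) ^ size \<alpha> * (LINT x|lebesgue_on G. w x * \<phi> x) = (-1) ^ size \<alpha> * (LINT x|lebesgue_on G. w' x * \<phi> x)"
      using w w' \<phi> unfolding weak_partials_def by simp
    then have "(LINT x|lebesgue_on G. w x * \<phi> x) = (LINT x|lebesgue_on G. w' x * \<phi> x)"
      by simp
    then show "(LINT x|lebesgue_on G. (w x + (-1) * w' x) * \<phi> x) = 0"
      using sq_integrable_mult[OF sq(1) test_sq[OF \<phi>]] sq_integrable_mult[OF sq(2) test_sq[OF \<phi>]]
      by (simp add: left_diff_distrib)
  qed
  then show ?thesis by eventually_elim simp
qed

lemma weak_partials_cong:
  assumes eq: "AE x in lebesgue_on G. u x = u' x"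
  shows "weak_partials G \<alpha> u = weak_partials G \<alpha> u'"
proof -
  have "(LINT x|lebesgue_on G. u x * g x) = (LINT x|lebesgue_on G. u' x * g x)" for g
  proof (rule integral_lebesgue_on_cong_AE[OF G])
    show "AE x in lebesgue_on G. u x * g x = u' x * g x" using eq by eventually_elim simp
  qed
  then show ?thesis unfolding weak_partials_def by simp
qed

lemma weak_partials_add:
  assumes a: "set_mset \<alpha> \<subseteq> Basis" and u: "u \<in> sq_integrable G" "v \<in> sq_integrable G"
    and w: "w \<in> weak_partials G \<alpha> u" "z \<in> weak_partials G \<alpha> v"
  shows "(\<lambda>x. w x + z x) \<in> weak_partials G \<alpha> (\<lambda>x. u x + v x)"
proof -
  have sq: "w \<in> sq_integrable G" "z \<in> sq_integrable G" using w by (auto simp: weak_partials_def)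
  have "(LINT x|lebesgue_on G. (u x + v x) * partial \<alpha> \<phi> x)
      = (-1) ^ size \<alpha> * (LINT x|lebesgue_on G. (w x + z x) * \<phi> x)" if \<phi>: "\<phi> \<in> test_funs G" for \<phi>
  proof -
    note p = test_sq[OF test_funs_partial[OF \<phi> a]]
    have "(LINT x|lebesgue_on G. u x * partial \<alpha> \<phi> x) = (-1) ^ size \<alpha> * (LINT x|lebesgue_on G. w x * \<phi> x)"
      "(LINT x|lebesgue_on G. v x * partial \<alpha> \<phi> x) = (-1) ^ size \<alpha> * (LINT x|lebesgue_on G. z x * \<phi> x)"
      using w \<phi> by (auto simp: weak_partials_def)
    then show ?thesis
      using sq_integrable_mult[OF u(1) p] sq_integrable_mult[OF u(2) p]
        sq_integrable_mult[OF sq(1) test_sq[OF \<phi>]] sq_integrable_mult[OF sq(2) test_sq[OF \<phi>]]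
      by (simp add: distrib_right distrib_left)
  qed
  then show ?thesis using sq by (simp add: weak_partials_def sq_integrable_add)
qed

lemma weak_partials_scale:
  assumes w: "w \<in> weak_partials G \<alpha> u"
  shows "(\<lambda>x. c * w x) \<in> weak_partials G \<alpha> (\<lambda>x. c * u x)"
  using w by (auto simp: weak_partials_def sq_integrable_scale mult.assoc mult.left_commute)

lemma weak_partials_empty: "u \<in> sq_integrable G \<Longrightarrow> u \<in> weak_partials G {#} u"
  by (simp add: weak_partials_def partial_empty)

lemma weak_partial_in: "w \<in> weak_partials G \<alpha> u \<Longrightarrow> weak_partial G \<alpha> u \<in> weak_partials G \<alpha> u"
  unfolding weak_partial_def by (rule someI[of "\<lambda>w. w \<in> weak_partials G \<alpha> u"])

lemma weak_partial_eq: "w \<in> weak_partials G \<alpha> u \<Longrightarrow> AE x in lebesgue_on G. weak_partial G \<alpha> u x = w x"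
  using weak_partials_unique[OF weak_partial_in] by blast

lemma l2norm_weak_partial: "w \<in> weak_partials G \<alpha> u \<Longrightarrow> l2norm G (weak_partial G \<alpha> u) = l2norm G w"
  by (rule l2norm_cong_AE[OF G weak_partial_eq])

lemma S_simps:
  "vadd S u v = (\<lambda>x. u x + v x)" "vscale S c u = (\<lambda>x. c * u x)"
  "vdiff S u v = (\<lambda>x. u x - v x)"
  by (simp_all add: sobolev_funs_def vdiff_def)

text \<open>In this form the triangle inequality of the Sobolev norm is Minkowski twice: in L2(G),
  then for the finite sum over multi-indices.\<close>

lemma S_norm: "vnorm S u = L2_set (\<lambda>\<alpha>. l2norm G (weak_partial G \<alpha> u)) (multi_indices m)"
  by (simp add: sobolev_funs_def L2_set_def l2norm_power2)

lemma in_S_iff: "u \<in> vecs S \<longleftrightarrow> u \<in> sq_integrable G \<and>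
    (\<forall>\<alpha>\<in>multi_indices m. weak_partial G \<alpha> u \<in> weak_partials G \<alpha> u)"
  unfolding sobolev_funs_def using weak_partial_in by auto

text \<open>\<open>weak_partial\<close> is an arbitrary choice. By uniqueness the norm can be
  computed from any explicitly given weak derivatives, such as sums, multiples or zero
  extensions.\<close>

lemma in_SI:
  assumes "u \<in> sq_integrable G" "\<And>\<alpha>. \<alpha> \<in> multi_indices m \<Longrightarrow> w \<alpha> \<in> weak_partials G \<alpha> u"
  shows "u \<in> vecs S" "vnorm S u = L2_set (\<lambda>\<alpha>. l2norm G (w \<alpha>)) (multi_indices m)"
proof -
  show "u \<in> vecs S" using assms weak_partial_in by (auto simp: in_S_iff)
  show "vnorm S u = L2_set (\<lambda>\<alpha>. l2norm G (w \<alpha>)) (multi_indices m)"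
    unfolding S_norm using l2norm_weak_partial[OF assms(2)] by (intro L2_set_cong) auto
qed

lemma S_add:
  assumes "u \<in> vecs S" "v \<in> vecs S"
  shows "(\<lambda>x. u x + v x) \<in> vecs S" "vnorm S (\<lambda>x. u x + v x) \<le> vnorm S u + vnorm S v"
proof -
  let ?w = "\<lambda>\<alpha> x. weak_partial G \<alpha> u x + weak_partial G \<alpha> v x"
  have uv: "u \<in> sq_integrable G" "v \<in> sq_integrable G"
    and w: "\<And>\<alpha>. \<alpha> \<in> multi_indices m \<Longrightarrow> weak_partial G \<alpha> u \<in> weak_partials G \<alpha> u"
      "\<And>\<alpha>. \<alpha> \<in> multi_indices m \<Longrightarrow> weak_partial G \<alpha> v \<in> weak_partials G \<alpha> v"
    using assms by (auto simp: in_S_iff)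
  have wp: "?w \<alpha> \<in> weak_partials G \<alpha> (\<lambda>x. u x + v x)" if "\<alpha> \<in> multi_indices m" for \<alpha>
    using that by (intro weak_partials_add multi_indicesD uv w)
  note * = in_SI[OF sq_integrable_add[OF uv], of ?w, OF wp]
  show "(\<lambda>x. u x + v x) \<in> vecs S" by (rule *(1))
  have "vnorm S (\<lambda>x. u x + v x) = L2_set (\<lambda>\<alpha>. l2norm G (?w \<alpha>)) (multi_indices m)" by (rule *(2))
  also have "\<dots> \<le> L2_set (\<lambda>\<alpha>. l2norm G (weak_partial G \<alpha> u) + l2norm G (weak_partial G \<alpha> v)) (multi_indices m)"
    by (intro L2_set_mono l2norm_triangle weak_partials_sq[OF w(1)] weak_partials_sq[OF w(2)] l2norm_nonneg)
  also have "\<dots> \<le> vnorm S u + vnorm S v" unfolding S_norm by (rule L2_set_triangle_ineq)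
  finally show "vnorm S (\<lambda>x. u x + v x) \<le> vnorm S u + vnorm S v" .
qed

lemma S_scale:
  assumes "u \<in> vecs S"
  shows "(\<lambda>x. c * u x) \<in> vecs S" "vnorm S (\<lambda>x. c * u x) = \<bar>c\<bar> * vnorm S u"
proof -
  let ?w = "\<lambda>\<alpha> x. c * weak_partial G \<alpha> u x"
  have wp: "?w \<alpha> \<in> weak_partials G \<alpha> (\<lambda>x. c * u x)" if "\<alpha> \<in> multi_indices m" for \<alpha>
    using that assms by (intro weak_partials_scale) (simp add: in_S_iff)
  have "(\<lambda>x. c * u x) \<in> sq_integrable G" using assms by (simp add: in_S_iff sq_integrable_scale)
  note * = in_SI[OF this, of ?w, OF wp]
  show "(\<lambda>x. c * u x) \<in> vecs S" by (rule *(1))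
  show "vnorm S (\<lambda>x. c * u x) = \<bar>c\<bar> * vnorm S u"
    using *(2) by (simp add: S_norm l2norm_scale L2_set_right_distrib)
qed

text \<open>Beyond providing a weak derivative, the identity holds for every smooth
  \<open>g\<close>, also one whose support leaves \<open>G\<close>. This surplus is what makes zero
  extension work.\<close>

lemma test_funs_weak_partials:
  assumes f: "f \<in> test_funs G" and a: "set_mset \<alpha> \<subseteq> Basis"
  shows "\<exists>h\<in>test_funs G. h \<in> weak_partials G \<alpha> f \<and> (\<forall>g. smooth g \<longrightarrow>
    (LINT x|lebesgue_on G. f x * partial \<alpha> g x) = (-1) ^ size \<alpha> * (LINT x|lebesgue_on G. h x * g x))"
proof -
  obtain bs where bs: "partial \<alpha> = iter_partial bs" "set bs \<subseteq> Basis" "length bs = size \<alpha>"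
    using a by (rule partial_iter_partial)
  obtain h where h: "h \<in> test_funs G" "\<And>g. smooth g \<Longrightarrow>
    (LINT x|lborel. f x * iter_partial bs g x) = (-1) ^ length bs * (LINT x|lborel. h x * g x)"
    using integral_by_parts[OF f bs(2)] by blast
  \<comment> \<open>\<open>k\<close> vanishes off \<open>G\<close>, so the integral may be taken
    over the whole space, where integration by parts is available.\<close>
  have eq: "(LINT x|lebesgue_on G. k x * g x) = (LINT x|lborel. k x * g x)"
    if k: "k \<in> test_funs G" and g: "smooth g" for k g
  proof -
    have "(LINT x|lebesgue_on G. k x * g x) = (LINT x|lebesgue. k x * g x)"
      using G test_funs_eq_0[OF k]
      by (simp add: integral_restrict_space) (intro Bochner_Integration.integral_cong, auto simp: indicator_def)
    also have "\<dots> = (LINT x|lborel. k x * g x)"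
      using smooth_continuous[OF smooth_mult[OF test_funs_smooth[OF k] g]]
      by (intro integral_completion) (simp add: borel_measurable_continuous_onI)
    finally show ?thesis .
  qed
  have "(LINT x|lebesgue_on G. f x * partial \<alpha> g x) = (-1) ^ size \<alpha> * (LINT x|lebesgue_on G. h x * g x)"
    if "smooth g" for g
    using h(2)[OF that] eq[OF f smooth_iter_partial[OF that bs(2)]] eq[OF h(1) that] bs by simp
  moreover from this have "h \<in> weak_partials G \<alpha> f"
    using test_sq[OF h(1)] test_funs_smooth by (auto simp: weak_partials_def)
  ultimately show ?thesis using h(1) by blast
qed

lemma test_funs_in_S: "test_funs G \<subseteq> vecs S"
proof
  fix f assume f: "f \<in> test_funs G"
  then have "\<forall>\<alpha>\<in>multi_indices m. \<exists>h. h \<in> weak_partials G \<alpha> f"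
    using test_funs_weak_partials[OF f multi_indicesD] by blast
  then show "f \<in> vecs S"
    using test_sq[OF f] weak_partial_in by (auto simp: in_S_iff)
qed

sublocale S: seminormed S
proof (rule seminormed_funsI)
  show "vecs S \<noteq> {}" using test_funs_in_S zero_in_test_funs by blast
qed (simp_all add: S_simps fun_eq_iff S_add S_scale)

lemma l2norm_le_norm: "u \<in> vecs S \<Longrightarrow> \<alpha> \<in> multi_indices m \<Longrightarrow> l2norm G (weak_partial G \<alpha> u) \<le> vnorm S u"
  unfolding S_norm by (rule member_le_L2_set[OF finite_multi_indices])

lemma l2norm_le_norm_self:
  assumes "u \<in> vecs S" shows "l2norm G u \<le> vnorm S u"
proof -
  have "u \<in> weak_partials G {#} u" using assms weak_partials_empty by (simp add: in_S_iff)
  from l2norm_weak_partial[OF this] l2norm_le_norm[OF assms, of "{#}"]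
  show ?thesis by (simp add: multi_indices_def)
qed

text \<open>Functions equal almost everywhere have the same set of weak derivatives, so
  \<open>weak_partial\<close> chooses literally the same function for both.\<close>

lemma S_cong_AE:
  assumes u: "u \<in> vecs S" and eq: "AE x in lebesgue_on G. u x = v x"
  shows "v \<in> vecs S" "vnorm S v = vnorm S u"
proof -
  have "v \<in> sq_integrable G" using u by (intro sq_integrable_cong_AE[OF G _ eq]) (simp add: in_S_iff)
  moreover have w: "weak_partials G \<alpha> v = weak_partials G \<alpha> u" for \<alpha>
    using weak_partials_cong[OF eq] by simp
  then have w': "weak_partial G \<alpha> v = weak_partial G \<alpha> u" for \<alpha> by (simp add: weak_partial_def)
  ultimately show "v \<in> vecs S" using u by (simp add: in_S_iff w)
  show "vnorm S v = vnorm S u" by (simp add: S_norm w')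
qed

text \<open>The norm dominates the L2 norm because the empty multi-index is among the summands.
  Hence \<open>cls\<close> is identification almost everywhere.\<close>

lemma dist_eq_0_iff_AE:
  assumes u: "u \<in> vecs S" and v: "v \<in> vecs S"
  shows "vnorm S (vdiff S u v) = 0 \<longleftrightarrow> (AE x in lebesgue_on G. u x = v x)"
proof
  assume 0: "vnorm S (vdiff S u v) = 0"
  have d: "vdiff S u v \<in> vecs S" by (rule S.diff_closed[OF u v])
  have "l2norm G (vdiff S u v) = 0"
    using l2norm_le_norm_self[OF d] 0 l2norm_nonneg[of G "vdiff S u v"] by simp
  then have "AE x in lebesgue_on G. vdiff S u v x = 0"
    using d by (intro l2norm_eq_0) (simp_all add: in_S_iff)
  then show "AE x in lebesgue_on G. u x = v x" by eventually_elim (simp add: S_simps)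
next
  assume "AE x in lebesgue_on G. u x = v x"
  then have "AE x in lebesgue_on G. vdiff S u u x = vdiff S u v x"
    by eventually_elim (simp add: S_simps)
  from S_cong_AE(2)[OF S.diff_closed[OF u u] this] show "vnorm S (vdiff S u v) = 0"
    by (simp add: S.dist_self[OF u])
qed

end

subsection \<open>Zero extension\<close>

context sobolev_space begin

text \<open>H_0^m(G) before passing to classes; \<open>vecs_sobolev0\<close> links the two
  levels.\<close>

abbreviation H where "H \<equiv> closure_in S (test_funs G)"

lemma H_subset: "H \<subseteq> vecs S"
  by (auto simp: closure_in_def)

lemma test_funs_in_H: "test_funs G \<subseteq> H"
  using test_funs_in_S S.dist_self by (force simp: closure_in_def)

lemma H_add: "u \<in> H \<Longrightarrow> v \<in> H \<Longrightarrow> (\<lambda>x. u x + v x) \<in> H"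
  using S.closure_in_add_closed[OF test_funs_in_S, of u v] by (simp add: S_simps test_funs_add)

lemma H_scale: "u \<in> H \<Longrightarrow> (\<lambda>x. c * u x) \<in> H"
  using S.closure_in_scale_closed[OF test_funs_in_S, of c u] by (simp add: S_simps test_funs_scale)

lemma vecs_sobolev0: "vecs (sobolev0 m G) = cls S ` H"
  by (simp add: sobolev0_def sobolev_def S.closure_in_quot[OF test_funs_in_S])

lemma sobolev0_simps:
  "vadd (sobolev0 m G) = vadd (quot S)" "vscale (sobolev0 m G) = vscale (quot S)"
  "vnorm (sobolev0 m G) = vnorm (quot S)"
  by (simp_all add: sobolev0_def sobolev_def)

lemma normed_sobolev0: "normed (sobolev0 m G)"
proof -
  interpret Q: normed "quot S" by (rule S.normed_quot)
  have "normed (subspace_on (quot S) (cls S ` H))"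
  proof (rule Q.normed_subspace_on)
    show "cls S ` H \<subseteq> vecs (quot S)" using H_subset by (auto simp: S.cls_in_quot)
    show "cls S ` H \<noteq> {}" using test_funs_in_H zero_in_test_funs by blast
  next
    fix U V assume "U \<in> cls S ` H" "V \<in> cls S ` H"
    then obtain u v where "u \<in> H" "v \<in> H" "U = cls S u" "V = cls S v" by blast
    then show "vadd (quot S) U V \<in> cls S ` H"
      using H_subset by (simp add: S.add_cls subsetD S_simps H_add)
  next
    fix U c assume "U \<in> cls S ` H"
    then obtain u where "u \<in> H" "U = cls S u" by blast
    then show "vscale (quot S) c U \<in> cls S ` H"
      using H_subset by (simp add: S.scale_cls subsetD S_simps H_scale)
  qed
  then show ?thesis
    by (simp add: sobolev0_def sobolev_def S.closure_in_quot[OF test_funs_in_S])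
qed

lemma rep_sobolev0:
  assumes "U \<in> vecs (sobolev0 m G)"
  shows "rep U \<in> H" "rep U \<in> vecs S" "cls S (rep U) = U"
  using S.rep_closure_in[OF test_funs_in_S] assms by (auto simp: vecs_sobolev0)

lemma rep_cls_AE:
  assumes u: "u \<in> vecs S"
  shows "AE x in lebesgue_on G. rep (cls S u) x = u x"
  using S.rep_cls[OF u] dist_eq_0_iff_AE[OF _ u] by blast

lemma cls_eqI_AE: "u \<in> vecs S \<Longrightarrow> v \<in> vecs S \<Longrightarrow> AE x in lebesgue_on G. u x = v x \<Longrightarrow> cls S u = cls S v"
  by (intro S.cls_eq) (simp_all add: dist_eq_0_iff_AE)

text \<open>The test function may be supported in a larger set than \<open>G\<close>: boundary terms vanish for
  elements of \<open>H\<^sub>0\<^sup>m(G)\<close> because they vanish for \<open>C\<^sub>c\<^sup>\<infinity>(G)\<close>, which is dense.\<close>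

lemma H_weak_partial:
  assumes u: "u \<in> H" and a: "\<alpha> \<in> multi_indices m" and \<psi>: "\<psi> \<in> test_funs G'"
  shows "(LINT x|lebesgue_on G. u x * partial \<alpha> \<psi> x)
    = (-1) ^ size \<alpha> * (LINT x|lebesgue_on G. weak_partial G \<alpha> u x * \<psi> x)"
proof -
  let ?p = "partial \<alpha> \<psi>"
  note a' = multi_indicesD[OF a]
  have p: "?p \<in> sq_integrable G" "\<psi> \<in> sq_integrable G"
    using test_sq[OF test_funs_partial[OF \<psi> a']] test_sq[OF \<psi>] by auto
  have uS: "u \<in> vecs S" using u H_subset by blast
  let ?d = "(LINT x|lebesgue_on G. u x * ?p x)
    - (-1) ^ size \<alpha> * (LINT x|lebesgue_on G. weak_partial G \<alpha> u x * \<psi> x)"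
  \<comment> \<open>The summand 1 keeps \<open>C\<close> positive when both norms vanish.\<close>
  define C where "C = l2norm G ?p + l2norm G \<psi> + 1"
  have C: "C > 0" using l2norm_nonneg[of G ?p] l2norm_nonneg[of G \<psi>] by (simp add: C_def)
  have "\<bar>?d\<bar> \<le> e" if e: "e > 0" for e
  proof -
    have "e / C > 0" using e C by simp
    then obtain \<phi> where \<phi>: "\<phi> \<in> test_funs G" "vnorm S (vdiff S u \<phi>) < e / C"
      using u unfolding closure_in_def by blast
    \<comment> \<open>Split \<open>u\<close> into a test function, for which the identity is exact,
      and a remainder \<open>v\<close> of small norm.\<close>
    define v where "v = vdiff S u \<phi>"
    have \<phi>S: "\<phi> \<in> vecs S" using \<phi>(1) test_funs_in_S by blast
    have v: "v \<in> vecs S" unfolding v_def by (rule S.diff_closed[OF uS \<phi>S])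
    have u_eq: "u = (\<lambda>x. v x + \<phi> x)" by (simp add: v_def S_simps)
    obtain h where h: "h \<in> test_funs G" "h \<in> weak_partials G \<alpha> \<phi>" "\<And>g. smooth g \<Longrightarrow>
        (LINT x|lebesgue_on G. \<phi> x * partial \<alpha> g x) = (-1) ^ size \<alpha> * (LINT x|lebesgue_on G. h x * g x)"
      using test_funs_weak_partials[OF \<phi>(1) a'] by blast
    let ?k = "weak_partial G \<alpha> v"
    have k: "?k \<in> weak_partials G \<alpha> v" using v a by (simp add: in_S_iff)
    have sq: "v \<in> sq_integrable G" "\<phi> \<in> sq_integrable G" "?k \<in> sq_integrable G" "h \<in> sq_integrable G"
      using v \<phi>S weak_partials_sq[OF k] weak_partials_sq[OF h(2)] by (simp_all add: in_S_iff)
    have "(\<lambda>x. ?k x + h x) \<in> weak_partials G \<alpha> u"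
      unfolding u_eq by (rule weak_partials_add[OF a' sq(1,2) k h(2)])
    from weak_partial_eq[OF this]
    have "AE x in lebesgue_on G. weak_partial G \<alpha> u x * \<psi> x = (?k x + h x) * \<psi> x"
      by eventually_elim simp
    from integral_lebesgue_on_cong_AE[OF G this]
    have 1: "(LINT x|lebesgue_on G. weak_partial G \<alpha> u x * \<psi> x)
        = (LINT x|lebesgue_on G. ?k x * \<psi> x) + (LINT x|lebesgue_on G. h x * \<psi> x)"
      using sq_integrable_mult[OF sq(3) p(2)] sq_integrable_mult[OF sq(4) p(2)]
      by (simp add: distrib_right)
    have 2: "(LINT x|lebesgue_on G. u x * ?p x)
        = (LINT x|lebesgue_on G. v x * ?p x) + (LINT x|lebesgue_on G. \<phi> x * ?p x)"
      unfolding u_eq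
      using sq_integrable_mult[OF sq(1) p(1)] sq_integrable_mult[OF sq(2) p(1)]
      by (simp add: distrib_right)
    \<comment> \<open>The contributions of \<open>\<phi>\<close> and \<open>h\<close> cancel,
      leaving only terms bounded by the norm of \<open>v\<close>.\<close>
    have "?d = (LINT x|lebesgue_on G. v x * ?p x) - (-1) ^ size \<alpha> * (LINT x|lebesgue_on G. ?k x * \<psi> x)"
      using 1 2 h(3)[OF test_funs_smooth[OF \<psi>]] by (simp add: distrib_left)
    also have "\<bar>\<dots>\<bar> \<le> \<bar>LINT x|lebesgue_on G. v x * ?p x\<bar> + \<bar>LINT x|lebesgue_on G. ?k x * \<psi> x\<bar>"
      by (rule order_trans[OF abs_triangle_ineq4]) (simp add: abs_mult power_abs)
    also have "\<dots> \<le> vnorm S v * l2norm G ?p + vnorm S v * l2norm G \<psi>"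
    proof (rule add_mono)
      show "\<bar>LINT x|lebesgue_on G. v x * ?p x\<bar> \<le> vnorm S v * l2norm G ?p"
        by (rule order_trans[OF l2_Cauchy_Schwarz[OF sq(1) p(1)]])
          (intro mult_right_mono l2norm_le_norm_self v l2norm_nonneg)
      show "\<bar>LINT x|lebesgue_on G. ?k x * \<psi> x\<bar> \<le> vnorm S v * l2norm G \<psi>"
        by (rule order_trans[OF l2_Cauchy_Schwarz[OF sq(3) p(2)]])
          (intro mult_right_mono l2norm_le_norm v a l2norm_nonneg)
    qed
    also have "\<dots> \<le> vnorm S v * C"
      using S.norm_nonneg[OF v] by (simp add: C_def algebra_simps)
    also have "\<dots> \<le> (e / C) * C"
      using \<phi>(2) C by (intro mult_right_mono) (simp_all add: v_def)
    also have "\<dots> = e" using C by simp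
    finally show ?thesis .
  qed
  then have "\<bar>?d\<bar> \<le> 0" by (rule field_le_epsilon[where y = 0, simplified])
  then show ?thesis by simp
qed

end

section \<open>Zero extension as an isometry between Sobolev spaces on nested open sets\<close>

locale zero_extension = X: sobolev_space m G + Y: sobolev_space m G'
  for m :: nat and G G' :: "'a::euclidean_space set" +
  assumes subset: "G \<subseteq> G'"
begin

lemma zext_sq_integrable:
  assumes f: "f \<in> sq_integrable G" shows "zext G f \<in> sq_integrable G'"
proof -
  have "zext G f \<in> borel_measurable (lebesgue_on G')"
    using f X.G Y.G subset by (simp add: zext_def borel_measurable_if_lebesgue_on sq_integrable_def)
  moreover have "integrable (lebesgue_on G') (\<lambda>x. (zext G f x)\<^sup>2)"
  proof -
    have "integrable lebesgue (\<lambda>x. if x \<in> G then (f x)\<^sup>2 else 0)"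
      using f X.G by (simp add: Lebesgue_Measure.integrable_restrict_UNIV sq_integrable_def)
    moreover have "(\<lambda>x. if x \<in> G then (f x)\<^sup>2 else 0) = (\<lambda>x. if x \<in> G' then (zext G f x)\<^sup>2 else 0)"
      using subset by (auto simp: zext_def fun_eq_iff)
    ultimately show ?thesis using Y.G by (simp add: Lebesgue_Measure.integrable_restrict_UNIV)
  qed
  ultimately show ?thesis by (simp add: sq_integrable_def)
qed

lemma integral_zext: "(LINT x|lebesgue_on G'. zext G f x * g x) = (LINT x|lebesgue_on G. f x * g x)"
proof -
  have "(\<lambda>x. zext G f x * g x) = (\<lambda>x. if x \<in> G then f x * g x else 0)"
    by (auto simp: zext_def)
  then show ?thesis using integral_restrict[OF subset X.G Y.G] by simp
qed

lemma l2norm_zext: "l2norm G' (zext G f) = l2norm G f"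
proof -
  have "(\<lambda>x. (zext G f x)\<^sup>2) = (\<lambda>x. if x \<in> G then (f x)\<^sup>2 else 0)"
    by (auto simp: zext_def)
  then show ?thesis using integral_restrict[OF subset X.G Y.G] by (simp add: l2norm_def)
qed

lemma zext_cong_AE:
  assumes "AE x in lebesgue_on G. f x = g x"
  shows "AE x in lebesgue_on G'. zext G f x = zext G g x"
proof -
  have "AE x in lebesgue. x \<in> G \<longrightarrow> f x = g x"
    using assms X.G by (simp add: AE_restrict_space_iff)
  then have "AE x in lebesgue. x \<in> G' \<longrightarrow> zext G f x = zext G g x"
    by eventually_elim (auto simp: zext_def)
  then show ?thesis using Y.G by (simp add: AE_restrict_space_iff)
qed

lemma zext_in_S:
  assumes u: "u \<in> X.H"
  shows "zext G u \<in> vecs Y.S" "vnorm Y.S (zext G u) = vnorm X.S u"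
proof -
  have uS: "u \<in> vecs X.S" using u X.H_subset by blast
  have sq: "zext G u \<in> sq_integrable G'"
    using uS by (intro zext_sq_integrable) (simp add: X.in_S_iff)
  have "zext G (weak_partial G \<alpha> u) \<in> weak_partials G' \<alpha> (zext G u)" if a: "\<alpha> \<in> multi_indices m" for \<alpha>
  proof -
    have "weak_partial G \<alpha> u \<in> sq_integrable G"
      using uS a X.weak_partials_sq by (auto simp: X.in_S_iff)
    then show ?thesis
      using X.H_weak_partial[OF u a] by (simp add: weak_partials_def zext_sq_integrable integral_zext)
  qed
  note * = Y.in_SI[OF sq, of "\<lambda>\<alpha>. zext G (weak_partial G \<alpha> u)", OF this]
  show "zext G u \<in> vecs Y.S" by (rule *(1))
  show "vnorm Y.S (zext G u) = vnorm X.S u"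
    using *(2) by (simp add: X.S_norm l2norm_zext)
qed

text \<open>A test function on \<open>G\<close> is its own zero extension and a test function on
  \<open>G'\<close>, so approximations of \<open>u\<close> also approximate \<open>zext G u\<close>,
  at the same distance.\<close>

lemma zext_in_H:
  assumes u: "u \<in> X.H" shows "zext G u \<in> Y.H"
proof -
  have "\<exists>\<phi>\<in>test_funs G'. vnorm Y.S (vdiff Y.S (zext G u) \<phi>) < e" if e: "e > 0" for e
  proof -
    obtain \<phi> where \<phi>: "\<phi> \<in> test_funs G" "vnorm X.S (vdiff X.S u \<phi>) < e"
      using u e unfolding closure_in_def by blast
    have "\<phi> \<in> X.H" using \<phi>(1) X.test_funs_in_H by blast
    then have "vdiff X.S u \<phi> \<in> X.H"
      using X.H_add[OF u X.H_scale[of \<phi> "-1"]] by (simp add: X.S_simps)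
    from zext_in_S(2)[OF this]
    have "vnorm Y.S (zext G (vdiff X.S u \<phi>)) < e" using \<phi>(2) by simp
    moreover have "zext G (vdiff X.S u \<phi>) = vdiff Y.S (zext G u) \<phi>"
      using test_funs_eq_0[OF \<phi>(1)] by (auto simp: zext_def X.S_simps Y.S_simps fun_eq_iff)
    ultimately show ?thesis using \<phi>(1) test_funs_mono[OF subset] by auto
  qed
  then show ?thesis using zext_in_S(1)[OF u] by (simp add: closure_in_def)
qed

lemma zero_ext_eq: "zero_ext m G G' U = cls Y.S (zext G (rep U))"
  by (simp add: zero_ext_def zext_def)

text \<open>\<open>zero_ext\<close> extends the function chosen by \<open>rep\<close>; any other
  representative in \<open>H\<close> differs from it on a null set and has the same extended class.
  Linearity can therefore be checked on functions.\<close>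

lemma zero_ext_cls:
  assumes u: "u \<in> X.H"
  shows "zero_ext m G G' (cls X.S u) = cls Y.S (zext G u)"
proof -
  have uS: "u \<in> vecs X.S" using u X.H_subset by blast
  have U: "cls X.S u \<in> vecs (sobolev0 m G)" using u by (simp add: X.vecs_sobolev0)
  show ?thesis
    unfolding zero_ext_eq
    by (intro Y.cls_eqI_AE zext_in_S(1) u X.rep_sobolev0(1)[OF U] zext_cong_AE X.rep_cls_AE uS)
qed

lemma linear_isometry_zero_ext: "linear_isometry (sobolev0 m G) (sobolev0 m G') (zero_ext m G G')"
proof -
  have H: "U \<in> vecs (sobolev0 m G) \<Longrightarrow> \<exists>u\<in>X.H. u \<in> vecs X.S \<and> U = cls X.S u" for U
    using X.H_subset by (auto simp: X.vecs_sobolev0)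
  show ?thesis
  proof (intro linear_isometry.intro linear_isometry_axioms.intro X.normed_sobolev0 Y.normed_sobolev0)
    fix U assume "U \<in> vecs (sobolev0 m G)"
    with H obtain u where u: "u \<in> X.H" "u \<in> vecs X.S" "U = cls X.S u" by blast
    show "zero_ext m G G' U \<in> vecs (sobolev0 m G')"
      using u by (simp add: zero_ext_cls Y.vecs_sobolev0 zext_in_H)
    show "vnorm (sobolev0 m G') (zero_ext m G G' U) = vnorm (sobolev0 m G) U"
      using u zext_in_S[OF u(1)]
      by (simp add: zero_ext_cls X.sobolev0_simps Y.sobolev0_simps X.S.norm_cls Y.S.norm_cls)
    fix c
    have "zext G (\<lambda>x. c * u x) = (\<lambda>x. c * zext G u x)" by (auto simp: zext_def)
    then show "zero_ext m G G' (vscale (sobolev0 m G) c U) = vscale (sobolev0 m G') c (zero_ext m G G' U)"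
      using u zext_in_S[OF u(1)] X.H_scale[OF u(1)]
      by (simp add: zero_ext_cls X.sobolev0_simps Y.sobolev0_simps X.S.scale_cls Y.S.scale_cls
          X.S_simps Y.S_simps)
  next
    fix U V assume "U \<in> vecs (sobolev0 m G)" "V \<in> vecs (sobolev0 m G)"
    with H obtain u v where u: "u \<in> X.H" "u \<in> vecs X.S" "U = cls X.S u"
      and v: "v \<in> X.H" "v \<in> vecs X.S" "V = cls X.S v" by meson
    have "zext G (\<lambda>x. u x + v x) = (\<lambda>x. zext G u x + zext G v x)" by (auto simp: zext_def)
    then show "zero_ext m G G' (vadd (sobolev0 m G) U V)
        = vadd (sobolev0 m G') (zero_ext m G G' U) (zero_ext m G G' V)"
      using u v zext_in_S[OF u(1)] zext_in_S[OF v(1)] X.H_add[OF u(1) v(1)]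
      by (simp add: zero_ext_cls X.sobolev0_simps Y.sobolev0_simps X.S.add_cls Y.S.add_cls
          X.S_simps Y.S_simps)
  qed
qed

end

section \<open>The two norm inequalities for zero extensions between domains\<close>

lemma bochner_isometry_zero_ext:
  assumes "is_domain G" "is_domain G'" "G \<subseteq> G'" "I \<in> sets lebesgue"
  shows "bochner_isometry (sobolev0 m G) (sobolev0 m G') (zero_ext m G G') I"
proof -
  interpret zero_extension m G G'
    using assms by unfold_locales (auto simp: is_domain_def)
  show ?thesis
    by (intro bochner_isometry.intro linear_isometry_zero_ext bochner_isometry_axioms.intro assms)
qed

theorem corollary3p12:
  fixes D \<Omega> Q :: "'a::euclidean_space set" and m :: nat and I :: "real set"
    and r_\<Omega> r_D :: "(real \<Rightarrow> ('a \<Rightarrow> real) set \<Rightarrow> real) set"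
  assumes "is_domain D" and "is_domain \<Omega>" and "is_domain Q"
    and "D \<subseteq> \<Omega>" and "\<Omega> \<subseteq> Q"
    and "is_interval I"
    and "r_\<Omega> \<in> vecs (bochner_L2 I (sobolev_neg m \<Omega>))"
    and "r_D = bochner_density I (sobolev0 m D)
                 (adjoint_on (bochner_L2 I (sobolev0 m D)) (bochner_zero_ext I m D \<Omega>)
                   (restrict (bochner_functional I (sobolev0 m \<Omega>) r_\<Omega>)
                             (vecs (bochner_L2 I (zero_ext_range m D \<Omega>)))))"
  shows "vnorm (bochner_L2 I (sobolev_neg m D)) r_D
           \<le> vnorm (bochner_L2 I (sobolev_neg m \<Omega>)) r_\<Omega> \<and>
         (\<forall>r_Q \<in> vecs (bochner_L2 I (sobolev_neg m Q)).
            bochner_functional I (sobolev0 m Q) r_Q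
              \<in> extensions (bochner_L2 I (zero_ext_range m \<Omega> Q)) (bochner_L2 I (sobolev0 m Q))
                  (adjoint_on (bochner_L2 I (zero_ext_range m \<Omega> Q)) (bochner_zero_restr I m \<Omega> Q)
                    (bochner_functional I (sobolev0 m \<Omega>) r_\<Omega>))
            \<longrightarrow> vnorm (bochner_L2 I (sobolev_neg m \<Omega>)) r_\<Omega>
                  \<le> vnorm (bochner_L2 I (sobolev_neg m Q)) r_Q)"
proof (intro conjI ballI impI)
  have I: "I \<in> sets lebesgue"
    using real_interval_borel_measurable[OF \<open>is_interval I\<close>] by (simp add: sets_completionI_sets)
  interpret D: bochner_isometry "sobolev0 m D" "sobolev0 m \<Omega>" "zero_ext m D \<Omega>" I
    by (rule bochner_isometry_zero_ext) (use assms I in auto)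
  interpret Q: bochner_isometry "sobolev0 m \<Omega>" "sobolev0 m Q" "zero_ext m \<Omega> Q" I
    by (rule bochner_isometry_zero_ext) (use assms I in auto)
  have lift: "bochner_zero_ext I m D \<Omega> = D.lift" "bochner_zero_ext I m \<Omega> Q = Q.lift"
    by (auto simp: fun_eq_iff bochner_zero_ext_def D.lift_def Q.lift_def zero_ext_range_def)
  have r: "r_\<Omega> \<in> vecs (bochner_L2 I (dual (sobolev0 m \<Omega>)))"
    using assms(7) by (simp add: sobolev_neg_def)
  have "r_D = D.pull r_\<Omega>"
    using assms(8) D.bochner_density_adjoint[OF r] by (simp add: lift zero_ext_range_def)
  then show "vnorm (bochner_L2 I (sobolev_neg m D)) r_D \<le> vnorm (bochner_L2 I (sobolev_neg m \<Omega>)) r_\<Omega>"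
    using D.norm_pull_le[OF r] by (simp add: sobolev_neg_def)
  fix r_Q assume q: "r_Q \<in> vecs (bochner_L2 I (sobolev_neg m Q))"
    and ext: "bochner_functional I (sobolev0 m Q) r_Q
      \<in> extensions (bochner_L2 I (zero_ext_range m \<Omega> Q)) (bochner_L2 I (sobolev0 m Q))
          (adjoint_on (bochner_L2 I (zero_ext_range m \<Omega> Q)) (bochner_zero_restr I m \<Omega> Q)
            (bochner_functional I (sobolev0 m \<Omega>) r_\<Omega>))"
  have q': "r_Q \<in> vecs (bochner_L2 I (dual (sobolev0 m Q)))"
    using q by (simp add: sobolev_neg_def)
  \<comment> \<open>Uniqueness of densities forces every admissible \<open>r_Q\<close> to pull back
    to \<open>r_\<Omega>\<close> itself, so contractivity of \<open>pull\<close> bounds the norm of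
    \<open>r_\<Omega>\<close>.\<close>
  have "Q.pull r_Q = r_\<Omega>"
    using ext by (intro Q.pull_extension r q') (simp add: bochner_zero_restr_def lift zero_ext_range_def)
  then show "vnorm (bochner_L2 I (sobolev_neg m \<Omega>)) r_\<Omega> \<le> vnorm (bochner_L2 I (sobolev_neg m Q)) r_Q"
    using Q.norm_pull_le[OF q'] by (simp add: sobolev_neg_def)
qed

end
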